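(* Let $(R,q)$ be a non-singular $2m$-dimensional quadratic space of plus type over $\mathbb{F}_2$, and let $\mathcal{S}$ be a maximal totally singular subspace of $(R^3,q^3)$. Then up to the action of $O(R,q)\wr\mathrm{Sym}_3$ on $R^3$, one of the following holds: (1) there exist non-zero singular vectors $a,b,c\in R$ such that $(a,0,0),(0,b,0),(0,0,c)\in\mathcal{S}$; (2) there exist non-zero singular vectors $a,b,c\in R$ such that $(a,b,0),(0,b,c)\in\mathcal{S}$; (3) $\mathcal{S}$ is conjugate to a subspace $\mathcal{S}(S_1,S_2,P,Q,T,\varphi)$ of the first kind (defined in the context); (4) $\mathcal{S}$ is conjugate to a subspace $\mathcal{S}(S_1,S_2,P,Q,B,T,z,\varphi)$ of the second kind (defined in the context).
   Context: A quadratic form $q$ on an even-dimensional $\mathbb{F}_2$-space $R$ has associated symplectic form $\langle a,b\rangle=q(a+b)+q(a)+q(b)$; $(R,q)$ is non-singular if $R^\perp=0$. A vector $a$ is singular if $q(a)=0$, non-singular if $q(a)=1$; a subspace is totally singular if all its vectors are singular. A non-singular $2m$-dimensional space is of plus (resp. minus) type if its maximal totally singular subspaces have dimension $m$ (resp. $m-1$). $O(R,q)$ is the group of linear automorphisms preserving $q$. On $R^3$ put $q^3(a_1,a_2,a_3)=q(a_1)+q(a_2)+q(a_3)$; $O(R,q)\wr\mathrm{Sym}_3$ acts coordinatewise and by permuting coordinates. $\perp$ between subspaces denotes orthogonal direct sum; $A^\perp$ is the orthogonal complement in $R$. First kind. Data: a $k_1$-dimensional totally singular subspace $S_1$ of $R$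 and a $k_2$-dimensional totally singular subspace $S_2$ of $S_1$ with $m-k_1-k_2$ even; an $(m-k_1-k_2)$-dimensional non-singular subspace $P$ of $S_1^\perp$ (of type $\varepsilon\in\{+,-\}$); a complementary subspace $Q$ of $S_1$ in $(S_1\perp P)^\perp$; a complementary subspace $T$ of $S_2$ in $(S_2\perp P)^\perp$; $U=Q^\perp$; an isomorphism of quadratic spaces $\varphi:T\to U$. Then $$\mathcal{S}(S_1,S_2,P,Q,T,\varphi)=\mathrm{Span}_{\mathbb{F}_2}\{(s_1,0,0),(0,s_2,0),(p,p,0),(q,0,q),(0,t,\varphi(t))\mid s_i\in S_i,\ p\in P,\ q\in Q,\ t\in T\}.$$ Second kind. Data: a $k_1$-dimensional totally singular subspace $S_1$ of $R$ and a $k_2$-dimensional totally singular subspace $S_2$ of $S_1$ with $m-k_1-k_2$ odd; an $(m-k_1-k_2-1)$-dimensional non-singular subspace $P$ of $S_1^\perp$ of plus type; an $(m-k_1+k_2-1)$-dimensional non-singular subspace $Q$ of $(S_1\perp P)^\perp$ of plus type; a complementary subspace $B$ of $S_1$ in $(S_1\perp P\perp Q)^\perp$ (a $2$-dimensional non-singular space of plus type); a complementary subspace $T$ of $S_2$ in $(P\perp S_2\perp B)^\perp$; $U=(Q\perp B)^\perp$; $y$ the non-singular vector of $B$; $z$ a non-zero singular vector of $B$; an isomorphism of quadratic spaces $\varphi:T\to U$. Then $$\mathcal{S}(S_1,S_2,P,Q,B,T,z,\varphi)=\mathrm{Span}_{\mathbb{F}_2}\{(s_1,0,0),(0,s_2,0),(p,p,0),(q,0,q),(0,t,\varphi(t)),(y,y,0),(y,0,y),(z,z,z)\mid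 s_i\in S_i,\ p\in P,\ q\in Q,\ t\in T\}.$$ *)

theory Defs
  imports
    Complex_Main
    "HOL-Library.Z2"
    "HOL-Library.Set_Algebras"
    "HOL-Library.Product_Plus"
    "HOL-Combinatorics.Permutations"
begin

text \<open>
  The field with two elements is the type \<^typ>\<open>bit\<close>.  The ambient space \<open>R\<close> is a whole type
  \<open>'v\<close> with scalar multiplication \<open>scale\<close>; subspaces of \<open>R\<close> are sets.  The predicates below are
  stated relative to a subspace \<open>W\<close>, with the restriction of \<open>q\<close> to it.
\<close>

definition polar :: "('v::ab_group_add \<Rightarrow> bit) \<Rightarrow> 'v \<Rightarrow> 'v \<Rightarrow> bit" where
  "polar q a b = q (a + b) + q a + q b"

definition quadratic_form :: "(bit \<Rightarrow> 'v::ab_group_add \<Rightarrow> 'v) \<Rightarrow> ('v \<Rightarrow> bit) \<Rightarrow> bool" where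
  "quadratic_form scale q \<longleftrightarrow>
     (\<forall>c v. q (scale c v) = c\<^sup>2 * q v) \<and>
     (\<forall>a. Vector_Spaces.linear scale (*) (\<lambda>b. polar q a b)) \<and>
     (\<forall>b. Vector_Spaces.linear scale (*) (\<lambda>a. polar q a b))"

definition perp :: "('v::ab_group_add \<Rightarrow> bit) \<Rightarrow> 'v set \<Rightarrow> 'v set" where
  "perp q A = {v. \<forall>a\<in>A. polar q v a = 0}"

definition nonsingular_subspace ::
  "(bit \<Rightarrow> 'v::ab_group_add \<Rightarrow> 'v) \<Rightarrow> ('v \<Rightarrow> bit) \<Rightarrow> 'v set \<Rightarrow> bool" where
  "nonsingular_subspace scale q W \<longleftrightarrow> module.subspace scale W \<and> W \<inter> perp q W = {0}"

definition totally_singular ::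
  "(bit \<Rightarrow> 'v::ab_group_add \<Rightarrow> 'v) \<Rightarrow> ('v \<Rightarrow> bit) \<Rightarrow> 'v set \<Rightarrow> bool" where
  "totally_singular scale q A \<longleftrightarrow> module.subspace scale A \<and> (\<forall>a\<in>A. q a = 0)"

definition maximal_totally_singular ::
  "(bit \<Rightarrow> 'v::ab_group_add \<Rightarrow> 'v) \<Rightarrow> ('v \<Rightarrow> bit) \<Rightarrow> 'v set \<Rightarrow> 'v set \<Rightarrow> bool" where
  "maximal_totally_singular scale q W M \<longleftrightarrow>
     totally_singular scale q M \<and> M \<subseteq> W \<and>
     (\<forall>N. totally_singular scale q N \<longrightarrow> M \<subseteq> N \<longrightarrow> N \<subseteq> W \<longrightarrow> N = M)"

definition plus_type ::
  "(bit \<Rightarrow> 'v::ab_group_add \<Rightarrow> 'v) \<Rightarrow> ('v \<Rightarrow> bit) \<Rightarrow> 'v set \<Rightarrow> bool" where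
  "plus_type scale q W \<longleftrightarrow>
     nonsingular_subspace scale q W \<and>
     (\<exists>n. vector_space.dim scale W = 2 * n \<and>
          (\<forall>M. maximal_totally_singular scale q W M \<longrightarrow> vector_space.dim scale M = n))"

definition complement_in ::
  "(bit \<Rightarrow> 'v::ab_group_add \<Rightarrow> 'v) \<Rightarrow> 'v set \<Rightarrow> 'v set \<Rightarrow> 'v set \<Rightarrow> bool" where
  "complement_in scale W A C \<longleftrightarrow>
     module.subspace scale C \<and> A \<inter> C = {0} \<and> A + C = W"

definition quadratic_iso ::
  "(bit \<Rightarrow> 'v::ab_group_add \<Rightarrow> 'v) \<Rightarrow> ('v \<Rightarrow> bit) \<Rightarrow> 'v set \<Rightarrow> 'v set \<Rightarrow> ('v \<Rightarrow> 'v) \<Rightarrow> bool" where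
  "quadratic_iso scale q T U \<phi> \<longleftrightarrow>
     bij_betw \<phi> T U \<and>
     (\<forall>s\<in>T. \<forall>t\<in>T. \<phi> (s + t) = \<phi> s + \<phi> t) \<and>
     (\<forall>c. \<forall>t\<in>T. \<phi> (scale c t) = scale c (\<phi> t)) \<and>
     (\<forall>t\<in>T. q (\<phi> t) = q t)"

definition orthogonal_group ::
  "(bit \<Rightarrow> 'v::ab_group_add \<Rightarrow> 'v) \<Rightarrow> ('v \<Rightarrow> bit) \<Rightarrow> ('v \<Rightarrow> 'v) set" where
  "orthogonal_group scale q =
     {g. Vector_Spaces.linear scale scale g \<and> bij g \<and> (\<forall>v. q (g v) = q v)}"

definition scale3 ::
  "(bit \<Rightarrow> 'v \<Rightarrow> 'v) \<Rightarrow> bit \<Rightarrow> 'v \<times> 'v \<times> 'v \<Rightarrow> 'v \<times> 'v \<times> 'v" where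
  "scale3 scale c = (\<lambda>(a1, a2, a3). (scale c a1, scale c a2, scale c a3))"

definition q3 :: "('v \<Rightarrow> bit) \<Rightarrow> 'v \<times> 'v \<times> 'v \<Rightarrow> bit" where
  "q3 q = (\<lambda>(a1, a2, a3). q a1 + q a2 + q a3)"

definition coord :: "'v \<times> 'v \<times> 'v \<Rightarrow> nat \<Rightarrow> 'v" where
  "coord = (\<lambda>(a1, a2, a3) i. if i = 1 then a1 else if i = 2 then a2 else a3)"

definition triple :: "(nat \<Rightarrow> 'v) \<Rightarrow> 'v \<times> 'v \<times> 'v" where
  "triple f = (f 1, f 2, f 3)"

text \<open>The image of the wreath product \<open>O(R,q) \<wr> Sym\<^sub>3\<close> in the group of transformations of \<open>R\<^sup>3\<close>.\<close>

definition wreath_action ::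
  "(bit \<Rightarrow> 'v::ab_group_add \<Rightarrow> 'v) \<Rightarrow> ('v \<Rightarrow> bit) \<Rightarrow> ('v \<times> 'v \<times> 'v \<Rightarrow> 'v \<times> 'v \<times> 'v) set" where
  "wreath_action scale q =
     {\<lambda>v. triple (\<lambda>i. g i (coord v (\<pi> i))) | g \<pi>.
        (\<forall>i\<in>{1..3}. g i \<in> orthogonal_group scale q) \<and> \<pi> permutes {1..3}}"

text \<open>
  In the two kinds of data below, orthogonal direct sums such as \<open>S\<^sub>1 \<bottom> P\<close> are written as
  sums of sets: the orthogonality conditions imposed, together with non-singularity of the
  summands, make them orthogonal and direct.  In the first kind \<open>P\<close> is an arbitrary
  non-singular space, i.e. its type \<open>\<epsilon>\<close> may be plus or minus.  Dimensions are compared as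
  integers to avoid truncated subtraction.
\<close>

definition first_kind_data ::
  "(bit \<Rightarrow> 'v::ab_group_add \<Rightarrow> 'v) \<Rightarrow> ('v \<Rightarrow> bit) \<Rightarrow> nat \<Rightarrow> nat \<Rightarrow> nat \<Rightarrow>
   'v set \<Rightarrow> 'v set \<Rightarrow> 'v set \<Rightarrow> 'v set \<Rightarrow> 'v set \<Rightarrow> ('v \<Rightarrow> 'v) \<Rightarrow> bool" where
  "first_kind_data scale q m k1 k2 S1 S2 P Q T \<phi> \<longleftrightarrow>
     totally_singular scale q S1 \<and> vector_space.dim scale S1 = k1 \<and>
     totally_singular scale q S2 \<and> vector_space.dim scale S2 = k2 \<and> S2 \<subseteq> S1 \<and>
     even (int m - int k1 - int k2) \<and>
     nonsingular_subspace scale q P \<and> P \<subseteq> perp q S1 \<and>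
     int (vector_space.dim scale P) = int m - int k1 - int k2 \<and>
     complement_in scale (perp q (S1 + P)) S1 Q \<and>
     complement_in scale (perp q (S2 + P)) S2 T \<and>
     quadratic_iso scale q T (perp q Q) \<phi>"

definition first_kind_space ::
  "(bit \<Rightarrow> 'v::ab_group_add \<Rightarrow> 'v) \<Rightarrow>
   'v set \<Rightarrow> 'v set \<Rightarrow> 'v set \<Rightarrow> 'v set \<Rightarrow> 'v set \<Rightarrow> ('v \<Rightarrow> 'v) \<Rightarrow> ('v \<times> 'v \<times> 'v) set" where
  "first_kind_space scale S1 S2 P Q T \<phi> =
     module.span (scale3 scale)
       ({(s, 0, 0) | s. s \<in> S1} \<union> {(0, s, 0) | s. s \<in> S2} \<union>
        {(p, p, 0) | p. p \<in> P} \<union> {(x, 0, x) | x. x \<in> Q} \<union>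
        {(0, t, \<phi> t) | t. t \<in> T})"

definition second_kind_data ::
  "(bit \<Rightarrow> 'v::ab_group_add \<Rightarrow> 'v) \<Rightarrow> ('v \<Rightarrow> bit) \<Rightarrow> nat \<Rightarrow> nat \<Rightarrow> nat \<Rightarrow>
   'v set \<Rightarrow> 'v set \<Rightarrow> 'v set \<Rightarrow> 'v set \<Rightarrow> 'v set \<Rightarrow> 'v set \<Rightarrow> 'v \<Rightarrow> 'v \<Rightarrow> ('v \<Rightarrow> 'v) \<Rightarrow> bool" where
  "second_kind_data scale q m k1 k2 S1 S2 P Q B T y z \<phi> \<longleftrightarrow>
     totally_singular scale q S1 \<and> vector_space.dim scale S1 = k1 \<and>
     totally_singular scale q S2 \<and> vector_space.dim scale S2 = k2 \<and> S2 \<subseteq> S1 \<and>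
     odd (int m - int k1 - int k2) \<and>
     plus_type scale q P \<and> P \<subseteq> perp q S1 \<and>
     int (vector_space.dim scale P) = int m - int k1 - int k2 - 1 \<and>
     plus_type scale q Q \<and> Q \<subseteq> perp q (S1 + P) \<and>
     int (vector_space.dim scale Q) = int m - int k1 + int k2 - 1 \<and>
     complement_in scale (perp q (S1 + P + Q)) S1 B \<and>
     plus_type scale q B \<and> vector_space.dim scale B = 2 \<and>
     complement_in scale (perp q (P + S2 + B)) S2 T \<and>
     y \<in> B \<and> q y = 1 \<and>
     z \<in> B \<and> z \<noteq> 0 \<and> q z = 0 \<and>
     quadratic_iso scale q T (perp q (Q + B)) \<phi>"

text \<open>
  The vector \<open>y\<close> is determined by \<open>B\<close>: a two-dimensional space of plus type has exactly one
  vector with \<open>q y = 1\<close>.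
\<close>

definition second_kind_space ::
  "(bit \<Rightarrow> 'v::ab_group_add \<Rightarrow> 'v) \<Rightarrow>
   'v set \<Rightarrow> 'v set \<Rightarrow> 'v set \<Rightarrow> 'v set \<Rightarrow> 'v set \<Rightarrow> 'v \<Rightarrow> 'v \<Rightarrow> ('v \<Rightarrow> 'v) \<Rightarrow>
   ('v \<times> 'v \<times> 'v) set" where
  "second_kind_space scale S1 S2 P Q T y z \<phi> =
     module.span (scale3 scale)
       ({(s, 0, 0) | s. s \<in> S1} \<union> {(0, s, 0) | s. s \<in> S2} \<union>
        {(p, p, 0) | p. p \<in> P} \<union> {(x, 0, x) | x. x \<in> Q} \<union>
        {(0, t, \<phi> t) | t. t \<in> T} \<union>
        {(y, y, 0), (y, 0, y), (z, z, z)})"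

end

theory Submission
  imports Defs
begin

text \<open>
  A maximal totally singular subspace \<open>S\<close> of \<open>R\<^sup>3\<close> equals its own orthogonal complement, because
  \<open>L \<times> L \<times> L\<close> does so for a maximal totally singular \<open>L\<close> in \<open>R\<close>
  (\<open>maximal_singular_imp_lagrangian\<close>).  Everything is read off from this self-duality.  Let
  \<open>S\<^sub>i\<close> be the set of entries of vectors of \<open>S\<close> supported on the coordinate \<open>i\<close>, and let
  \<open>A\<^sub>i\<^sub>j\<close> be the set of \<open>i\<close>-th entries of vectors of \<open>S\<close> supported on \<open>{i, j}\<close>.  Self-duality
  says that the projection of \<open>S\<close> to the first coordinate is the orthogonal complement of
  \<open>S\<^sub>1\<close>, and that \<open>A\<^sub>1\<^sub>2\<close> and \<open>A\<^sub>1\<^sub>3\<close> are orthogonal complements of each other; likewise for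
  the other coordinates.

  If all \<open>S\<^sub>i\<close> are non-zero, case (1) holds.  Otherwise permute the coordinates so that
  \<open>S\<^sub>3 = 0\<close> and \<open>S\<^sub>2\<close> is not larger than \<open>S\<^sub>1\<close>.  A vector \<open>a\<close> of \<open>D = A\<^sub>1\<^sub>2 \<inter> A\<^sub>1\<^sub>3\<close> comes
  with \<open>(a, b, 0)\<close> and \<open>(a, 0, c)\<close> in \<open>S\<close>, so that a singular \<open>a\<close> outside \<open>S\<^sub>1\<close> yields case (2).  If
  there is none, then \<open>q\<close>, which is additive on the totally isotropic space \<open>D\<close>, has kernel
  exactly \<open>S\<^sub>1\<close>; hence \<open>D = S\<^sub>1\<close>, or \<open>D\<close> is spanned by \<open>S\<^sub>1\<close> and one non-singular vector \<open>y\<close>.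

  In the case \<open>D = S\<^sub>1\<close>, take complements \<open>P\<close> and \<open>Q\<close> of \<open>S\<^sub>1\<close> in \<open>A\<^sub>1\<^sub>2\<close> and \<open>A\<^sub>1\<^sub>3\<close>.  Vectors
  \<open>(p, p', 0)\<close> and \<open>(x, 0, x')\<close> of \<open>S\<close> match \<open>P\<close> and \<open>Q\<close> isometrically with subspaces of the
  second and third coordinate, and Witt's theorem (\<open>witt_extension\<close>) moves these to \<open>P\<close> and
  \<open>Q\<close> and moves \<open>S\<^sub>2\<close> into \<open>S\<^sub>1\<close> (\<open>normalise_coordinates\<close>).  What remains is the graph of the
  isometry \<open>\<phi>\<close> (\<open>slot_graph_isometry\<close>), and \<open>S\<close> is of the first kind (\<open>first_kind\<close>).

  In the other case \<open>P\<close> and \<open>Q\<close> complement \<open>D\<close> instead.  Adding \<open>y\<close> to a vector of \<open>P\<close> changes the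
  value of \<open>q\<close>, but not the bilinear form, so \<open>P\<close> and \<open>Q\<close> can be chosen of plus type
  (\<open>exists_plus_type_complement\<close>).  Since \<open>R\<close> is of plus type, the plane that is left over is
  hyperbolic (\<open>plane_over_singular_hyperbolic\<close>).  This gives a singular \<open>z\<close> not orthogonal to \<open>y\<close>
  (\<open>exists_singular_partner\<close>) and a vector \<open>(z, b, c)\<close> of \<open>S\<close> with singular \<open>b\<close> and \<open>c\<close>
  (\<open>exists_singular_lift\<close>); Witt's theorem moves \<open>b\<close> and \<open>c\<close> to \<open>z\<close> as well, and \<open>S\<close> is of the
  second kind (\<open>second_kind\<close>).  In both cases the dimensions of \<open>P\<close> and \<open>Q\<close> follow from
  \<open>dim A + dim A\<^sup>\<bottom> = 2m\<close>.

  Over the field with two elements a subspace is just a set that contains \<open>0\<close> and is closed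
  under addition, and linear maps are the additive ones.  The geometry is therefore developed
  for abelian groups in which \<open>x + x = 0\<close>, where finite cardinalities take the place of
  dimensions; scalars and dimensions enter only at the end.
\<close>

section \<open>Subspaces over the field with two elements\<close>

definition f2_subspace :: "'a::ab_group_add set \<Rightarrow> bool" where
  "f2_subspace A \<longleftrightarrow> 0 \<in> A \<and> (\<forall>x\<in>A. \<forall>y\<in>A. x + y \<in> A)"

lemma f2_subspaceI: "0 \<in> A \<Longrightarrow> (\<And>x y. x \<in> A \<Longrightarrow> y \<in> A \<Longrightarrow> x + y \<in> A) \<Longrightarrow> f2_subspace A"
  by (simp add: f2_subspace_def)

lemma f2_subspace_0: "f2_subspace A \<Longrightarrow> 0 \<in> A"
  by (simp add: f2_subspace_def)

lemma f2_subspace_add: "f2_subspace A \<Longrightarrow> x \<in> A \<Longrightarrow> y \<in> A \<Longrightarrow> x + y \<in> A"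
  by (simp add: f2_subspace_def)

lemma f2_subspace_zero: "f2_subspace {0}"
  and f2_subspace_UNIV: "f2_subspace UNIV"
  and f2_subspace_Int: "f2_subspace A \<Longrightarrow> f2_subspace B \<Longrightarrow> f2_subspace (A \<inter> B)"
  by (auto simp: f2_subspace_def)

lemma f2_subspace_plus:
  assumes "f2_subspace A" "f2_subspace B"
  shows "f2_subspace (A + B)"
proof (rule f2_subspaceI)
  show "0 \<in> A + B"
    using assms by (auto simp: set_plus_def f2_subspace_def intro!: bexI[of _ 0])
  fix x y assume "x \<in> A + B" "y \<in> A + B"
  then obtain a b a' b' where "a \<in> A" "b \<in> B" "a' \<in> A" "b' \<in> B" "x = a + b" "y = a' + b'"
    by (auto simp: set_plus_def)
  moreover from this have "x + y = (a + a') + (b + b')"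
    by (simp add: algebra_simps)
  ultimately show "x + y \<in> A + B"
    using assms by (metis set_plus_intro f2_subspace_add)
qed

lemma subset_plus_left: "0 \<in> B \<Longrightarrow> A \<subseteq> A + B" for A B :: "'a::ab_group_add set"
  by (force simp: set_plus_def)

lemma subset_plus_right: "0 \<in> A \<Longrightarrow> B \<subseteq> A + B" for A B :: "'a::ab_group_add set"
  by (force simp: set_plus_def)

lemma plus_subset_iff:
  "f2_subspace A \<Longrightarrow> f2_subspace B \<Longrightarrow> f2_subspace C \<Longrightarrow> A + B \<subseteq> C \<longleftrightarrow> A \<subseteq> C \<and> B \<subseteq> C"
  using subset_plus_left[of B A] subset_plus_right[of A B]
  by (auto simp: set_plus_def f2_subspace_0 f2_subspace_add subset_iff)

lemma exists_maximal_above: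
  fixes A :: "'a set"
  assumes "finite (UNIV :: 'a set)" and "P A"
  obtains M where "P M" "A \<subseteq> M" "\<And>N. P N \<Longrightarrow> M \<subseteq> N \<Longrightarrow> N = M"
proof -
  have "finite {B. P B}"
    by (rule finite_subset[OF subset_UNIV]) (simp add: assms(1) Finite_Set.finite_set)
  with finite_has_maximal2[of "{B. P B}" A] assms(2) that show thesis
    by auto
qed

locale char_two =
  fixes space_type :: "'a::ab_group_add itself"
  assumes add_self [simp]: "x + x = (0 :: 'a)"
    and finite_space: "finite (UNIV :: 'a set)"
begin

lemma finite_set: "finite (A :: 'a set)"
  by (rule finite_subset[OF subset_UNIV finite_space])

lemma add_self_left [simp]: "x + (x + y) = (y :: 'a)"
  by (simp flip: add.assoc)

lemma add_eq_0_iff_eq: "x + y = 0 \<longleftrightarrow> x = (y :: 'a)"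
  by (metis add.right_neutral add_self_left)

lemma f2_subspace_line: "f2_subspace {0, x :: 'a}"
  by (auto simp: f2_subspace_def)

lemma inj_on_plus_direct:
  assumes "f2_subspace A" "f2_subspace B" "A \<inter> B = {0 :: 'a}"
  shows "inj_on (\<lambda>(a, b). a + b) (A \<times> B)"
proof (rule inj_onI, clarsimp)
  fix a b a' b' assume *: "a \<in> A" "b \<in> B" "a' \<in> A" "b' \<in> B" "a + b = a' + b'"
  then have "a + a' = b + b'"
    by (metis add.commute add_self_left add.assoc)
  moreover from * assms have "a + a' \<in> A" "b + b' \<in> B"
    by (auto intro: f2_subspace_add)
  ultimately have "a + a' = 0" "b + b' = 0"
    using assms(3) by auto
  then show "a = a' \<and> b = b'"
    by (simp add: add_eq_0_iff_eq)
qed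

lemma card_plus_direct:
  assumes "f2_subspace A" "f2_subspace B" "A \<inter> B = {0 :: 'a}"
  shows "card (A + B) = card A * card B"
proof -
  have "A + B = (\<lambda>(a, b). a + b) ` (A \<times> B)"
    by (auto simp: set_plus_def)
  then show ?thesis
    using card_image[OF inj_on_plus_direct[OF assms]] by (simp add: card_cartesian_product)
qed

text \<open>
  Being able to prescribe a part \<open>C\<close> of the complement matters in
  \<open>exists_plus_type_complement\<close>, where \<open>C\<close> is a totally singular space of the largest possible
  dimension.
\<close>

lemma exists_complement_above:
  fixes W A C :: "'a set"
  assumes "f2_subspace W" "f2_subspace A" "f2_subspace C" "A \<subseteq> W" "C \<subseteq> W" "A \<inter> C = {0}"
  obtains D where "f2_subspace D" "C \<subseteq> D" "D \<subseteq> W" "A \<inter> D = {0}" "A + D = W"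
proof -
  define P where "P D \<longleftrightarrow> f2_subspace D \<and> D \<subseteq> W \<and> A \<inter> D = {0}" for D
  obtain D where D: "P D" "C \<subseteq> D" and max: "\<And>N. P N \<Longrightarrow> D \<subseteq> N \<Longrightarrow> N = D"
    using exists_maximal_above[OF finite_space, of P C] assms unfolding P_def by blast
  have "W \<subseteq> A + D"
  proof
    fix w assume "w \<in> W"
    show "w \<in> A + D"
    proof (rule ccontr)
      assume w: "w \<notin> A + D"
      have "x = 0" if "x \<in> A" "d \<in> D" "x = d + e" "e = 0 \<or> e = w" for x d e
      proof (cases "e = 0")
        case True
        with that D(1) show ?thesis by (auto simp: P_def)
      next
        case False
        with that have "w = x + d" by (simp add: add.commute)
        with that w show ?thesis by auto
      qed
      moreover have "0 \<in> D + {0, w}" "D \<subseteq> D + {0, w}" "w \<in> D + {0, w}"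
        using D(1) subset_plus_left[of "{0, w}" D] subset_plus_right[of D "{0, w}"]
        by (auto simp: P_def f2_subspace_def)
      moreover have "D + {0, w} \<subseteq> W"
        using plus_subset_iff[OF _ f2_subspace_line assms(1), of D w] D(1) assms \<open>w \<in> W\<close>
        by (auto simp: P_def f2_subspace_def)
      ultimately have "P (D + {0, w})"
        using D(1) f2_subspace_plus[OF _ f2_subspace_line, of D w] assms(2)
        by (auto simp: P_def f2_subspace_0 set_plus_def)
      with max \<open>D \<subseteq> D + {0, w}\<close> \<open>w \<in> D + {0, w}\<close> have "w \<in> D" by blast
      with w assms(2) subset_plus_right[of A D] show False by (auto simp: f2_subspace_0)
    qed
  qed
  moreover have "A + D \<subseteq> W"
    using plus_subset_iff[of A D W] D(1) assms by (auto simp: P_def)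
  ultimately have "A + D = W"
    by blast
  with that[of D] D show thesis
    by (simp add: P_def)
qed

lemma exists_complement:
  fixes W A :: "'a set"
  assumes "f2_subspace W" "f2_subspace A" "A \<subseteq> W"
  obtains D where "f2_subspace D" "D \<subseteq> W" "A \<inter> D = {0}" "A + D = W"
proof -
  have "{0} \<subseteq> W" "A \<inter> {0} = {0}"
    using f2_subspace_0[OF assms(1)] f2_subspace_0[OF assms(2)] by auto
  then show thesis
    by (rule exists_complement_above[OF assms(1,2) f2_subspace_zero assms(3)]) (rule that)
qed

end

lemma char_two_prod:
  assumes "char_two TYPE('a::ab_group_add)" "char_two TYPE('b::ab_group_add)"
  shows "char_two TYPE('a \<times> 'b)"
proof -
  interpret a: char_two "TYPE('a)" by fact
  interpret b: char_two "TYPE('b)" by fact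
  show ?thesis
    using a.finite_space b.finite_space
    by unfold_locales (auto simp: zero_prod_def finite_prod)
qed

section \<open>Quadratic forms over the field with two elements\<close>

lemma bit_add_self [simp]: "x + x = (0 :: bit)"
  by (cases x) simp_all

text \<open>
  The non-trivial character of the additive group of the field.
\<close>

definition bit_sign :: "bit \<Rightarrow> int" where "bit_sign b = (if b = 0 then 1 else -1)"

locale f2_quadratic_space =
  fixes q :: "'v::ab_group_add \<Rightarrow> bit"
  assumes char_two: "char_two TYPE('v)"
    and polar_add_left: "polar q (a + b) c = polar q a c + polar q b c"
    and nondegenerate: "(\<And>b. polar q a b = 0) \<Longrightarrow> a = 0"
begin

sublocale char_two "TYPE('v)"
  by (rule char_two)

lemma polar_commute: "polar q a b = polar q b a"
  by (simp only: polar_def ac_simps)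

lemma polar_add_right: "polar q a (b + c) = polar q a b + polar q a c"
  by (metis polar_add_left polar_commute)

lemma polar_0 [simp]: "polar q 0 b = 0" "polar q a 0 = 0"
  by (metis add_cancel_right_left polar_add_left add.right_neutral)
     (metis add_cancel_right_left polar_add_right add.right_neutral)

lemma q_0 [simp]: "q 0 = 0"
  using polar_0(1)[of 0] by (simp add: polar_def)

lemma polar_self [simp]: "polar q a a = 0"
  by (simp add: polar_def)

lemma q_add: "q (a + b) = q a + q b + polar q a b"
proof -
  have "x = y + z + (x + y + z)" for x y z :: bit
    by (cases x; cases y; cases z) simp_all
  then show ?thesis
    unfolding polar_def by blast
qed

lemma perp_iff: "v \<in> perp q A \<longleftrightarrow> (\<forall>a\<in>A. polar q v a = 0)"
  by (simp add: perp_def)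

lemma perpD: "v \<in> perp q A \<Longrightarrow> a \<in> A \<Longrightarrow> polar q v a = 0" "v \<in> perp q A \<Longrightarrow> a \<in> A \<Longrightarrow> polar q a v = 0"
  by (simp_all add: perp_def polar_commute)

lemma f2_subspace_perp: "f2_subspace (perp q A)"
  by (auto simp: f2_subspace_def perp_def polar_add_left)

lemma perp_anti_mono: "A \<subseteq> B \<Longrightarrow> perp q B \<subseteq> perp q A"
  by (auto simp: perp_def)

lemma perp_plus:
  assumes "0 \<in> A" "0 \<in> B"
  shows "perp q (A + B) = perp q A \<inter> perp q B"
proof
  show "perp q (A + B) \<subseteq> perp q A \<inter> perp q B"
    using perp_anti_mono[OF subset_plus_left[OF assms(2), of A]]
      perp_anti_mono[OF subset_plus_right[OF assms(1), of B]] by simp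
  show "perp q A \<inter> perp q B \<subseteq> perp q (A + B)"
    by (auto simp: perp_def set_plus_def polar_add_right)
qed

lemma perp_UNIV: "perp q UNIV = {0}"
  using nondegenerate by (auto simp: perp_def)

lemma character_sum:
  assumes "f2_subspace W"
  shows "(\<Sum>v\<in>W. bit_sign (polar q v a)) = (if a \<in> perp q W then int (card W) else 0)"
proof (cases "a \<in> perp q W")
  case True
  then show ?thesis by (simp add: perpD bit_sign_def)
next
  case False
  then obtain w where w: "w \<in> W" "polar q w a = 1"
    by (auto simp: perp_def polar_commute)
  \<comment> \<open>Translation by a vector \<open>w\<close> not orthogonal to \<open>a\<close> permutes \<open>W\<close> and flips every sign.\<close>
  have "(\<Sum>v\<in>W. bit_sign (polar q v a)) = (\<Sum>v\<in>W. bit_sign (polar q (v + w) a))"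
    by (rule sum.reindex_bij_witness[where i = "\<lambda>v. v + w" and j = "\<lambda>v. v + w"])
       (use assms w in \<open>auto simp: add.assoc intro: f2_subspace_add\<close>)
  also have "\<dots> = (\<Sum>v\<in>W. - bit_sign (polar q v a))"
  proof (rule sum.cong)
    fix v show "bit_sign (polar q (v + w) a) = - bit_sign (polar q v a)"
      using w(2) by (cases "polar q v a") (simp_all add: polar_add_left bit_sign_def)
  qed simp
  also have "\<dots> = - (\<Sum>v\<in>W. bit_sign (polar q v a))"
    by (rule sum_negf)
  finally have "(\<Sum>v\<in>W. bit_sign (polar q v a)) = 0"
    by (simp only: equal_neg_zero)
  with False show ?thesis
    by simp
qed

text \<open>
  Both sides evaluate the sum of the signs of \<open>\<langle>v, a\<rangle>\<close> over \<open>W \<times> A\<close>, in the two orders of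
  summation.  This replaces all dimension formulas for orthogonal complements, including the
  relative ones inside a non-singular \<open>W\<close>.
\<close>

lemma card_perp:
  assumes "f2_subspace A" "f2_subspace W"
  shows "card W * card (A \<inter> perp q W) = card A * card (W \<inter> perp q A)"
proof -
  have sum_A: "(\<Sum>a\<in>X. \<Sum>v\<in>Y. bit_sign (polar q v a)) = int (card Y * card (X \<inter> perp q Y))"
    if "f2_subspace Y" for X Y
    using that by (simp add: finite_set character_sum sum.If_cases)
  have "int (card W * card (A \<inter> perp q W)) = (\<Sum>a\<in>A. \<Sum>v\<in>W. bit_sign (polar q v a))"
    by (simp only: sum_A[OF assms(2)])
  also have "\<dots> = (\<Sum>v\<in>W. \<Sum>a\<in>A. bit_sign (polar q a v))"
    by (subst sum.swap) (simp add: polar_commute)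
  also have "\<dots> = int (card A * card (W \<inter> perp q A))"
    by (simp only: sum_A[OF assms(1)])
  finally show ?thesis
    by linarith
qed

lemma double_perp_in:
  assumes "f2_subspace W" "W \<inter> perp q W = {0}" "f2_subspace A" "A \<subseteq> W"
  shows "W \<inter> perp q (W \<inter> perp q A) = A"
proof -
  define A' where "A' = W \<inter> perp q A"
  have sub: "f2_subspace A'"
    using assms by (simp add: A'_def f2_subspace_Int f2_subspace_perp)
  have triv: "X \<inter> perp q W = {0}" if "f2_subspace X" "X \<subseteq> W" for X
    using that assms(2) f2_subspace_0[OF that(1)] f2_subspace_0[OF f2_subspace_perp] by blast
  have "card A' * card A = card A' * card (W \<inter> perp q A')"
    using card_perp[OF assms(3,1)] card_perp[OF sub assms(1)] triv[OF assms(3,4)] triv[OF sub]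
    by (simp add: A'_def mult.commute)
  moreover have "card A' > 0"
    using f2_subspace_0[OF sub] by (auto simp: finite_set card_gt_0_iff)
  moreover have "A \<subseteq> W \<inter> perp q A'"
    using assms(4) by (auto simp: A'_def perp_def polar_commute)
  ultimately show ?thesis
    using card_subset_eq[of "W \<inter> perp q A'" A] f2_subspace_0[OF sub]
    by (auto simp: finite_set simp flip: A'_def)
qed

lemma double_perp: "f2_subspace A \<Longrightarrow> perp q (perp q A) = A"
  using double_perp_in[of UNIV A] by (simp add: perp_UNIV f2_subspace_UNIV)

lemma plus_perp_eq_UNIV:
  assumes "f2_subspace N" "N \<inter> perp q N = {0}"
  shows "N + perp q N = UNIV"
proof -
  have "perp q (N + perp q N) = {0}"
    using assms by (simp add: perp_plus double_perp f2_subspace_0 f2_subspace_perp Int_commute)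
  then have "perp q (perp q (N + perp q N)) = UNIV"
    by (simp add: perp_def)
  then show ?thesis
    using assms double_perp f2_subspace_plus f2_subspace_perp by metis
qed

text \<open>
  Applied with \<open>A = A\<^sup>\<bottom>\<close>, this turns orthogonality to the vectors of \<open>A\<close> supported on some of the
  coordinates into membership in a projection of \<open>A\<close>.
\<close>

lemma perp_Int_perp:
  assumes "f2_subspace A" "f2_subspace B"
  shows "perp q (A \<inter> perp q B) = perp q A + B"
proof -
  have "perp q (perp q A + B) = A \<inter> perp q B"
    using assms by (simp add: perp_plus double_perp f2_subspace_0 f2_subspace_perp)
  then show ?thesis
    using double_perp f2_subspace_plus assms f2_subspace_perp by metis
qed

section \<open>Self-perpendicular totally singular subspaces\<close>

text \<open>
  Self-perpendicularity is taken relative to \<open>W\<close>; for non-singular \<open>W\<close> such an \<open>M\<close> has half the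
  dimension of \<open>W\<close>, so its existence means that \<open>W\<close> is of plus type.
\<close>

definition lagrangian :: "'v set \<Rightarrow> 'v set \<Rightarrow> bool" where
  "lagrangian W M \<longleftrightarrow> f2_subspace M \<and> (\<forall>v\<in>M. q v = 0) \<and> W \<inter> perp q M = M"

text \<open>
  The notion \<^const>\<open>maximal_totally_singular\<close> stripped of the scalar multiplication.
\<close>

definition maximal_singular :: "'v set \<Rightarrow> 'v set \<Rightarrow> bool" where
  "maximal_singular W M \<longleftrightarrow> f2_subspace M \<and> (\<forall>v\<in>M. q v = 0) \<and> M \<subseteq> W \<and>
     (\<forall>N. f2_subspace N \<longrightarrow> (\<forall>v\<in>N. q v = 0) \<longrightarrow> M \<subseteq> N \<longrightarrow> N \<subseteq> W \<longrightarrow> N = M)"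

lemma polar_singular:
  assumes "f2_subspace M" "\<forall>v\<in>M. q v = 0" "x \<in> M" "y \<in> M"
  shows "polar q x y = 0"
  using assms f2_subspace_add[of M x y] by (simp add: polar_def)

text \<open>
  One Lagrangian subspace \<open>M\<close> forces all maximal totally singular subspaces \<open>S\<close> to be Lagrangian.
  Maximality absorbs \<open>M \<inter> S\<^sup>\<bottom>\<close> into \<open>S\<close>.  Dualising, every \<open>v\<close> in \<open>S\<^sup>\<bottom>\<close> has the form \<open>s + \<mu>\<close> with
  \<open>\<mu> \<in> M\<close>; then \<open>\<mu>\<close> lies in \<open>M \<inter> S\<^sup>\<bottom>\<close>, hence in \<open>S\<close>, and so does \<open>v\<close>.
\<close>

lemma maximal_singular_imp_lagrangian:
  assumes W: "f2_subspace W" "W \<inter> perp q W = {0}"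
    and M: "lagrangian W M" and S: "maximal_singular W S"
  shows "lagrangian W S"
proof -
  have subM: "f2_subspace M" and qM: "\<forall>v\<in>M. q v = 0" and MM: "W \<inter> perp q M = M"
    using M by (auto simp: lagrangian_def)
  have subS: "f2_subspace S" and qS: "\<forall>v\<in>S. q v = 0" and SW: "S \<subseteq> W"
    using S by (auto simp: maximal_singular_def)
  define X where "X = M \<inter> perp q S"
  have subX: "f2_subspace X"
    by (simp add: X_def subM f2_subspace_Int f2_subspace_perp)
  have "S + X = S"
  proof -
    have "\<forall>v\<in>S + X. q v = 0"
      using qS qM by (auto simp: set_plus_def X_def q_add perpD)
    moreover have "S + X \<subseteq> W"
      using plus_subset_iff[OF subS subX W(1)] SW MM by (auto simp: X_def)
    ultimately show ?thesis
      using S f2_subspace_plus[OF subS subX] subset_plus_left[OF f2_subspace_0[OF subX]]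
      by (auto simp: maximal_singular_def)
  qed
  then have XS: "X \<subseteq> S"
    using subset_plus_right[OF f2_subspace_0[OF subS], of X] by simp
  have "W \<inter> perp q (S + M) = X"
    using MM by (auto simp: X_def perp_plus f2_subspace_0 subS subM)
  then have perpX: "W \<inter> perp q X = S + M"
    using double_perp_in[OF W f2_subspace_plus[OF subS subM]] SW MM
      plus_subset_iff[OF subS subM W(1)] by auto
  have "v \<in> S" if v: "v \<in> W" "v \<in> perp q S" for v
  proof -
    have "v \<in> W \<inter> perp q X"
      using v XS perp_anti_mono by blast
    then obtain s \<mu> where s: "s \<in> S" "\<mu> \<in> M" "v = s + \<mu>"
      unfolding perpX by (auto simp: set_plus_def)
    have "\<mu> = s + v"
      using s(3) by simp
    moreover have "s \<in> perp q S"
      using s(1) polar_singular[OF subS qS] by (simp add: perp_def)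
    ultimately have "\<mu> \<in> perp q S"
      using f2_subspace_add[OF f2_subspace_perp] v(2) by simp
    then have "\<mu> \<in> S"
      using XS s(2) by (auto simp: X_def)
    then show ?thesis
      using s f2_subspace_add[OF subS] by simp
  qed
  moreover have "S \<subseteq> perp q S"
    using polar_singular[OF subS qS] by (auto simp: perp_def)
  ultimately show ?thesis
    using subS qS SW by (auto simp: lagrangian_def)
qed

lemma exists_maximal_singular:
  assumes "f2_subspace N" "\<forall>v\<in>N. q v = 0" "N \<subseteq> W"
  obtains M where "maximal_singular W M" "N \<subseteq> M"
proof -
  obtain M where "f2_subspace M \<and> (\<forall>v\<in>M. q v = 0) \<and> M \<subseteq> W" "N \<subseteq> M"
    "\<And>K. f2_subspace K \<and> (\<forall>v\<in>K. q v = 0) \<and> K \<subseteq> W \<Longrightarrow> M \<subseteq> K \<Longrightarrow> K = M"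
    using exists_maximal_above[OF finite_space,
        of "\<lambda>M. f2_subspace M \<and> (\<forall>v\<in>M. q v = 0) \<and> M \<subseteq> W" N] assms
    by blast
  then show thesis
    using that[of M] by (auto simp: maximal_singular_def)
qed

lemma card_lagrangian:
  assumes "f2_subspace W" "W \<inter> perp q W = {0}" "lagrangian W M"
  shows "card W = card M * card M"
proof -
  have "M \<inter> perp q W = {0}"
    using assms f2_subspace_0[of M] f2_subspace_0[OF f2_subspace_perp, of W]
    by (auto simp: lagrangian_def)
  then show ?thesis
    using card_perp[of M W] assms by (simp add: lagrangian_def)
qed

text \<open>
  A maximal totally isotropic subspace is its own orthogonal complement in \<open>W\<close>, because the
  bilinear form is alternating.  This is the source of the parity of \<open>m - k\<^sub>1 - k\<^sub>2\<close> in the first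
  kind.
\<close>

lemma nonsingular_square_card:
  assumes W: "f2_subspace W" "W \<inter> perp q W = {0}"
  obtains L :: "'v set" where "f2_subspace L" "card W = card L * card L"
proof -
  define P where "P L \<longleftrightarrow> f2_subspace L \<and> L \<subseteq> W \<inter> perp q L" for L
  have "P {0}"
    using f2_subspace_0[OF W(1)] by (simp add: P_def f2_subspace_zero perp_def)
  then obtain L where L: "P L" and max: "\<And>N. P N \<Longrightarrow> L \<subseteq> N \<Longrightarrow> N = L"
    using exists_maximal_above[OF finite_space, of P] by metis
  have "v \<in> L" if v: "v \<in> W" "v \<in> perp q L" for v
  proof -
    have sub: "f2_subspace L" "L \<subseteq> W" "L \<subseteq> perp q L"
      using L by (auto simp: P_def)
    have "L + {0, v} \<subseteq> W"
      using plus_subset_iff[OF sub(1) f2_subspace_line W(1)] sub(2) v(1) f2_subspace_0[OF W(1)]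
      by simp
    moreover have "L + {0, v} \<subseteq> perp q (L + {0, v})"
    proof -
      have "L + {0, v} \<subseteq> perp q L"
        using plus_subset_iff[OF sub(1) f2_subspace_line f2_subspace_perp, of v L]
          sub(3) v(2) f2_subspace_0[OF f2_subspace_perp, of L] by simp
      moreover have "L + {0, v} \<subseteq> perp q {0, v}"
        using plus_subset_iff[OF sub(1) f2_subspace_line f2_subspace_perp, of v "{0, v}"] v(2)
        by (auto simp: perp_def polar_commute)
      ultimately show ?thesis
        by (simp add: perp_plus f2_subspace_0[OF sub(1)])
    qed
    ultimately have "P (L + {0, v})"
      using f2_subspace_plus[OF sub(1) f2_subspace_line] by (simp add: P_def)
    then have "L + {0, v} = L"
      using max subset_plus_left by blast
    then show ?thesis
      using subset_plus_right[of L "{0, v}"] L by (auto simp: P_def f2_subspace_0)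
  qed
  then have "W \<inter> perp q L = L"
    using L by (auto simp: P_def)
  moreover have "L \<inter> perp q W = {0}"
    using L assms f2_subspace_0[of L] f2_subspace_0[OF f2_subspace_perp, of W]
    by (auto simp: P_def)
  ultimately show thesis
    using card_perp[of L W] L W(1) by (intro that) (auto simp: P_def)
qed

end

definition bit_scale :: "bit \<Rightarrow> 'a::ab_group_add \<Rightarrow> 'a" where
  "bit_scale c v = (if c = 0 then 0 else v)"

lemma bit_scale_simps [simp]: "bit_scale 0 v = 0" "bit_scale 1 v = v"
  by (simp_all add: bit_scale_def)

context f2_quadratic_space
begin

lemma maximal_singular_absorbs:
  assumes N: "maximal_singular W N" and W: "f2_subspace W"
    and v: "v \<in> W" "v \<in> perp q N" "q v = 0"
  shows "v \<in> N"
proof -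
  have subN: "f2_subspace N" "\<forall>v\<in>N. q v = 0" "N \<subseteq> W"
    using N by (auto simp: maximal_singular_def)
  have "\<forall>x\<in>N + {0, v}. q x = 0"
    using subN(2) v by (auto simp: set_plus_def q_add perpD)
  moreover have "N + {0, v} \<subseteq> W"
    using plus_subset_iff[OF subN(1) f2_subspace_line W] subN(3) v(1) f2_subspace_0[OF W] by simp
  ultimately have "N + {0, v} = N"
    using N f2_subspace_plus[OF subN(1) f2_subspace_line] subset_plus_left[of "{0, v}" N]
    by (simp add: maximal_singular_def)
  then show ?thesis
    using subset_plus_right[OF f2_subspace_0[OF subN(1)], of "{0, v}"] by simp
qed

lemma complement_of_radical_nonsingular:
  assumes W: "f2_subspace W" "W \<inter> perp q W = D"
    and P: "f2_subspace P" "D \<inter> P = {0}" "D + P = W"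
  shows "P \<inter> perp q P = {0}"
proof -
  have D: "f2_subspace D"
    using W by (metis f2_subspace_Int f2_subspace_perp)
  have "x \<in> D" if x: "x \<in> P" "x \<in> perp q P" for x
  proof -
    have PW: "P \<subseteq> W"
      using subset_plus_right[OF f2_subspace_0[OF D], of P] P(3) by simp
    have "x \<in> perp q D"
      using x(1) PW W(2) by (auto simp: perp_def polar_commute)
    then have "x \<in> perp q W"
      using x(2) perp_plus[OF f2_subspace_0[OF D] f2_subspace_0[OF P(1)]] P(3) by simp
    then show ?thesis
      using x(1) PW W(2) by blast
  qed
  then show ?thesis
    using P(2) f2_subspace_0[OF P(1)] f2_subspace_0[OF f2_subspace_perp] by blast
qed

text \<open>
  The radical \<open>S + {0, y}\<close> of \<open>W\<close> contains a non-singular vector, so a maximal totally singular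
  \<open>N\<close> of \<open>W\<close> has only \<open>N + {0, y}\<close> orthogonal to it: a vector \<open>x\<close> orthogonal to \<open>N\<close>, or else \<open>x + y\<close>,
  is singular.  Complementing the radical by a space \<open>P\<close> that contains a complement \<open>M\<close> of \<open>S\<close> in
  \<open>N\<close> makes \<open>M\<close> Lagrangian in \<open>P\<close>.
\<close>

lemma exists_plus_type_complement:
  assumes W: "f2_subspace W" "W \<inter> perp q W = S + {0, y}"
    and S: "f2_subspace S" "\<forall>s\<in>S. q s = 0" and y: "q y = 1"
  obtains P M where "f2_subspace P" "(S + {0, y}) \<inter> P = {0}" "S + {0, y} + P = W"
    "P \<inter> perp q P = {0}" "lagrangian P M"
proof -
  define D where "D = S + {0, y}"
  have D: "f2_subspace D" "D \<subseteq> W" "D \<subseteq> perp q W"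
    using f2_subspace_plus[OF S(1) f2_subspace_line] W(2) by (auto simp: D_def)
  have SD: "S \<subseteq> D" and yD: "y \<in> D"
    using subset_plus_left[of "{0, y}" S] subset_plus_right[OF f2_subspace_0[OF S(1)], of "{0, y}"]
    by (auto simp: D_def)
  obtain N where N: "maximal_singular W N" "S \<subseteq> N"
    using exists_maximal_singular[OF S, of W] SD D(2) by blast
  have subN: "f2_subspace N" "\<forall>v\<in>N. q v = 0" "N \<subseteq> W"
    using N by (auto simp: maximal_singular_def)
  have ND: "n \<in> S" if n: "n \<in> N" "n \<in> D" for n
  proof -
    obtain s e where s: "s \<in> S" "e \<in> {0, y}" "n = s + e"
      using n(2) unfolding D_def by (blast elim: set_plus_elim)
    have "polar q s y = 0"
      using SD D s(1) yD perpD(1)[of s W y] by blast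
    moreover have "q n = 0"
      using that subN(2) by simp
    ultimately have "e = 0"
      using s S(2) y by (auto simp: q_add)
    with s show ?thesis by simp
  qed
  obtain M where M: "f2_subspace M" "M \<subseteq> N" "S \<inter> M = {0}" "S + M = N"
    using exists_complement[OF subN(1) S(1) N(2)] by blast
  have "D \<inter> M = {0}"
    using ND M f2_subspace_0[OF M(1)] f2_subspace_0[OF D(1)] by blast
  then obtain P where P: "f2_subspace P" "M \<subseteq> P" "P \<subseteq> W" "D \<inter> P = {0}" "D + P = W"
    using exists_complement_above[OF W(1) D(1) M(1) D(2)] M(2) subN(3) by (metis order_trans)
  have nonsing: "P \<inter> perp q P = {0}"
    by (rule complement_of_radical_nonsingular[OF W(1) _ P(1,4,5)]) (simp add: W(2) D_def)
  have "x \<in> M" if x: "x \<in> P" "x \<in> perp q M" for x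
  proof -
    have xW: "x \<in> W"
      using x(1) P(3) by blast
    have "x \<in> perp q S" and xy: "polar q x y = 0"
      using xW SD yD D(3) by (auto simp: perp_def polar_commute)
    then have xN: "x \<in> perp q N"
      using x(2) M(4) perp_plus[OF f2_subspace_0[OF S(1)] f2_subspace_0[OF M(1)]] by simp
    have "x \<in> N + {0, y}"
    proof (cases "q x = 0")
      case True
      then have "x \<in> N"
        by (rule maximal_singular_absorbs[OF N(1) W(1) xW xN])
      then show ?thesis
        using subset_plus_left[of "{0, y}" N] by auto
    next
      case False
      then have 1: "q x = 1" by simp
      have "y \<in> perp q N"
        using yD D(3) subN(3) perp_anti_mono by blast
      then have "x + y \<in> N"
        using maximal_singular_absorbs[OF N(1) W(1), of "x + y"] xW xN yD D(2) 1 y xy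
          f2_subspace_add[OF W(1)] f2_subspace_add[OF f2_subspace_perp]
        by (auto simp: q_add)
      then have "(x + y) + y \<in> N + {0, y}"
        by (intro set_plus_intro) auto
      then show ?thesis
        by (simp add: add.assoc)
    qed
    then obtain n e where n: "n \<in> N" "e \<in> {0, y}" "x = n + e"
      by (blast elim: set_plus_elim)
    then obtain s \<mu> where "s \<in> S" "\<mu> \<in> M" "n = s + \<mu>"
      unfolding M(4)[symmetric] by (blast elim: set_plus_elim)
    with n have *: "s \<in> S" "\<mu> \<in> M" "e \<in> {0, y}" "x = s + \<mu> + e"
      by simp_all
    then have "x + \<mu> = s + e"
      by (simp add: ac_simps)
    moreover have "s + e \<in> D"
      using * by (auto simp: D_def)
    moreover have "x + \<mu> \<in> P"
      using x * P(2) f2_subspace_add[OF P(1)] by blast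
    ultimately have "x + \<mu> = 0"
      using P(4) by auto
    then have "x = \<mu>"
      by (simp only: add_eq_0_iff_eq)
    then show ?thesis
      using *(2) by (simp only:)
  qed
  moreover have "M \<subseteq> perp q M"
    using polar_singular[OF M(1)] subN(2) M(2) by (auto simp: perp_def)
  ultimately have "lagrangian P M"
    using P(2) M(1,2) subN(2) by (auto simp: lagrangian_def)
  then show thesis
    using that[of P M] P nonsing by (simp add: D_def)
qed

text \<open>
  If \<open>y\<close> and \<open>z\<close> were both non-singular, their plane would contain no singular vector except
  \<open>0\<close>; then \<open>N\<close> would be a maximal totally singular subspace different from \<open>N\<^sup>\<bottom>\<close>, which the
  existence of a Lagrangian subspace excludes.
\<close>

lemma plane_over_singular_hyperbolic:
  assumes L: "lagrangian UNIV L"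
    and N: "f2_subspace N" "\<forall>v\<in>N. q v = 0"
    and perpN: "perp q N = N + {0, y} + {0, z}"
    and yz: "polar q y z = 1" and y: "q y = 1"
  shows "q z = 0"
proof (rule ccontr)
  assume "q z \<noteq> 0"
  then have z: "q z = 1" by simp
  have mem: "y \<in> perp q N" "z \<in> perp q N"
    unfolding perpN using f2_subspace_0[OF N(1)]
    by (force simp: set_plus_def)+
  have "maximal_singular UNIV N"
    unfolding maximal_singular_def
  proof (intro conjI allI impI)
    fix K assume K: "f2_subspace K" "\<forall>v\<in>K. q v = 0" "N \<subseteq> K"
    have "v \<in> N" if "v \<in> K" for v
    proof -
      have "v \<in> perp q N"
        using polar_singular[OF K(1,2) that] K(3) by (auto simp: perp_def)
      then obtain x b where x: "x \<in> N + {0, y}" "b \<in> {0, z}" "v = x + b"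
        unfolding perpN by (rule set_plus_elim)
      from x(1) obtain n a where "n \<in> N" "a \<in> {0, y}" "x = n + a"
        by (rule set_plus_elim)
      with x have v: "n \<in> N" "a \<in> {0, y}" "b \<in> {0, z}" "v = n + a + b"
        by simp_all
      then have "polar q n a = 0" "polar q n b = 0"
        using mem by (auto simp: perpD)
      moreover have "q v = 0"
        using that K(2) by simp
      ultimately have "a = 0 \<and> b = 0"
        using v(1-3) N(2) yz y z unfolding v(4) by (auto simp: q_add polar_add_left)
      then show ?thesis
        using v by simp
    qed
    then show "K = N"
      using K(3) by blast
  qed (use N in auto)
  then have "lagrangian UNIV N"
    by (rule maximal_singular_imp_lagrangian[OF f2_subspace_UNIV _ L, rotated])
       (simp add: perp_UNIV)
  then have "y \<in> N"
    using mem by (auto simp: lagrangian_def)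
  then show False
    using N(2) y by simp
qed

section \<open>Witt's extension theorem\<close>

definition isometry :: "('v \<Rightarrow> 'v) \<Rightarrow> bool" where
  "isometry g \<longleftrightarrow> (\<forall>x y. g (x + y) = g x + g y) \<and> bij g \<and> (\<forall>v. q (g v) = q v)"

lemma isometry_polar: "isometry g \<Longrightarrow> polar q (g x) (g y) = polar q x y"
  unfolding isometry_def polar_def by metis

lemma isometry_comp: "isometry g \<Longrightarrow> isometry h \<Longrightarrow> isometry (g \<circ> h)"
  unfolding isometry_def by (simp add: bij_comp)

lemma isometry_id: "isometry id"
  by (simp add: isometry_def)

lemma isometryI:
  assumes add: "\<And>x y. g (x + y) = g x + g y" and q: "\<And>v. q (g v) = q v"
  shows "isometry g"
proof -
  have pol: "polar q (g x) (g y) = polar q x y" for x y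
    unfolding polar_def using add q by metis
  have "inj g"
  proof (rule injI)
    fix x y assume "g x = g y"
    then have "g (x + y) = 0"
      by (simp add: add)
    then have "polar q (x + y) b = 0" for b
      using pol[of "x + y" b] by simp
    then show "x = y"
      using nondegenerate[of "x + y"] by (simp add: add_eq_0_iff_eq)
  qed
  then show ?thesis
    using add q finite_UNIV_inj_surj[OF finite_space] by (simp add: isometry_def bij_def)
qed

lemma bit_scale_add: "bit_scale (c + d) (v :: 'v) = bit_scale c v + bit_scale d v"
  by (cases c; cases d) simp_all

lemma q_bit_scale: "q (bit_scale c v) = c * q v"
  and polar_bit_scale: "polar q (bit_scale c v) w = c * polar q v w"
    "polar q w (bit_scale c v) = c * polar q w v"
  by (cases c; simp)+

lemma isometry_transvection:
  assumes "q w = 1"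
  shows "isometry (\<lambda>v. v + bit_scale (polar q v w) w)"
proof (rule isometryI)
  fix x y v
  show "x + y + bit_scale (polar q (x + y) w) w
      = x + bit_scale (polar q x w) w + (y + bit_scale (polar q y w) w)"
    by (simp only: polar_add_left bit_scale_add ac_simps)
  show "q (v + bit_scale (polar q v w) w) = q v"
    using assms by (cases "polar q v w") (simp_all add: q_add add.assoc)
qed

text \<open>
  The transvection at \<open>w\<close> preserves \<open>q\<close> only for non-singular \<open>w\<close>; for singular \<open>w\<close> these Siegel
  (or Eichler) transformations take its place in the proof of Witt's theorem.
\<close>

lemma isometry_siegel:
  assumes "q w = 0" "polar q u w = 0"
  shows "isometry (\<lambda>v. v + bit_scale (polar q v u) w
    + bit_scale (polar q v w) (u + bit_scale (q u) w))"
proof (rule isometryI)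
  fix x y v
  show "x + y + bit_scale (polar q (x + y) u) w
        + bit_scale (polar q (x + y) w) (u + bit_scale (q u) w)
      = x + bit_scale (polar q x u) w + bit_scale (polar q x w) (u + bit_scale (q u) w)
        + (y + bit_scale (polar q y u) w + bit_scale (polar q y w) (u + bit_scale (q u) w))"
    by (simp only: polar_add_left bit_scale_add ac_simps)
  show "q (v + bit_scale (polar q v u) w
        + bit_scale (polar q v w) (u + bit_scale (q u) w)) = q v"
    using assms polar_commute[of w u]
    by (cases "polar q v w"; cases "polar q v u"; cases "q u"; cases "q v")
       (simp_all add: q_add polar_add_left polar_add_right)
qed

text \<open>
  Put \<open>w = x + y\<close>; it is orthogonal to \<open>K\<close>, and \<open>\<langle>x, w\<rangle> = q(w)\<close>.  If \<open>w\<close> is non-singular, its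
  transvection works.  If \<open>w\<close> is singular and non-zero, a Siegel transformation works for any \<open>u\<close>
  orthogonal to \<open>K\<close> and \<open>w\<close> with \<open>\<langle>x, u\<rangle> = 1\<close>; such a \<open>u\<close> exists because \<open>x\<close> lies outside
  \<open>K + {0, w}\<close>.
\<close>

lemma exists_isometry_fixing:
  assumes K: "f2_subspace K" and xy: "q x = q y" "\<And>k. k \<in> K \<Longrightarrow> polar q x k = polar q y k"
    and notin: "x \<notin> K" "y \<notin> K"
  obtains h where "isometry h" "\<And>k. k \<in> K \<Longrightarrow> h k = k" "h x = y"
proof -
  define w where "w = x + y"
  have y: "y = x + w"
    by (simp add: w_def)
  have wK: "polar q k w = 0" if "k \<in> K" for k
    using xy(2)[OF that] by (simp add: w_def polar_add_right polar_commute)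
  have xw: "polar q x w = q w"
    using xy(1) by (simp add: w_def q_add polar_add_right)
  show thesis
  proof (cases "q w = 1")
    case True
    note 1 = this
    show thesis
      using that[OF isometry_transvection[OF 1]] wK xw 1 y by simp
  next
    case False
    then have 0: "q w = 0" by simp
    show thesis
    proof (cases "w = 0")
      case True
      then show thesis
        using that[OF isometry_id] y by simp
    next
      case False
      have "x \<notin> K + {0, w}"
      proof
        assume "x \<in> K + {0, w}"
        then obtain k e where "k \<in> K" "e \<in> {0, w}" "x = k + e"
          by (blast elim: set_plus_elim)
        then have "x = k \<or> y = k"
          using y by (auto simp: add.assoc)
        then show False
          using notin \<open>k \<in> K\<close> by blast
      qed
      then have "x \<notin> perp q (perp q (K + {0, w}))"
        using double_perp f2_subspace_plus[OF K f2_subspace_line] by simp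
      then obtain u where u: "u \<in> perp q (K + {0, w})" "polar q x u = 1"
        by (auto simp: perp_def)
      then have "polar q u w = 0" "\<And>k. k \<in> K \<Longrightarrow> polar q k u = 0"
        using perp_plus[OF f2_subspace_0[OF K], of "{0, w}"] by (auto simp: perpD)
      then show thesis
        using that[OF isometry_siegel[OF 0, of u]] u(2) wK xw 0 y by simp
    qed
  qed
qed

text \<open>
  Witt's theorem for partial isometries given by their graphs \<open>G\<close>.  The graph form fits the
  application, in which the partial isometry is cut out of the space \<open>S\<close> of triples.  A maximal
  subspace \<open>H\<close> of \<open>G\<close> on which some isometry agrees with \<open>G\<close> is all of \<open>G\<close>, since
  \<open>exists_isometry_fixing\<close> corrects that isometry at one more vector.
\<close>

theorem witt_extension:
  assumes G: "f2_subspace G" and iso: "\<And>x y. (x, y) \<in> G \<Longrightarrow> q x = q y"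
    and inj: "\<And>y. (0, y) \<in> G \<Longrightarrow> y = 0" "\<And>x. (x, 0) \<in> G \<Longrightarrow> x = 0"
  obtains g where "isometry g" "\<And>x y. (x, y) \<in> G \<Longrightarrow> g x = y"
proof -
  interpret pair: char_two "TYPE('v \<times> 'v)"
    by (intro char_two_prod char_two)
  define P where "P H \<longleftrightarrow> f2_subspace H \<and> H \<subseteq> G \<and>
    (\<exists>g. isometry g \<and> (\<forall>(x, y)\<in>H. g x = y))" for H
  have "P {0}"
    using isometry_id f2_subspace_0[OF G] f2_subspace_zero[where 'a = "'v \<times> 'v"]
    by (auto simp: P_def zero_prod_def)
  then obtain H where H: "P H" and max: "\<And>N. P N \<Longrightarrow> H \<subseteq> N \<Longrightarrow> N = H"
    using exists_maximal_above[OF pair.finite_space, of P] by metis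
  then obtain g where g: "isometry g" "\<And>x y. (x, y) \<in> H \<Longrightarrow> g x = y"
    unfolding P_def by fast
  have subH: "f2_subspace H" "H \<subseteq> G"
    using H by (auto simp: P_def)
  have add: "(a + c, b + d) \<in> G" if "(a, b) \<in> G" "(c, d) \<in> G" for a b c d
    using f2_subspace_add[OF G that] by simp
  have pol: "polar q a c = polar q b d" if "(a, b) \<in> G" "(c, d) \<in> G" for a b c d
    using iso[OF that(1)] iso[OF that(2)] iso[OF add[OF that]] by (simp add: polar_def)
  have inj_g: "a = b" if "g a = g b" for a b
    using g(1) that by (auto simp: isometry_def bij_def inj_def)
  have "(x, y) \<in> H" if xy: "(x, y) \<in> G" for x y
  proof (rule ccontr)
    assume notin: "(x, y) \<notin> H"
    define K where "K = snd ` H"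
    have K: "f2_subspace K"
    proof (rule f2_subspaceI)
      show "0 \<in> K"
        using f2_subspace_0[OF subH(1)] by (force simp: K_def zero_prod_def)
      show "a + b \<in> K" if "a \<in> K" "b \<in> K" for a b
        using that f2_subspace_add[OF subH(1)] by (force simp: K_def image_iff)
    qed
    have "q (g x) = q y"
      using g(1) iso[OF xy] by (simp add: isometry_def)
    moreover have "polar q (g x) k = polar q y k" if k: "k \<in> K" for k
    proof -
      obtain a where a: "(a, k) \<in> H"
        using k by (auto simp: K_def)
      then have "polar q (g x) (g a) = polar q y k"
        using isometry_polar[OF g(1)] pol[OF xy, of a k] subH by auto
      then show ?thesis
        using g(2)[OF a] by simp
    qed
    moreover have "g x \<notin> K"
    proof
      assume "g x \<in> K"
      then obtain a where a: "(a, g x) \<in> H"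
        by (auto simp: K_def)
      then have "a = x"
        using g(2) inj_g by blast
      then have "(0, g x + y) \<in> G"
        using add[of a "g x" x y] a xy subH by auto
      then have "g x = y"
        using inj(1)[of "g x + y"] by (simp add: add_eq_0_iff_eq)
      then show False
        using a \<open>a = x\<close> notin by simp
    qed
    moreover have "y \<notin> K"
    proof
      assume "y \<in> K"
      then obtain a where a: "(a, y) \<in> H"
        by (auto simp: K_def)
      then have "(a + x, 0) \<in> G"
        using add[of a y x y] xy subH by auto
      then have "a = x"
        using inj(2)[of "a + x"] by (simp add: add_eq_0_iff_eq)
      then show False
        using a notin by simp
    qed
    ultimately obtain h where h: "isometry h" "\<And>k. k \<in> K \<Longrightarrow> h k = k" "h (g x) = y"
      using exists_isometry_fixing[OF K] by metis
    have hg: "isometry (h \<circ> g)"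
      using isometry_comp g(1) h(1) by blast
    have on_H: "(h \<circ> g) a = b" if "(a, b) \<in> H" for a b
      using that g(2) h(2) by (force simp: K_def)
    have "(h \<circ> g) a = b" if ab: "(a, b) \<in> H + {0, (x, y)}" for a b
    proof -
      obtain c d where cd: "(c, d) \<in> H" "(a, b) = (c, d) \<or> (a, b) = (c + x, d + y)"
        using ab by (auto simp: set_plus_def zero_prod_def)
      show ?thesis
        using cd(2) on_H[OF cd(1)] h(3) hg by (auto simp: isometry_def)
    qed
    moreover have "H + {0, (x, y)} \<subseteq> G"
      using plus_subset_iff[OF subH(1) pair.f2_subspace_line G] subH(2) xy f2_subspace_0[OF G]
      by simp
    ultimately have "P (H + {0, (x, y)})"
      using f2_subspace_plus[OF subH(1) pair.f2_subspace_line] hg by (auto simp: P_def)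
    then have "H + {0, (x, y)} = H"
      using max subset_plus_left by blast
    then show False
      using notin subset_plus_right[OF f2_subspace_0[OF subH(1)], of "{0, (x, y)}"] by auto
  qed
  then show thesis
    using that g by blast
qed

text \<open>
  Any linear bijection between totally singular spaces is an isometry, so a linear injection
  of \<open>S\<^sub>2\<close> into \<open>S\<^sub>1\<close>, here again as a graph, is what Witt's theorem needs in order to move
  \<open>S\<^sub>2\<close> into \<open>S\<^sub>1\<close>.
\<close>

lemma exists_partial_isomorphism:
  fixes A B :: "'v set"
  assumes A: "f2_subspace A" and B: "f2_subspace B" and card: "card A \<le> card B"
  obtains H where "f2_subspace H" "H \<subseteq> A \<times> B" "\<And>x. x \<in> A \<Longrightarrow> \<exists>y. (x, y) \<in> H"
    "\<And>y. (0, y) \<in> H \<Longrightarrow> y = 0" "\<And>x. (x, 0) \<in> H \<Longrightarrow> x = 0"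
proof -
  interpret pair: char_two "TYPE('v \<times> 'v)"
    by (intro char_two_prod char_two)
  define P where "P H \<longleftrightarrow> f2_subspace H \<and> H \<subseteq> A \<times> B \<and>
    (\<forall>y. (0, y) \<in> H \<longrightarrow> y = 0) \<and> (\<forall>x. (x, 0) \<in> H \<longrightarrow> x = 0)" for H
  have "P {0}"
    using f2_subspace_0[OF A] f2_subspace_0[OF B] f2_subspace_zero[where 'a = "'v \<times> 'v"]
    by (auto simp: P_def zero_prod_def)
  then obtain H where H: "P H" and max: "\<And>N. P N \<Longrightarrow> H \<subseteq> N \<Longrightarrow> N = H"
    using exists_maximal_above[OF pair.finite_space, of P] by metis
  have subH: "f2_subspace H" "H \<subseteq> A \<times> B"
    and injH: "\<And>y. (0, y) \<in> H \<Longrightarrow> y = 0" "\<And>x. (x, 0) \<in> H \<Longrightarrow> x = 0"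
    using H by (auto simp: P_def)
  have add: "(a + c, b + d) \<in> H" if "(a, b) \<in> H" "(c, d) \<in> H" for a b c d
    using f2_subspace_add[OF subH(1) that] by simp
  have "A \<subseteq> fst ` H"
  proof (rule ccontr)
    assume "\<not> A \<subseteq> fst ` H"
    then obtain x where x: "x \<in> A" "x \<notin> fst ` H"
      by blast
    have "inj_on fst H" "inj_on snd H"
    proof -
      show "inj_on fst H"
        by (rule inj_onI) (use add injH in \<open>force simp: add_eq_0_iff_eq\<close>)
      show "inj_on snd H"
        by (rule inj_onI) (use add injH in \<open>force simp: add_eq_0_iff_eq\<close>)
    qed
    then have "card (snd ` H) = card (fst ` H)"
      by (simp add: card_image)
    also have "\<dots> < card A"
      using x subH(2) by (intro psubset_card_mono) (auto simp: finite_set)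
    finally have "card (snd ` H) < card B"
      using card by simp
    then have "\<not> B \<subseteq> snd ` H"
      by (metis card_mono finite_set not_le)
    then obtain y where y: "y \<in> B" "y \<notin> snd ` H"
      by blast
    have in_AB: "(a, b) \<in> A \<times> B" if "(a, b) \<in> H" for a b
      using that subH(2) by blast
    have cases: "(a, b) \<in> H \<or> (a + x, b + y) \<in> H" if "(a, b) \<in> H + {0, (x, y)}" for a b
      using that by (auto simp: set_plus_def zero_prod_def add.assoc)
    have "b = 0" if "(0, b) \<in> H + {0, (x, y)}" for b
      using cases[OF that] injH x(2) by force
    moreover have "a = 0" if "(a, 0) \<in> H + {0, (x, y)}" for a
      using cases[OF that] injH y(2) by force
    moreover have "f2_subspace (A \<times> B)"
      using A B by (auto simp: f2_subspace_def zero_prod_def)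
    then have "H + {0, (x, y)} \<subseteq> A \<times> B"
      using plus_subset_iff[OF subH(1) pair.f2_subspace_line] subH(2) x(1) y(1) f2_subspace_0
      by auto
    ultimately have "P (H + {0, (x, y)})"
      using f2_subspace_plus[OF subH(1) pair.f2_subspace_line] by (auto simp: P_def)
    then have "H + {0, (x, y)} = H"
      using max subset_plus_left by blast
    then have "(x, y) \<in> H"
      using subset_plus_right[OF f2_subspace_0[OF subH(1)], of "{0, (x, y)}"] by auto
    then show False
      using x(2) by force
  qed
  then show thesis
    using that[OF subH _ injH] by force
qed

lemma lagrangian_image:
  assumes g: "isometry g" and M: "lagrangian UNIV M"
  shows "lagrangian UNIV (g ` M)"
proof -
  have add: "g (x + y) = g x + g y" and qg: "q (g v) = q v" and surj: "surj g" for x y v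
    using g by (auto simp: isometry_def bij_def)
  have g0: "g 0 = 0"
    using add[of 0 0] by simp
  have M': "f2_subspace M" "\<forall>v\<in>M. q v = 0" "perp q M = M"
    using M by (auto simp: lagrangian_def)
  have "f2_subspace (g ` M)"
    using M'(1) g0 by (auto simp: f2_subspace_def image_iff simp flip: add) 
  moreover have "perp q (g ` M) = g ` perp q M"
  proof -
    have "g v \<in> perp q (g ` M) \<longleftrightarrow> g v \<in> g ` perp q M" for v
      using g by (simp add: perp_def isometry_polar[OF g] inj_image_mem_iff isometry_def bij_def)
    then show ?thesis
      using surj by (metis subset_antisym subsetI surjD)
  qed
  ultimately show ?thesis
    using M'(2) qg by (simp add: lagrangian_def M'(3))
qed

end

section \<open>Self-perpendicular spaces of triples\<close>

lemma bit_add_eq_0_iff: "x + y = 0 \<longleftrightarrow> x = (y :: bit)"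
  by (cases x; cases y) simp_all

lemma q3_apply [simp]: "q3 q (a, b, c) = q a + q b + q c"
  by (simp add: q3_def)

lemma polar_q3 [simp]:
  "polar (q3 q) (a, b, c) (a', b', c') = polar q a a' + polar q b b' + polar q c c'"
  by (simp only: polar_def q3_apply add_Pair ac_simps)

lemma f2_subspace_Times: "f2_subspace A \<Longrightarrow> f2_subspace B \<Longrightarrow> f2_subspace (A \<times> B)"
  by (auto simp: f2_subspace_def zero_prod_def)

lemma (in f2_quadratic_space) f2_quadratic_space_triple: "f2_quadratic_space (q3 q)"
proof (rule f2_quadratic_space.intro)
  show "char_two TYPE('v \<times> 'v \<times> 'v)"
    by (intro char_two_prod char_two)
  fix x y z :: "'v \<times> 'v \<times> 'v"
  show "polar (q3 q) (x + y) z = polar (q3 q) x z + polar (q3 q) y z"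
    by (cases x; cases y; cases z) (simp only: polar_q3 add_Pair polar_add_left ac_simps)
next
  fix x :: "'v \<times> 'v \<times> 'v"
  assume *: "\<And>y. polar (q3 q) x y = 0"
  obtain a b c where x: "x = (a, b, c)"
    by (cases x)
  have "polar q a d = 0" "polar q b d = 0" "polar q c d = 0" for d
    using *[of "(d, 0, 0)"] *[of "(0, d, 0)"] *[of "(0, 0, d)"] by (simp_all add: x)
  then show "x = 0"
    using nondegenerate by (simp add: x zero_prod_def)
qed

locale triple_lagrangian = f2_quadratic_space q for q :: "'v::ab_group_add \<Rightarrow> bit" +
  fixes S :: "('v \<times> 'v \<times> 'v) set"
  assumes lagrangian_S: "f2_quadratic_space.lagrangian (q3 q) UNIV S"
begin

interpretation triple: f2_quadratic_space "q3 q"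
  by (rule f2_quadratic_space_triple)

lemma f2_subspace_S: "f2_subspace S"
  using lagrangian_S by (simp add: triple.lagrangian_def)

lemma zero_S [simp]: "(0, 0, 0) \<in> S"
  using f2_subspace_0[OF f2_subspace_S] by (simp add: zero_prod_def)

lemma add_S: "(a, b, c) \<in> S \<Longrightarrow> (a', b', c') \<in> S \<Longrightarrow> (a + a', b + b', c + c') \<in> S"
  using f2_subspace_add[OF f2_subspace_S] by force

lemma q_S: "(a, b, c) \<in> S \<Longrightarrow> q a + q b + q c = 0"
  using lagrangian_S by (force simp: triple.lagrangian_def)

lemma polar_S:
  "(a, b, c) \<in> S \<Longrightarrow> (a', b', c') \<in> S \<Longrightarrow> polar q a a' + polar q b b' + polar q c c' = 0"
  using triple.polar_singular[of S "(a, b, c)" "(a', b', c')"] lagrangian_S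
  by (simp add: triple.lagrangian_def)

text \<open>
  The form in which self-duality is used: \<open>Z\<close> will be a sum of coordinate slots, and its
  orthogonal complement picks out the vectors of \<open>S\<close> that vanish there.  The lemmas
  \<open>projection1\<close> and \<open>dual13\<close> to \<open>dual31\<close> spell this out; in \<open>dual\<close>\<open>ij\<close> the vector lives in the
  coordinate \<open>i\<close> and is completed in the coordinate \<open>j\<close>.
\<close>

lemma dual_S:
  assumes Z: "f2_subspace Z" and v: "\<And>s. s \<in> S \<Longrightarrow> s \<in> perp (q3 q) Z \<Longrightarrow> polar (q3 q) v s = 0"
  obtains s z where "s \<in> S" "z \<in> Z" "v = s + z"
proof -
  have "v \<in> perp (q3 q) (S \<inter> perp (q3 q) Z)"
    using v by (auto simp: perp_def)
  then have "v \<in> perp (q3 q) S + Z"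
    by (simp add: triple.perp_Int_perp f2_subspace_S Z)
  moreover have "perp (q3 q) S = S"
    using lagrangian_S by (simp add: triple.lagrangian_def)
  ultimately show thesis
    using that by (auto elim: set_plus_elim)
qed

lemma perp_slots:
  "(a, b, c) \<in> perp (q3 q) (UNIV \<times> {(0, 0)}) \<longleftrightarrow> a = 0"
  "(a, b, c) \<in> perp (q3 q) ({0} \<times> UNIV \<times> {0}) \<longleftrightarrow> b = 0"
  "(a, b, c) \<in> perp (q3 q) ({0} \<times> {0} \<times> UNIV) \<longleftrightarrow> c = 0"
  "(a, b, c) \<in> perp (q3 q) ({0} \<times> UNIV) \<longleftrightarrow> b = 0 \<and> c = 0"
proof -
  have *: "(\<forall>x. polar q v x = 0) \<longleftrightarrow> v = 0" for v
    using nondegenerate by auto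
  have "b = 0 \<and> c = 0" if "\<forall>x y. polar q b x + polar q c y = 0"
    using that[rule_format, of _ 0] that[rule_format, of 0] *[of b] *[of c] by simp
  then show "(a, b, c) \<in> perp (q3 q) ({0} \<times> UNIV) \<longleftrightarrow> b = 0 \<and> c = 0"
    by (auto simp: perp_def)
qed (use nondegenerate in \<open>auto simp: perp_def\<close>)

lemmas slot_subspaces = f2_subspace_Times f2_subspace_zero f2_subspace_UNIV
  f2_subspace_zero[where 'a = "'v \<times> 'v", unfolded zero_prod_def]

lemma projection1:
  assumes "\<And>s. (s, 0, 0) \<in> S \<Longrightarrow> polar q a s = 0"
  obtains b c where "(a, b, c) \<in> S"
proof -
  obtain s z where "s \<in> S" "z \<in> {0} \<times> UNIV" "(a, 0, 0) = s + z"
    by (rule dual_S[of "{0} \<times> UNIV" "(a, 0, 0)"])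
       (use assms in \<open>auto simp: perp_slots intro!: slot_subspaces\<close>)
  then show thesis
    using that by (cases s) auto
qed

lemma dual13:
  assumes "\<And>x b. (x, b, 0) \<in> S \<Longrightarrow> polar q a x = 0"
  obtains c where "(a, 0, c) \<in> S"
proof -
  obtain s z where "s \<in> S" "z \<in> {0} \<times> {0} \<times> UNIV" "(a, 0, 0) = s + z"
    by (rule dual_S[of "{0} \<times> {0} \<times> UNIV" "(a, 0, 0)"])
       (use assms in \<open>auto simp: perp_slots intro!: slot_subspaces\<close>)
  then show thesis
    using that by (cases s) auto
qed

lemma dual23:
  assumes "\<And>a x. (a, x, 0) \<in> S \<Longrightarrow> polar q b x = 0"
  obtains c where "(0, b, c) \<in> S"
proof -
  obtain s z where "s \<in> S" "z \<in> {0} \<times> {0} \<times> UNIV" "(0, b, 0) = s + z"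
    by (rule dual_S[of "{0} \<times> {0} \<times> UNIV" "(0, b, 0)"])
       (use assms in \<open>auto simp: perp_slots intro!: slot_subspaces\<close>)
  then show thesis
    using that by (cases s) auto
qed

lemma dual32:
  assumes "\<And>a x. (a, 0, x) \<in> S \<Longrightarrow> polar q c x = 0"
  obtains b where "(0, b, c) \<in> S"
proof -
  obtain s z where "s \<in> S" "z \<in> {0} \<times> UNIV \<times> {0}" "(0, 0, c) = s + z"
    by (rule dual_S[of "{0} \<times> UNIV \<times> {0}" "(0, 0, c)"])
       (use assms in \<open>auto simp: perp_slots intro!: slot_subspaces\<close>)
  then show thesis
    using that by (cases s) auto
qed

lemma dual31:
  assumes "\<And>b x. (0, b, x) \<in> S \<Longrightarrow> polar q c x = 0"
  obtains a where "(a, 0, c) \<in> S"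
proof -
  obtain s z where "s \<in> S" "z \<in> UNIV \<times> {(0, 0)}" "(0, 0, c) = s + z"
    by (rule dual_S[of "UNIV \<times> {(0, 0)}" "(0, 0, c)"])
       (use assms in \<open>auto simp: perp_slots intro!: slot_subspaces\<close>)
  then show thesis
    using that by (cases s) auto
qed

text \<open>
  \<open>S\<^sub>1\<close> and \<open>S\<^sub>2\<close> are the slots of \<open>S\<close> in the first two coordinates; \<open>A\<^sub>1\<^sub>2\<close> and \<open>A\<^sub>1\<^sub>3\<close>
  collect the first entries of the vectors of \<open>S\<close> supported on two coordinates.
\<close>

definition S1 where "S1 = {a. (a, 0, 0) \<in> S}"
definition S2 where "S2 = {b. (0, b, 0) \<in> S}"
definition A12 where "A12 = {a. \<exists>b. (a, b, 0) \<in> S}"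
definition A13 where "A13 = {a. \<exists>c. (a, 0, c) \<in> S}"

lemma f2_subspace_slots:
  "f2_subspace S1" "f2_subspace S2" "f2_subspace A12" "f2_subspace A13"
proof -
  show "f2_subspace S1"
    using add_S[of _ 0 0 _ 0 0] by (simp add: f2_subspace_def S1_def)
  show "f2_subspace S2"
    using add_S[of 0 _ 0 0 _ 0] by (simp add: f2_subspace_def S2_def)
  show "f2_subspace A12"
  proof (rule f2_subspaceI)
    show "0 \<in> A12"
      using zero_S unfolding A12_def by blast
    show "x + y \<in> A12" if "x \<in> A12" "y \<in> A12" for x y
      using that add_S[of x _ 0 y _ 0] by (force simp: A12_def)
  qed
  show "f2_subspace A13"
  proof (rule f2_subspaceI)
    show "0 \<in> A13"
      using zero_S unfolding A13_def by blast
    show "x + y \<in> A13" if "x \<in> A13" "y \<in> A13" for x y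
      using that add_S[of x 0 _ y 0] by (force simp: A13_def)
  qed
qed

lemma q_S1: "\<forall>s\<in>S1. q s = 0"
  using q_S[of _ 0 0] by (simp add: S1_def)

lemma q_S2: "\<forall>s\<in>S2. q s = 0"
  using q_S[of 0 _ 0] by (simp add: S2_def)

lemma perp_A12: "perp q A12 = A13"
proof (intro set_eqI iffI)
  fix a assume "a \<in> perp q A12"
  then have "polar q a x = 0" if "(x, b, 0) \<in> S" for x b
    using that by (auto simp: perp_def A12_def)
  then obtain c where "(a, 0, c) \<in> S"
    by (rule dual13)
  then show "a \<in> A13"
    by (auto simp: A13_def)
next
  fix a assume "a \<in> A13"
  then obtain c where "(a, 0, c) \<in> S"
    by (auto simp: A13_def)
  then have "polar q a x = 0" if "(x, b, 0) \<in> S" for x b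
    using polar_S[of a 0 c x b 0] that by simp
  then show "a \<in> perp q A12"
    by (auto simp: perp_def A12_def)
qed

lemma perp_A13: "perp q A13 = A12"
  using double_perp[OF f2_subspace_slots(3)] by (simp add: perp_A12)

lemma S1_subset: "S1 \<subseteq> A12 \<inter> A13"
  by (auto simp: S1_def A12_def A13_def)

lemma polar_S12: "(a, b, 0) \<in> S \<Longrightarrow> (a', b', c') \<in> S \<Longrightarrow> polar q b b' = polar q a a'"
  and polar_S13: "(a, 0, c) \<in> S \<Longrightarrow> (a', b', c') \<in> S \<Longrightarrow> polar q c c' = polar q a a'"
  and polar_S23: "(0, b, c) \<in> S \<Longrightarrow> (a', b', c') \<in> S \<Longrightarrow> polar q c c' = polar q b b'"
  using polar_S[of a b 0 a' b' c'] polar_S[of a 0 c a' b' c'] polar_S[of 0 b c a' b' c']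
  by (simp_all only: polar_0 add_0_left add_0_right bit_add_eq_0_iff)

lemma q_S12: "(a, b, 0) \<in> S \<Longrightarrow> q b = q a"
  and q_S13: "(a, 0, c) \<in> S \<Longrightarrow> q c = q a"
  and q_S23: "(0, b, c) \<in> S \<Longrightarrow> q c = q b"
  using q_S[of a b 0] q_S[of a 0 c] q_S[of 0 b c]
  by (simp_all only: q_0 add_0_left add_0_right bit_add_eq_0_iff)

lemma slots_iff:
  "a \<in> S1 \<longleftrightarrow> (a, 0, 0) \<in> S" "a \<in> S2 \<longleftrightarrow> (0, a, 0) \<in> S"
  "a \<in> A12 \<longleftrightarrow> (\<exists>b. (a, b, 0) \<in> S)" "a \<in> A13 \<longleftrightarrow> (\<exists>c. (a, 0, c) \<in> S)"
  by (simp_all add: S1_def S2_def A12_def A13_def)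

section \<open>Adapting the second coordinate to the first\<close>

text \<open>
  The partial isometry to be extended sends \<open>p'\<close> to \<open>p\<close> for a suitable choice of \<open>(p, p', 0)\<close> in
  \<open>S\<close>, maps \<open>S\<^sub>2\<close> into \<open>S\<^sub>1\<close>, and sends \<open>b\<close> to \<open>z\<close>.  It preserves all inner products because \<open>S\<close>
  is totally singular: for vectors of \<open>S\<close> that vanish in the third coordinate, inner products
  in the second coordinate repeat those in the first.  The disjunction covers both kinds at
  once: \<open>z = b = 0\<close> for the first, while for the second some \<open>y\<close> in the radical of \<open>A\<^sub>1\<^sub>2\<close> pairs
  non-trivially with \<open>z\<close>, which keeps \<open>z\<close> and \<open>b\<close> independent of the rest.
\<close>

lemma normalise_second_coordinate:
  assumes card: "card S2 \<le> card S1"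
    and P: "f2_subspace P" "S1 \<inter> P = {0}" "P \<subseteq> A12"
    and z: "(z, b, c) \<in> S" "q z = 0" "q b = 0"
    and cases: "z = 0 \<and> b = 0 \<or> (\<exists>y\<in>P \<inter> A13. polar q y z = 1)"
  obtains g where "isometry g" "\<And>s. s \<in> S2 \<Longrightarrow> g s \<in> S1"
    "\<And>p. p \<in> P \<Longrightarrow> \<exists>p'. (p, p', 0) \<in> S \<and> g p' = p" "g b = z"
proof -
  interpret pair: char_two "TYPE('v \<times> 'v)"
    by (intro char_two_prod char_two)
  obtain H where H: "f2_subspace H" "H \<subseteq> S2 \<times> S1" "\<And>x. x \<in> S2 \<Longrightarrow> \<exists>y. (x, y) \<in> H"
    "\<And>y. (0, y) \<in> H \<Longrightarrow> y = 0" "\<And>x. (x, 0) \<in> H \<Longrightarrow> x = 0"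
    using exists_partial_isomorphism[OF f2_subspace_slots(2,1) card] by metis
  define E where "E = {(x, p). p \<in> P \<and> (p, x, 0) \<in> S}"
  define K where "K = S2 \<times> {0 :: 'v}"
  have E: "f2_subspace E"
  proof (rule f2_subspaceI)
    show "0 \<in> E"
      using f2_subspace_0[OF P(1)] by (simp add: E_def zero_prod_def)
    show "u + v \<in> E" if "u \<in> E" "v \<in> E" for u v
      using that f2_subspace_add[OF P(1)] add_S[of _ _ 0 _ _ 0] by (auto simp: E_def)
  qed
  have K: "f2_subspace K"
    unfolding K_def by (intro f2_subspace_Times f2_subspace_slots f2_subspace_zero)
  have KE: "K \<subseteq> E"
    using f2_subspace_0[OF P(1)] by (auto simp: K_def E_def slots_iff)
  \<comment> \<open>\<open>p'\<close> is determined by \<open>p\<close> only modulo \<open>S\<^sub>2\<close>; a complement of \<open>K\<close> makes a linear choice.\<close>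
  obtain C where C: "f2_subspace C" "C \<subseteq> E" "K \<inter> C = {0}" "K + C = E"
    using pair.exists_complement[OF E K KE] by blast
  define G where "G = C + H + {0, (b, z)}"
  have G: "f2_subspace G"
    unfolding G_def by (intro f2_subspace_plus C(1) H(1) pair.f2_subspace_line)
  have CH: "C \<subseteq> G" "H \<subseteq> G" "(b, z) \<in> G"
  proof -
    have "C + H \<subseteq> G"
      unfolding G_def by (rule subset_plus_left) simp
    then show "C \<subseteq> G" "H \<subseteq> G"
      using subset_plus_left[OF f2_subspace_0[OF H(1)], of C]
        subset_plus_right[OF f2_subspace_0[OF C(1)], of H] by simp_all
    show "(b, z) \<in> G"
      using subset_plus_right[OF f2_subspace_0[OF f2_subspace_plus[OF C(1) H(1)]], of "{0, (b, z)}"]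
      by (simp add: G_def)
  qed
  have decomp: "\<exists>p' p s \<sigma> e. (p', p) \<in> C \<and> (s, \<sigma>) \<in> H \<and>
      x = p' + s + bit_scale e b \<and> y = p + \<sigma> + bit_scale e z" if xy: "(x, y) \<in> G" for x y
  proof -
    obtain u d where u: "u \<in> C + H" "d \<in> {0, (b, z)}" "(x, y) = u + d"
      using xy unfolding G_def by (rule set_plus_elim)
    obtain k h where "k \<in> C" "h \<in> H" "u = k + h"
      using u(1) by (rule set_plus_elim)
    moreover obtain e where "d = (bit_scale e b, bit_scale e z)"
    proof (cases "d = 0")
      case True
      then show thesis
        using that[of 0] by (simp add: zero_prod_def)
    next
      case False
      then show thesis
        using that[of 1] u(2) by simp
    qed
    ultimately have "(fst k, snd k) \<in> C \<and> (fst h, snd h) \<in> H \<and>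
        x = fst k + fst h + bit_scale e b \<and> y = snd k + snd h + bit_scale e z"
      using u(3) by (metis fst_conv snd_conv fst_add snd_add prod.collapse)
    then show ?thesis
      by blast
  qed
  have CE: "p \<in> P" "(p, p', 0) \<in> S" if "(p', p) \<in> C" for p p'
    using that C(2) by (auto simp: E_def)
  have HS: "(0, s, 0) \<in> S" "(\<sigma>, 0, 0) \<in> S" if "(s, \<sigma>) \<in> H" for s \<sigma>
    using that H(2) by (auto simp: slots_iff)
  have iso: "q x = q y" if in_G: "(x, y) \<in> G" for x y
  proof -
    obtain p' p s \<sigma> e where *: "(p', p) \<in> C" "(s, \<sigma>) \<in> H"
      "x = p' + s + bit_scale e b" "y = p + \<sigma> + bit_scale e z"
      using decomp[OF in_G] by blast
    note m = CE[OF *(1)] HS[OF *(2)]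
    have "q s = 0" "q \<sigma> = 0" "q p' = q p"
      using q_S12[OF m(3)] q_S12[OF m(4)] q_S12[OF m(2)] by simp_all
    moreover have "polar q p' s = 0" "polar q p \<sigma> = 0"
      using polar_S12[OF m(2) m(3)] polar_S12[OF m(2) m(4)] by simp_all
    moreover have "polar q p' b = polar q p z" "polar q s b = 0" "polar q \<sigma> z = 0"
      using polar_S12[OF m(2) z(1)] polar_S12[OF m(3) z(1)] polar_S12[OF m(4) z(1)] by simp_all
    ultimately show ?thesis
      unfolding * using z by (simp add: q_add polar_add_left polar_bit_scale q_bit_scale)
  qed
  have no_z: "bit_scale e b = 0 \<and> bit_scale e z = 0"
    if k: "(p', p) \<in> C" "(s, \<sigma>) \<in> H"
      and sum: "p' + s + bit_scale e b = 0 \<or> p + \<sigma> + bit_scale e z = 0" for p' p s \<sigma> e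
  proof (cases "z = 0 \<and> b = 0")
    case True
    then show ?thesis
      by (cases e) auto
  next
    case False
    with cases obtain y where y: "y \<in> P" "y \<in> A13" "polar q y z = 1"
      by blast
    have "y \<in> A12"
      using y(1) P(3) by blast
    then obtain y' where y': "(y, y', 0) \<in> S"
      unfolding slots_iff by blast
    note m = CE[OF k(1)] HS[OF k(2)]
    have "polar q y p = 0"
      using y(2) m(1) P(3) by (auto simp: perp_A12[symmetric] perp_def)
    moreover have "polar q y' p' = polar q y p" "polar q y' b = polar q y z" "polar q y' s = 0"
      "polar q y \<sigma> = 0"
      using polar_S12[OF y' m(2)] polar_S12[OF y' z(1)] polar_S12[OF y' m(3)]
        polar_S12[OF y' m(4)] by simp_all
    ultimately have "polar q y' (p' + s + bit_scale e b) = e" "polar q y (p + \<sigma> + bit_scale e z) = e"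
      using y(3) by (simp_all add: polar_add_right polar_bit_scale)
    with sum have "e = 0"
      by auto
    then show ?thesis
      by simp
  qed
  have trivial: "p = 0 \<and> p' = 0" if "(p', p) \<in> C" "(p, 0, 0) \<in> S" for p p'
  proof -
    have "p \<in> S1 \<inter> P"
      using CE(1)[OF that(1)] that(2) by (simp add: slots_iff)
    then have "p = 0"
      unfolding P(2) by simp
    moreover from this have "(p', 0) \<in> K \<inter> C"
      using CE(2)[OF that(1)] that(1) by (auto simp: K_def slots_iff)
    ultimately show ?thesis
      using C(3) by (simp add: zero_prod_def)
  qed
  have inj1: "y = 0" if in_G: "(0, y) \<in> G" for y
  proof -
    obtain p' p s \<sigma> e where *: "(p', p) \<in> C" "(s, \<sigma>) \<in> H"
      "0 = p' + s + bit_scale e b" "y = p + \<sigma> + bit_scale e z"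
      using decomp[OF in_G] by blast
    have e: "bit_scale e b = 0" "bit_scale e z = 0"
      using no_z[OF *(1,2), of e] *(3) by simp_all
    then have "p' = s"
      using *(3) by (metis add.right_neutral add_eq_0_iff_eq)
    then have "(p, 0, 0) \<in> S"
      using add_S[OF CE(2)[OF *(1)] HS(1)[OF *(2)]] by simp
    then have "p = 0" "s = 0"
      using trivial[OF *(1)] \<open>p' = s\<close> by auto
    then show ?thesis
      using H(4) *(2,4) e by simp
  qed
  have inj2: "x = 0" if in_G: "(x, 0) \<in> G" for x
  proof -
    obtain p' p s \<sigma> e where *: "(p', p) \<in> C" "(s, \<sigma>) \<in> H"
      "x = p' + s + bit_scale e b" "0 = p + \<sigma> + bit_scale e z"
      using decomp[OF in_G] by blast
    have e: "bit_scale e b = 0" "bit_scale e z = 0"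
      using no_z[OF *(1,2), of e] *(4) by simp_all
    then have "p = \<sigma>"
      using *(4) by (metis add.right_neutral add_eq_0_iff_eq)
    then have "p = 0" "p' = 0"
      using trivial[OF *(1)] HS(2)[OF *(2)] by auto
    then show ?thesis
      using H(5) *(2,3) \<open>p = \<sigma>\<close> e by simp
  qed
  obtain g where g: "isometry g" "\<And>x y. (x, y) \<in> G \<Longrightarrow> g x = y"
    using witt_extension[OF G iso inj1 inj2] by metis
  show thesis
  proof (rule that[OF g(1)])
    show "g b = z"
      using g(2) CH(3) by blast
    show "g s \<in> S1" if "s \<in> S2" for s
      using H(3)[OF that] H(2) g(2) CH(2) by blast
    show "\<exists>p'. (p, p', 0) \<in> S \<and> g p' = p" if p: "p \<in> P" for p
    proof -
      have "p \<in> A12"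
        using p P(3) by blast
      then obtain x where "(p, x, 0) \<in> S"
        unfolding slots_iff by blast
      then have "(x, p) \<in> K + C"
        using p C(4) by (simp add: E_def)
      then obtain k h where kh: "k \<in> K" "h \<in> C" "(x, p) = k + h"
        by (rule set_plus_elim)
      then have "h = (fst h, p)"
        by (cases h) (auto simp: K_def)
      then have "(fst h, p) \<in> C"
        using kh(2) by simp
      then show ?thesis
        using CE(2) g(2) CH(1) by blast
    qed
  qed
qed

end

section \<open>Lagrangian spaces of triples with trivial third slot\<close>

lemma (in f2_quadratic_space) isometry_preserves_lagrangian_triple:
  assumes "triple_lagrangian q S" "f2_quadratic_space.isometry (q3 q) k"
  shows "triple_lagrangian q (k ` S)"
proof -
  interpret triple: f2_quadratic_space "q3 q"
    by (rule f2_quadratic_space_triple)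
  interpret S: triple_lagrangian q S
    by fact
  show ?thesis
    using triple.lagrangian_image[OF assms(2) S.lagrangian_S] by unfold_locales
qed

lemma (in f2_quadratic_space) perpI: "(\<And>a. a \<in> A \<Longrightarrow> polar q a v = 0) \<Longrightarrow> v \<in> perp q A"
  by (simp add: perp_def polar_commute[of v])

context triple_lagrangian
begin

lemma perp_S1: "perp q S1 = A12 + A13" if "A12 \<inter> A13 = S1"
  using perp_Int_perp[OF f2_subspace_slots(3,3)] that
  by (simp add: perp_A12 add.commute)

lemma first_coordinate_perp: "(a, b, c) \<in> S \<Longrightarrow> a \<in> perp q S1"
  using polar_S12[of _ 0 a b c] by (auto simp: perp_def slots_iff polar_commute)

text \<open>
  Since \<open>S\<^sub>3 = 0\<close>, a vector \<open>(0, t, u)\<close> of \<open>S\<close> is determined by \<open>t\<close>, and \<open>u\<close> determines \<open>t\<close> modulo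
  \<open>S\<^sub>2\<close>; passing to the complement \<open>T\<close> makes the correspondence bijective.  It preserves \<open>q\<close>
  because these vectors are singular.
\<close>

lemma slot_graph_isometry:
  assumes no3: "\<And>c. (0, 0, c) \<in> S \<Longrightarrow> c = 0"
    and T: "f2_subspace T" "S2 \<inter> T = {0}" "S2 + T = V"
    and V: "\<And>t. t \<in> V \<Longrightarrow> \<exists>u. (0, t, u) \<in> S" and U: "\<And>u. u \<in> U \<Longrightarrow> \<exists>t. (0, t, u) \<in> S"
    and VU: "\<And>t u. (0, t, u) \<in> S \<Longrightarrow> t \<in> V \<longleftrightarrow> u \<in> U"
  obtains \<phi> where "bij_betw \<phi> T U" "\<And>t. t \<in> T \<Longrightarrow> (0, t, \<phi> t) \<in> S"
    "\<And>s t. s \<in> T \<Longrightarrow> t \<in> T \<Longrightarrow> \<phi> (s + t) = \<phi> s + \<phi> t" "\<And>t. t \<in> T \<Longrightarrow> q (\<phi> t) = q t"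
proof -
  have TV: "T \<subseteq> V"
    using subset_plus_right[OF f2_subspace_0[OF f2_subspace_slots(2)], of T] T(3) by simp
  define \<phi> where "\<phi> t = (SOME u. (0, t, u) \<in> S)" for t
  have \<phi>: "(0, t, \<phi> t) \<in> S" if "t \<in> T" for t
  proof -
    have "\<exists>u. (0, t, u) \<in> S"
      using that TV V by blast
    then show ?thesis
      unfolding \<phi>_def by (rule someI_ex)
  qed
  have unique: "u = u'" if "(0, t, u) \<in> S" "(0, t, u') \<in> S" for t u u'
    using no3[of "u + u'"] add_S[OF that] by (simp add: add_eq_0_iff_eq)
  have add: "\<phi> (s + t) = \<phi> s + \<phi> t" if "s \<in> T" "t \<in> T" for s t
    using unique[OF \<phi>[OF f2_subspace_add[OF T(1) that]]] add_S[OF \<phi>[OF that(1)] \<phi>[OF that(2)]]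
    by simp
  have "inj_on \<phi> T"
  proof (rule inj_onI)
    fix s t assume st: "s \<in> T" "t \<in> T" "\<phi> s = \<phi> t"
    then have "s + t \<in> S2 \<inter> T"
      using add_S[OF \<phi>[OF st(1)] \<phi>[OF st(2)]] f2_subspace_add[OF T(1) st(1,2)]
      by (simp add: slots_iff)
    then show "s = t"
      unfolding T(2) by (simp add: add_eq_0_iff_eq)
  qed
  moreover have "\<phi> t \<in> U" if "t \<in> T" for t
    using VU[OF \<phi>[OF that]] that TV by blast
  moreover have "u \<in> \<phi> ` T" if u: "u \<in> U" for u
  proof -
    obtain t where t: "(0, t, u) \<in> S"
      using U[OF u] by blast
    then have "t \<in> S2 + T"
      using VU u T(3) by simp
    then obtain s r where sr: "s \<in> S2" "r \<in> T" "t = s + r"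
      by (rule set_plus_elim)
    then have "(0, r, u) \<in> S"
      using add_S[of 0 s 0, OF _ t] by (simp add: slots_iff)
    then show ?thesis
      using unique[OF _ \<phi>[OF sr(2)]] sr(2) by blast
  qed
  ultimately have "bij_betw \<phi> T U"
    by (auto simp: bij_betw_def)
  then show thesis
    using that \<phi> add q_S23[OF \<phi>] by blast
qed

lemma slot_perps:
  assumes S23: "(0, t, u) \<in> S"
  shows "t \<in> perp q S2" and "(\<And>p. p \<in> P \<Longrightarrow> (p, p, 0) \<in> S) \<Longrightarrow> t \<in> perp q P"
    and "(\<And>x. x \<in> Q \<Longrightarrow> (x, 0, x) \<in> S) \<Longrightarrow> u \<in> perp q Q"
proof -
  show "t \<in> perp q S2"
  proof (rule perpI)
    fix s assume "s \<in> S2"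
    then have "(0, s, 0) \<in> S"
      by (simp add: slots_iff)
    then show "polar q s t = 0"
      using polar_S12[OF _ S23] by simp
  qed
  show "t \<in> perp q P" if P: "\<And>p. p \<in> P \<Longrightarrow> (p, p, 0) \<in> S"
  proof (rule perpI)
    fix p assume "p \<in> P"
    show "polar q p t = 0"
      using polar_S12[OF P[OF \<open>p \<in> P\<close>] S23] by simp
  qed
  show "u \<in> perp q Q" if Q: "\<And>x. x \<in> Q \<Longrightarrow> (x, 0, x) \<in> S"
  proof (rule perpI)
    fix x assume "x \<in> Q"
    show "polar q x u = 0"
      using polar_S13[OF Q[OF \<open>x \<in> Q\<close>] S23] by simp
  qed
qed

text \<open>
  Once \<open>P\<close> is embedded diagonally, the second entries of vectors of \<open>S\<close> supported on the first
  two coordinates are exactly those in \<open>S\<^sub>2 + P\<close>, and \<open>dual23\<close> applies.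
\<close>

lemma slot2_dual:
  assumes P: "A12 = S1 + P" "\<And>p. p \<in> P \<Longrightarrow> (p, p, 0) \<in> S" and t: "t \<in> perp q S2" "t \<in> perp q P"
  obtains u where "(0, t, u) \<in> S"
proof (rule dual23)
  fix a x assume ax: "(a, x, 0) \<in> S"
  then have "a \<in> S1 + P"
    unfolding P(1)[symmetric] slots_iff by blast
  then obtain s p where sp: "s \<in> S1" "p \<in> P" "a = s + p"
    by (rule set_plus_elim)
  then have "(s + p + a, p + x, 0) \<in> S"
    using add_S[OF add_S[OF _ P(2)[of p]] ax, of s 0 0] by (simp add: slots_iff)
  then have "p + x \<in> S2"
    using sp(3) by (simp add: slots_iff)
  then have "polar q t (p + x) = 0"
    by (rule perpD(1)[OF t(1)])
  then show "polar q t x = 0"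
    using perpD(1)[OF t(2) sp(2)] by (simp add: polar_add_right)
qed

lemma slot3_dual:
  assumes no3: "\<And>c. (0, 0, c) \<in> S \<Longrightarrow> c = 0"
    and Q: "A13 = S1 + Q" "\<And>x. x \<in> Q \<Longrightarrow> (x, 0, x) \<in> S" and u: "u \<in> perp q Q"
  obtains t where "(0, t, u) \<in> S"
proof (rule dual32)
  fix a x assume ax: "(a, 0, x) \<in> S"
  then have "a \<in> S1 + Q"
    unfolding Q(1)[symmetric] slots_iff by blast
  then obtain s p where sp: "s \<in> S1" "p \<in> Q" "a = s + p"
    by (rule set_plus_elim)
  then have "(s + p + a, 0, p + x) \<in> S"
    using add_S[OF add_S[OF _ Q(2)[of p]] ax, of s 0 0] by (simp add: slots_iff)
  then have "p = x"
    using sp(3) no3[of "p + x"] by (simp add: add_eq_0_iff_eq)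
  then show "polar q u x = 0"
    using perpD(1)[OF u sp(2)] by simp
qed

lemma spanning_23:
  assumes no3: "\<And>c. (0, 0, c) \<in> S \<Longrightarrow> c = 0" and R: "f2_subspace R"
    and gens: "\<And>s. s \<in> S2 \<Longrightarrow> (0, s, 0) \<in> R" "\<And>t. t \<in> T \<Longrightarrow> (0, t, \<phi> t) \<in> R"
    and \<phi>: "\<And>t. t \<in> T \<Longrightarrow> (0, t, \<phi> t) \<in> S"
    and bc: "(0, b, c) \<in> S" "b \<in> S2 + T"
  shows "(0, b, c) \<in> R"
proof -
  obtain s t where st: "s \<in> S2" "t \<in> T" "b = s + t"
    using bc(2) by (rule set_plus_elim)
  then have "(0, 0, c + \<phi> t) \<in> S"
    using add_S[OF add_S[OF bc(1) \<phi>[OF st(2)]], of 0 s 0] by (simp add: slots_iff ac_simps)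
  then have "c = \<phi> t"
    using no3[of "c + \<phi> t"] by (simp add: add_eq_0_iff_eq)
  then show ?thesis
    using f2_subspace_add[OF R gens(1)[OF st(1)] gens(2)[OF st(2)]] st(3) by simp
qed

text \<open>
  The first entry of a vector of \<open>S\<close> lies in \<open>S\<^sub>1\<^sup>\<bottom> = A\<^sub>1\<^sub>2 + A\<^sub>1\<^sub>3\<close>, so generators clear it; the
  remaining vector \<open>(0, b, c)\<close> has \<open>b\<close> orthogonal to \<open>S\<^sub>2\<close> and \<open>P\<close>, thus in \<open>S\<^sub>2 + T\<close>.
\<close>

lemma first_kind_spanning:
  assumes no3: "\<And>c. (0, 0, c) \<in> S \<Longrightarrow> c = 0" and R: "f2_subspace R"
    and rad: "A12 \<inter> A13 = S1"
    and P: "A12 = S1 + P" "\<And>p. p \<in> P \<Longrightarrow> (p, p, 0) \<in> S"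
    and Q: "A13 = S1 + Q" "\<And>x. x \<in> Q \<Longrightarrow> (x, 0, x) \<in> S"
    and T: "S2 + T = perp q S2 \<inter> perp q P" "\<And>t. t \<in> T \<Longrightarrow> (0, t, \<phi> t) \<in> S"
    and gens: "\<And>s. s \<in> S1 \<Longrightarrow> (s, 0, 0) \<in> R" "\<And>s. s \<in> S2 \<Longrightarrow> (0, s, 0) \<in> R"
      "\<And>p. p \<in> P \<Longrightarrow> (p, p, 0) \<in> R" "\<And>x. x \<in> Q \<Longrightarrow> (x, 0, x) \<in> R"
      "\<And>t. t \<in> T \<Longrightarrow> (0, t, \<phi> t) \<in> R"
  shows "S \<subseteq> R"
proof clarify
  fix a b c assume abc: "(a, b, c) \<in> S"
  then have "a \<in> A12 + A13"
    using first_coordinate_perp perp_S1[OF rad] by simp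
  then obtain d e where "d \<in> S1 + P" "e \<in> S1 + Q" "a = d + e"
    unfolding P(1) Q(1) by (rule set_plus_elim)
  then obtain s p s' x where *: "s \<in> S1" "p \<in> P" "s' \<in> S1" "x \<in> Q" "a = (s + p) + (s' + x)"
    by (metis set_plus_elim)
  define r where "r = (s, 0, 0) + (s', 0, 0) + (p, p, 0) + (x, 0, x)"
  have "r \<in> S"
    unfolding r_def using * P(2) Q(2)
    by (intro f2_subspace_add[OF f2_subspace_S]) (auto simp: slots_iff)
  then have "(a, b, c) + r \<in> S"
    by (rule f2_subspace_add[OF f2_subspace_S abc])
  moreover have r: "r = (a, p, x)"
    using *(5) by (simp add: r_def ac_simps)
  ultimately have bc: "(0, b + p, c + x) \<in> S"
    by simp
  have "b + p \<in> S2 + T"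
    unfolding T(1) using slot_perps(1,2)[OF bc] P(2) by blast
  then have "(0, b + p, c + x) \<in> R"
    using spanning_23[OF no3 R gens(2,5) T(2) bc] by blast
  moreover have "r \<in> R"
    unfolding r_def using * gens by (intro f2_subspace_add[OF R]) auto
  ultimately have "(0, b + p, c + x) + r \<in> R"
    by (intro f2_subspace_add[OF R])
  then show "(a, b, c) \<in> R"
    by (simp add: r add.assoc)
qed

end

text \<open>
  The situation in which \<open>A\<^sub>1\<^sub>2\<close> and \<open>A\<^sub>1\<^sub>3\<close> have a radical modulo \<open>S\<^sub>1\<close>, before and after the
  second and third coordinates are adapted.
\<close>

locale second_kind_split = triple_lagrangian q S
  for q :: "'v::ab_group_add \<Rightarrow> bit" and S +
  fixes y :: 'v and P Q :: "'v set"
  assumes no3: "(0, 0, c) \<in> S \<Longrightarrow> c = 0"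
    and radical: "A12 \<inter> A13 = S1 + {0, y}" and q_y: "q y = 1"
    and P: "f2_subspace P" "(S1 + {0, y}) \<inter> P = {0}" "S1 + {0, y} + P = A12" "P \<inter> perp q P = {0}"
    and Q: "f2_subspace Q" "(S1 + {0, y}) \<inter> Q = {0}" "S1 + {0, y} + Q = A13" "Q \<inter> perp q Q = {0}"
begin

lemma subsets: "S1 \<subseteq> A12" "S1 \<subseteq> A13" "y \<in> A12" "y \<in> A13" "P \<subseteq> A12" "Q \<subseteq> A13"
proof -
  have "f2_subspace (S1 + {0, y})"
    by (intro f2_subspace_plus f2_subspace_slots f2_subspace_line)
  then show "P \<subseteq> A12" "Q \<subseteq> A13"
    using P(3) Q(3) subset_plus_right f2_subspace_0 by blast+
  show "S1 \<subseteq> A12" "S1 \<subseteq> A13" "y \<in> A12" "y \<in> A13"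
    using radical subset_plus_left[of "{0, y}" S1]
      subset_plus_right[OF f2_subspace_0[OF f2_subspace_slots(1)], of "{0, y}"] by auto
qed

lemma polar_A12_A13: "a \<in> A12 \<Longrightarrow> b \<in> A13 \<Longrightarrow> polar q a b = 0"
  using perp_A12 perpD(2) by blast

lemma orthogonal:
  "s \<in> S1 \<Longrightarrow> p \<in> P \<Longrightarrow> polar q s p = 0" "s \<in> S1 \<Longrightarrow> x \<in> Q \<Longrightarrow> polar q s x = 0"
  "p \<in> P \<Longrightarrow> x \<in> Q \<Longrightarrow> polar q p x = 0" "p \<in> P \<Longrightarrow> polar q p y = 0"
  "x \<in> Q \<Longrightarrow> polar q x y = 0" "s \<in> S1 \<Longrightarrow> polar q s y = 0"
  using polar_A12_A13 subsets by (metis polar_commute subsetD)+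

lemma orthogonal_sym:
  "s \<in> S1 \<Longrightarrow> p \<in> P \<Longrightarrow> polar q p s = 0" "s \<in> S1 \<Longrightarrow> x \<in> Q \<Longrightarrow> polar q x s = 0"
  "p \<in> P \<Longrightarrow> x \<in> Q \<Longrightarrow> polar q x p = 0" "p \<in> P \<Longrightarrow> polar q y p = 0"
  "x \<in> Q \<Longrightarrow> polar q y x = 0" "s \<in> S1 \<Longrightarrow> polar q y s = 0"
  using orthogonal polar_commute by metis+

lemma y_notin: "y \<notin> S1"
  using q_S1 q_y by auto

lemma perp_sum: "perp q (S1 + P + Q) = perp q S1 \<inter> perp q P \<inter> perp q Q"
  using f2_subspace_slots(1) P(1) Q(1)
  by (simp add: perp_plus f2_subspace_plus f2_subspace_0)

lemma y_perp: "y \<in> perp q (S1 + P + Q)"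
  using orthogonal unfolding perp_sum by (auto simp: perp_def polar_commute)

lemma S1_perp: "S1 \<subseteq> perp q (S1 + P + Q)"
  using orthogonal polar_singular[OF f2_subspace_slots(1) q_S1]
  unfolding perp_sum by (auto simp: perp_def)

text \<open>
  Correcting a vector by \<open>z\<close> makes it orthogonal to \<open>y\<close> too, hence to \<open>A\<^sub>1\<^sub>2\<close>, and places it in
  \<open>A\<^sub>1\<^sub>3\<close>; being orthogonal to the non-singular \<open>Q\<close>, it has no component there.
\<close>

lemma perp_S1_P_Q:
  assumes z: "z \<in> perp q (S1 + P + Q)" "polar q y z = 1"
  shows "perp q (S1 + P + Q) = S1 + {0, y} + {0, z}"
proof
  show "perp q (S1 + P + Q) \<subseteq> S1 + {0, y} + {0, z}"
  proof
    fix v assume v: "v \<in> perp q (S1 + P + Q)"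
    define e where "e = bit_scale (polar q v y) z"
    have "e = 0 \<or> e = z"
      by (cases "polar q v y") (simp_all add: e_def)
    have w: "v + e \<in> perp q (S1 + P + Q)"
      using \<open>e = 0 \<or> e = z\<close> v z(1) f2_subspace_add[OF f2_subspace_perp] by auto
    have "polar q (v + e) y = 0"
      using z(2) by (simp add: e_def polar_add_left polar_bit_scale polar_commute[of z])
    then have "v + e \<in> perp q (S1 + {0, y} + P)"
      using w f2_subspace_slots(1) P(1)
      by (auto simp: perp_sum perp_plus f2_subspace_plus f2_subspace_0 f2_subspace_line
          perp_iff[of _ "{0, y}"])
    then have "v + e \<in> S1 + {0, y} + Q"
      by (simp add: P(3) Q(3) perp_A12)
    then obtain d x where dx: "d \<in> S1 + {0, y}" "x \<in> Q" "v + e = d + x"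
      by (rule set_plus_elim)
    have "polar q x x' = 0" if x': "x' \<in> Q" for x'
    proof -
      have "d \<in> A12"
        using dx(1) radical by blast
      then have "polar q d x' = 0"
        using x' polar_A12_A13 subsets by blast
      moreover have "polar q (v + e) x' = 0"
        using w x' by (auto simp: perp_sum perpD)
      ultimately show ?thesis
        by (simp add: dx(3) polar_add_left)
    qed
    then have "x \<in> Q \<inter> perp q Q"
      using dx(2) by (simp add: perp_def)
    then have "x = 0"
      unfolding Q(4) by simp
    then have "v = d + e"
      using dx(3) by (metis add.right_neutral add.commute add_self_left)
    then show "v \<in> S1 + {0, y} + {0, z}"
      using dx(1) \<open>e = 0 \<or> e = z\<close> by auto
  qed
  show "S1 + {0, y} + {0, z} \<subseteq> perp q (S1 + P + Q)"
    using y_perp z(1) S1_perp f2_subspace_slots(1) f2_subspace_0[OF f2_subspace_perp]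
    by (simp add: plus_subset_iff f2_subspace_plus f2_subspace_line f2_subspace_perp)
qed

text \<open>
  Some \<open>z\<close> orthogonal to \<open>S\<^sub>1 + P + Q\<close> pairs non-trivially with \<open>y\<close>, as \<open>y\<close> is not in
  \<open>S\<^sub>1 + P + Q\<close>.  Any such \<open>z\<close> is singular, by \<open>plane_over_singular_hyperbolic\<close> for the totally
  singular space \<open>S\<^sub>1 + M + N\<close>.
\<close>

lemma exists_singular_partner:
  assumes L: "lagrangian UNIV L" and M: "lagrangian P M" "lagrangian Q N"
  obtains z where "z \<in> perp q (S1 + P + Q)" "polar q y z = 1" "q z = 0"
proof -
  have "y \<notin> perp q (perp q (S1 + P + Q))"
  proof
    assume "y \<in> perp q (perp q (S1 + P + Q))"
    then have "y \<in> S1 + P + Q"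
      by (simp add: double_perp f2_subspace_plus f2_subspace_slots P(1) Q(1))
    then obtain s p x where *: "s \<in> S1" "p \<in> P" "x \<in> Q" "y = s + p + x"
      by (metis set_plus_elim)
    then have "p + (s + p + x) = s + x" "x + (s + p + x) = s + p"
      by (simp_all add: ac_simps)
    then have p: "p = y + (s + x)" and x: "x = y + (s + p)"
      using *(4) by (metis add.commute add_self_left)+
    have "p \<in> perp q P"
      using orthogonal *(1,3) by (subst p) (auto simp: perp_def polar_add_left orthogonal_sym)
    moreover have "x \<in> perp q Q"
      using orthogonal *(1,2) by (subst x) (auto simp: perp_def polar_add_left orthogonal_sym)
    ultimately have "p = 0" "x = 0"
      using *(2,3) P(4) Q(4) by blast+
    then show False
      using * y_notin by simp
  qed
  then obtain z where z: "z \<in> perp q (S1 + P + Q)" "polar q y z = 1"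
    by (auto simp: perp_def)
  have subM: "f2_subspace M" "\<forall>v\<in>M. q v = 0" "P \<inter> perp q M = M"
    and subN: "f2_subspace N" "\<forall>v\<in>N. q v = 0" "Q \<inter> perp q N = N"
    using M by (auto simp: lagrangian_def)
  define K where "K = S1 + M + N"
  have K: "f2_subspace K" "\<forall>v\<in>K. q v = 0"
  proof -
    show "f2_subspace K"
      unfolding K_def by (intro f2_subspace_plus f2_subspace_slots subM subN)
    show "\<forall>v\<in>K. q v = 0"
    proof
      fix v assume "v \<in> K"
      then obtain s \<mu> \<nu> where *: "s \<in> S1" "\<mu> \<in> M" "\<nu> \<in> N" "v = s + \<mu> + \<nu>"
        unfolding K_def by (metis set_plus_elim)
      then have "polar q s \<mu> = 0" "polar q s \<nu> = 0" "polar q \<mu> \<nu> = 0"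
        using orthogonal subM(3) subN(3) by blast+
      then show "q v = 0"
        using * q_S1 subM(2) subN(2) by (simp add: q_add polar_add_left)
    qed
  qed
  have perpK: "perp q K = perp q S1 \<inter> perp q M \<inter> perp q N"
    unfolding K_def using f2_subspace_slots(1) subM(1) subN(1)
    by (simp add: perp_plus f2_subspace_plus f2_subspace_0)
  have "perp q K = K + {0, y} + {0, z}"
  proof
    have "perp q (S1 + P + Q) \<subseteq> perp q K"
      unfolding perp_sum perpK using subM(3) subN(3) perp_anti_mono by blast
    moreover have "K \<subseteq> perp q K"
      using polar_singular[OF K] by (auto simp: perp_def)
    ultimately show "K + {0, y} + {0, z} \<subseteq> perp q K"
      using y_perp z(1) K(1) f2_subspace_0[OF f2_subspace_perp]
      by (auto simp: plus_subset_iff f2_subspace_plus f2_subspace_line f2_subspace_perp)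
    \<comment> \<open>Split off the components in the non-singular spaces \<open>P\<close> and \<open>Q\<close>; they are orthogonal to
      \<open>M\<close> and \<open>N\<close>, hence in them.\<close>
    show "perp q K \<subseteq> K + {0, y} + {0, z}"
    proof
      fix v assume v: "v \<in> perp q K"
      obtain p r where pr: "p \<in> P" "r \<in> perp q P" "v = p + r"
        using plus_perp_eq_UNIV[OF P(1,4)] by (metis UNIV_I set_plus_elim)
      obtain x r' where xr: "x \<in> Q" "r' \<in> perp q Q" "r = x + r'"
        using plus_perp_eq_UNIV[OF Q(1,4)] by (metis UNIV_I set_plus_elim)
      have "polar q p \<mu> = 0" if "\<mu> \<in> M" for \<mu>
      proof -
        have "polar q r \<mu> = 0" "polar q v \<mu> = 0"
          using that subM(3) pr(2) v unfolding perpK by (auto simp: perp_def)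
        then show ?thesis
          by (simp add: pr(3) polar_add_left)
      qed
      then have pM: "p \<in> M"
        using subM(3) pr(1) by (auto simp: perp_def)
      have "polar q x \<nu> = 0" if "\<nu> \<in> N" for \<nu>
      proof -
        have "\<nu> \<in> Q"
          using that subN(3) by blast
        then have "polar q r' \<nu> = 0" "polar q v \<nu> = 0" "polar q p \<nu> = 0"
          using that xr(2) v pr(1) orthogonal unfolding perpK by (auto simp: perp_def)
        then show ?thesis
          by (simp add: pr(3) xr(3) polar_add_left)
      qed
      then have xN: "x \<in> N"
        using subN(3) xr(1) by (auto simp: perp_def)
      have "r' \<in> perp q P"
      proof -
        have "polar q x p' = 0" if "p' \<in> P" for p'
          using orthogonal(3)[OF that xr(1)] by (simp add: polar_commute)
        then show ?thesis
          using pr(2) by (simp add: xr(3) perp_def polar_add_left)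
      qed
      moreover have "r' \<in> perp q S1"
      proof -
        have "polar q x s = 0" "polar q p s = 0" if "s \<in> S1" for s
          using orthogonal(1)[OF that pr(1)] orthogonal(2)[OF that xr(1)]
          by (simp_all add: polar_commute)
        then show ?thesis
          using v unfolding perpK by (simp add: perp_def pr(3) xr(3) polar_add_left)
      qed
      ultimately have "r' \<in> S1 + {0, y} + {0, z}"
        using xr(2) unfolding perp_S1_P_Q[OF z, symmetric] perp_sum by blast
      then obtain s e f where *: "s \<in> S1" "e \<in> {0, y}" "f \<in> {0, z}" "r' = s + e + f"
        by (metis set_plus_elim)
      then have "v = s + p + x + e + f"
        by (simp add: pr(3) xr(3) ac_simps)
      then show "v \<in> K + {0, y} + {0, z}"
        unfolding K_def using * pM xN by (auto intro!: set_plus_intro)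
    qed
  qed
  then have "q z = 0"
    using plane_over_singular_hyperbolic[OF L K _ z(2) q_y] by simp
  then show thesis
    using that z by blast
qed

text \<open>
  A lift \<open>(z, b, c)\<close> has \<open>q(b) = q(c)\<close>, and adding a vector \<open>(0, t, u)\<close> of \<open>S\<close> replaces \<open>c\<close> by
  \<open>c + u\<close>.  Suppose that this never makes the third entry singular.  Then \<open>q(u) = \<langle>c, u\<rangle>\<close> for all
  such \<open>u\<close>, so they form a totally isotropic space, which by \<open>dual31\<close> reduces to \<open>{0, w}\<close> with
  \<open>(y, 0, w)\<close> in \<open>S\<close>.  The third coordinate then is the orthogonal sum of an isometric copy of \<open>Q\<close>
  and the plane of \<open>w\<close> and \<open>c\<close>.  As \<open>Q\<close> is of plus type, that plane is hyperbolic by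
  \<open>plane_over_singular_hyperbolic\<close>, and \<open>c\<close> was singular after all.
\<close>

lemma exists_singular_lift:
  assumes L: "lagrangian UNIV L" and M: "lagrangian Q M"
    and z: "z \<in> perp q (S1 + P + Q)" "polar q y z = 1" "q z = 0"
  obtains b c where "(z, b, c) \<in> S" "q b = 0" "q c = 0"
proof -
  have "z \<in> perp q S1"
    using z(1) unfolding perp_sum by blast
  then have zS1: "polar q z s = 0" if "(s, 0, 0) \<in> S" for s
    using that by (simp add: perp_def slots_iff)
  obtain b c where bc: "(z, b, c) \<in> S"
    by (rule projection1[of z]) (use zS1 in auto)
  have qbc: "q b = q c"
    using q_S[OF bc] by (simp only: z(3) add_0_left bit_add_eq_0_iff)
  show thesis
  proof (cases "\<exists>t u. (0, t, u) \<in> S \<and> q (c + u) = 0")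
    case True
    then obtain t u where tu: "(0, t, u) \<in> S" "q (c + u) = 0"
      by blast
    have *: "(z, b + t, c + u) \<in> S"
      using add_S[OF bc tu(1)] by simp
    then have "q (b + t) = q (c + u)"
      using q_S[OF *] by (simp only: z(3) add_0_left bit_add_eq_0_iff)
    then show thesis
      using that[OF *] tu(2) by simp
  next
    case False
    then have none: "q (c + u) = 1" if "(0, t, u) \<in> S" for t u
      using that by auto
    have qc: "q c = 1"
      using none[of 0 0] by simp
    have qu: "q u = polar q c u" if "(0, t, u) \<in> S" for t u
    proof -
      have "1 + q u + polar q c u = 1"
        using none[OF that] unfolding q_add qc .
      then show ?thesis
        by (cases "q u"; cases "polar q c u") simp_all
    qed
    have isotropic: "polar q u u' = 0" if "(0, t, u) \<in> S" "(0, t', u') \<in> S" for t u t' u'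
    proof -
      have "q (u + u') = polar q c (u + u')"
        using qu[of "t + t'" "u + u'"] add_S[OF that] by simp
      also have "\<dots> = q u + q u'"
        by (simp only: polar_add_right qu[OF that(1)] qu[OF that(2)])
      finally show ?thesis
        by (cases "q u"; cases "q u'") (simp_all add: polar_def)
    qed
    obtain w where w: "(y, 0, w) \<in> S"
      using subsets(4) by (auto simp: slots_iff)
    have qw: "q w = 1"
      using q_S13[OF w] q_y by simp
    have line: "u = 0 \<or> u = w" if tu: "(0, t, u) \<in> S" for t u
    proof -
      obtain a where a: "(a, 0, u) \<in> S"
        by (rule dual31[of u]) (use isotropic[OF tu] in auto)
      have "(a, t, 0) \<in> S"
        using add_S[OF a tu] by simp
      then have "a \<in> S1 + {0, y}"
        unfolding radical[symmetric] Int_iff slots_iff using a by blast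
      then obtain s e where se: "s \<in> S1" "e \<in> {0, y}" "a = s + e"
        by (rule set_plus_elim)
      then have "(e, 0, u) \<in> S"
        using add_S[OF _ a, of s 0 0] by (simp add: slots_iff)
      then have "(0, 0, u) \<in> S \<or> (0, 0, u + w) \<in> S"
        using se(2) add_S[OF _ w, of y 0 u] by auto
      then show ?thesis
        using no3 add_eq_0_iff_eq by blast
    qed
    \<comment> \<open>The copy of the Lagrangian subspace \<open>M\<close> of \<open>Q\<close> in the third coordinate.\<close>
    define N where "N = {x'. \<exists>x\<in>M. (x, 0, x') \<in> S}"
    have subM: "f2_subspace M" "\<forall>v\<in>M. q v = 0" "Q \<inter> perp q M = M"
      using M by (auto simp: lagrangian_def)
    have N: "f2_subspace N" "\<forall>v\<in>N. q v = 0"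
    proof -
      show "f2_subspace N"
      proof (rule f2_subspaceI)
        show "0 \<in> N"
          using f2_subspace_0[OF subM(1)] zero_S unfolding N_def by blast
        show "u + v \<in> N" if uv: "u \<in> N" "v \<in> N" for u v
        proof -
          obtain x x' where "x \<in> M" "(x, 0, u) \<in> S" "x' \<in> M" "(x', 0, v) \<in> S"
            using uv by (auto simp: N_def)
          then show ?thesis
            using add_S[of x 0 u x' 0 v] f2_subspace_add[OF subM(1)] by (auto simp: N_def)
        qed
      qed
      show "\<forall>v\<in>N. q v = 0"
        using q_S13 subM(2) by (auto simp: N_def)
    qed
    have wN: "w \<in> perp q N"
    proof -
      have "polar q w x' = 0" if "x \<in> M" "(x, 0, x') \<in> S" for x x'
        using polar_S13[OF w that(2)] orthogonal(5)[of x] subM(3) that(1)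
        by (auto simp: polar_commute)
      then show ?thesis
        by (auto simp: perp_def N_def)
    qed
    have cN: "c \<in> perp q N"
    proof -
      have "polar q c x' = 0" if "x \<in> M" "(x, 0, x') \<in> S" for x x'
      proof -
        have "polar q z x = 0"
          using z(1) that(1) subM(3) unfolding perp_sum by (auto simp: perp_def)
        then show ?thesis
          using polar_S13[OF that(2) bc] by (simp add: polar_commute)
      qed
      then show ?thesis
        by (auto simp: perp_def N_def)
    qed
    have wc: "polar q w c = 1"
      using polar_S13[OF w bc] z(2) by simp
    have "perp q N = N + {0, w} + {0, c}"
    proof
      have "N \<subseteq> perp q N"
        using polar_singular[OF N] by (auto simp: perp_def)
      then show "N + {0, w} + {0, c} \<subseteq> perp q N"
        using wN cN N(1) f2_subspace_0[OF f2_subspace_perp]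
        by (simp add: plus_subset_iff f2_subspace_plus f2_subspace_line f2_subspace_perp)
      show "perp q N \<subseteq> N + {0, w} + {0, c}"
      proof
        fix v assume v: "v \<in> perp q N"
        define e where "e = bit_scale (polar q v w) c"
        have e: "e = 0 \<or> e = c"
          by (cases "polar q v w") (simp_all add: e_def)
        have ve: "v + e \<in> perp q N"
          using e v cN f2_subspace_add[OF f2_subspace_perp] by auto
        have "polar q (v + e) w = 0"
          using wc by (simp add: e_def polar_add_left polar_bit_scale polar_commute[of c])
        then have "polar q (v + e) u = 0" if "(0, t, u) \<in> S" for t u
          using line[OF that] by auto
        then obtain a where a: "(a, 0, v + e) \<in> S"
          by (rule dual31[of "v + e"]) auto
        then have "a \<in> S1 + {0, y} + Q"
          unfolding Q(3) slots_iff by blast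
        then obtain s d x where *: "s \<in> S1" "d \<in> {0, y}" "x \<in> Q" "a = s + d + x"
          by (metis set_plus_elim)
        define d' where "d' = (if d = 0 then 0 else w)"
        have "(d, 0, d') \<in> S"
          using *(2) w by (auto simp: d'_def)
        then have x: "(x, 0, v + e + d') \<in> S"
          using add_S[OF add_S[OF a], of d 0 d' s 0 0] *(1,4) by (simp add: slots_iff ac_simps)
        have ved: "v + e + d' \<in> perp q N"
          using f2_subspace_add[OF f2_subspace_perp ve wN] ve by (simp add: d'_def)
        have "polar q x \<mu> = 0" if \<mu>: "\<mu> \<in> M" for \<mu>
        proof -
          have "\<mu> \<in> A13"
            using \<mu> subM(3) subsets(6) by blast
          then obtain \<mu>' where \<mu>': "(\<mu>, 0, \<mu>') \<in> S"
            by (auto simp: slots_iff)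
          then have "\<mu>' \<in> N"
            using \<mu> by (auto simp: N_def)
          then show ?thesis
            using polar_S13[OF x \<mu>'] ved by (simp add: perp_def)
        qed
        then have "x \<in> M"
          using *(3) subM(3) by (auto simp: perp_def)
        then have "v + e + d' \<in> N"
          using x by (auto simp: N_def)
        then have "(v + e + d') + d' + e \<in> N + {0, w} + {0, c}"
          using e by (intro set_plus_intro) (auto simp: d'_def)
        then show "v \<in> N + {0, w} + {0, c}"
          by (simp add: add.assoc)
      qed
    qed
    then have "q c = 0"
      using plane_over_singular_hyperbolic[OF L N _ wc qw] by simp
    then show thesis
      using qc by simp
  qed
qed

lemma P_line:
  "f2_subspace (P + {0, y})" "S1 \<inter> (P + {0, y}) = {0}" "A12 = S1 + (P + {0, y})"
  and Q_line: "f2_subspace (Q + {0, y})" "S1 \<inter> (Q + {0, y}) = {0}" "A13 = S1 + (Q + {0, y})"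
proof -
  have *: "S1 \<inter> (X + {0, y}) = {0}" if X: "f2_subspace X" "(S1 + {0, y}) \<inter> X = {0}" for X
  proof -
    have "v = 0" if v: "v \<in> S1" "v \<in> X + {0, y}" for v
    proof -
      obtain x e where xe: "x \<in> X" "e \<in> {0, y}" "v = x + e"
        using v(2) by (rule set_plus_elim)
      then have "x = v + e"
        by (simp add: add.assoc)
      then have "x \<in> (S1 + {0, y}) \<inter> X"
        using set_plus_intro[OF v(1) xe(2)] xe(1) by simp
      then have "v = e"
        using X(2) xe(3) by simp
      then show ?thesis
        using xe(2) v(1) y_notin by auto
    qed
    then show ?thesis
      using f2_subspace_0[OF f2_subspace_slots(1)]
        f2_subspace_0[OF f2_subspace_plus[OF X(1) f2_subspace_line]] by blast
  qed
  show "f2_subspace (P + {0, y})" "f2_subspace (Q + {0, y})"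
    by (intro f2_subspace_plus P(1) Q(1) f2_subspace_line)+
  show "S1 \<inter> (P + {0, y}) = {0}" "S1 \<inter> (Q + {0, y}) = {0}"
    using * P Q by blast+
  show "A12 = S1 + (P + {0, y})" "A13 = S1 + (Q + {0, y})"
    using P(3) Q(3) by (simp_all add: ac_simps)
qed

end

section \<open>Normal forms under the wreath product\<close>

lemma (in f2_quadratic_space) isometry_0: "isometry g \<Longrightarrow> g 0 = 0"
  unfolding isometry_def by (metis add_0_right add_left_cancel)

lemma (in f2_quadratic_space) isometry_triple:
  assumes "isometry f" "isometry g" "isometry h"
  shows "f2_quadratic_space.isometry (q3 q) (\<lambda>(a, b, c). (f a, g b, h c))"
proof -
  interpret triple: f2_quadratic_space "q3 q"
    by (rule f2_quadratic_space_triple)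
  show ?thesis
    using assms by (intro triple.isometryI) (auto simp: isometry_def)
qed

lemma (in f2_quadratic_space) isometry_swaps:
  "f2_quadratic_space.isometry (q3 q) (\<lambda>(a, b, c). (b, a, c))"
  "f2_quadratic_space.isometry (q3 q) (\<lambda>(a, b, c). (a, c, b))"
  "f2_quadratic_space.isometry (q3 q) (\<lambda>(a, b, c). (c, b, a))"
proof -
  interpret triple: f2_quadratic_space "q3 q"
    by (rule f2_quadratic_space_triple)
  show "triple.isometry (\<lambda>(a, b, c). (b, a, c))" "triple.isometry (\<lambda>(a, b, c). (a, c, b))"
    "triple.isometry (\<lambda>(a, b, c). (c, b, a))"
    by (intro triple.isometryI; force simp: ac_simps)+
qed

context triple_lagrangian
begin

text \<open>
  The third coordinate is treated by \<open>normalise_second_coordinate\<close> for the space with the last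
  two coordinates exchanged, where the slot to be moved is \<open>S\<^sub>3 = 0\<close>.  Isometries of the last two
  coordinates leave \<open>S\<^sub>1\<close>, \<open>A\<^sub>1\<^sub>2\<close> and \<open>A\<^sub>1\<^sub>3\<close> unchanged.
\<close>

lemma normalise_coordinates:
  assumes card: "card S2 \<le> card S1" and no3: "\<And>c. (0, 0, c) \<in> S \<Longrightarrow> c = 0"
    and P: "f2_subspace P" "S1 \<inter> P = {0}" "P \<subseteq> A12"
    and Q: "f2_subspace Q" "S1 \<inter> Q = {0}" "Q \<subseteq> A13"
    and z: "(z, b, c) \<in> S" "q z = 0" "q b = 0" "q c = 0"
    and cases: "z = 0 \<and> b = 0 \<and> c = 0 \<or> (\<exists>y\<in>P \<inter> Q. polar q y z = 1)"
  obtains g h S' where "isometry g" "isometry h" "S' = (\<lambda>(a, b, c). (a, g b, h c)) ` S"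
    "triple_lagrangian q S'" "triple_lagrangian.S1 S' = S1" "triple_lagrangian.S2 S' \<subseteq> S1"
    "triple_lagrangian.A12 S' = A12" "triple_lagrangian.A13 S' = A13"
    "\<And>c. (0, 0, c) \<in> S' \<Longrightarrow> c = 0" "\<And>p. p \<in> P \<Longrightarrow> (p, p, 0) \<in> S'"
    "\<And>x. x \<in> Q \<Longrightarrow> (x, 0, x) \<in> S'" "(z, z, z) \<in> S'"
proof -
  have "z = 0 \<and> b = 0 \<or> (\<exists>y\<in>P \<inter> A13. polar q y z = 1)"
    using cases Q(3) by blast
  then obtain g where g: "isometry g" "\<And>s. s \<in> S2 \<Longrightarrow> g s \<in> S1"
    "\<And>p. p \<in> P \<Longrightarrow> \<exists>p'. (p, p', 0) \<in> S \<and> g p' = p" "g b = z"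
    using normalise_second_coordinate[OF card P z(1,2,3)] by metis
  define X where "X = (\<lambda>(a, b, c). (a, c, b)) ` S"
  have memX: "(a, c, b) \<in> X \<longleftrightarrow> (a, b, c) \<in> S" for a b c
    by (force simp: X_def)
  interpret X: triple_lagrangian q X
    unfolding X_def
    by (rule isometry_preserves_lagrangian_triple[OF triple_lagrangian_axioms isometry_swaps(2)])
  have X: "X.S1 = S1" "X.A12 = A13" "X.A13 = A12" "X.S2 = {0}"
    unfolding X.S1_def X.A12_def X.A13_def X.S2_def S1_def A12_def A13_def memX
    using no3 zero_S by auto
  have "card X.S2 \<le> card X.S1"
    using f2_subspace_0[OF f2_subspace_slots(1)] by (auto simp: X Suc_le_eq card_gt_0_iff finite_set)
  moreover have "z = 0 \<and> c = 0 \<or> (\<exists>y\<in>Q \<inter> X.A13. polar q y z = 1)"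
    using cases P(3) unfolding X by blast
  ultimately obtain h where h: "isometry h" "\<And>x. x \<in> Q \<Longrightarrow> \<exists>x'. (x, 0, x') \<in> S \<and> h x' = x" "h c = z"
    using X.normalise_second_coordinate[of Q z c b] Q z unfolding X memX by metis
  define S' where "S' = (\<lambda>(a, b, c). (a, g b, h c)) ` S"
  interpret S': triple_lagrangian q S'
    unfolding S'_def
    using isometry_preserves_lagrangian_triple[OF triple_lagrangian_axioms
        isometry_triple[OF isometry_id g(1) h(1)]] by simp
  have memS': "(a, g b, h c) \<in> S'" if "(a, b, c) \<in> S" for a b c
    using that by (force simp: S'_def)
  have inj0: "g b = 0 \<longleftrightarrow> b = 0" "h b = 0 \<longleftrightarrow> b = 0" for b
    using g(1) h(1) isometry_0 by (metis isometry_def bij_def inj_eq)+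
  have g0: "g 0 = 0" "h 0 = 0"
    by (simp_all add: inj0)
  have no3': "c = 0" if "(0, 0, c) \<in> S'" for c
    using that no3 by (auto simp: S'_def inj0)
  show thesis
  proof (rule that[OF g(1) h(1) S'_def S'.triple_lagrangian_axioms _ _ _ _ no3'])
    show "S'.S1 = S1"
      unfolding S'.S1_def S1_def by (auto simp: S'_def inj0 image_iff g0 intro: bexI[of _ "(_, 0, 0)"])
    show "S'.S2 \<subseteq> S1"
      using g(2) unfolding S'.S2_def S2_def by (auto simp: S'_def inj0)
    show "S'.A12 = A12"
    proof
      show "S'.A12 \<subseteq> A12"
        unfolding S'.A12_def A12_def by (auto simp: S'_def inj0)
      show "A12 \<subseteq> S'.A12"
        using memS'[of _ _ 0] by (auto simp: S'.A12_def A12_def g0)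
    qed
    show "S'.A13 = A13"
    proof
      show "S'.A13 \<subseteq> A13"
        unfolding S'.A13_def A13_def by (auto simp: S'_def inj0)
      show "A13 \<subseteq> S'.A13"
        using memS'[of _ 0 _] by (auto simp: S'.A13_def A13_def g0)
    qed
    show "(p, p, 0) \<in> S'" if "p \<in> P" for p
      using g(3)[OF that] memS'[of p _ 0] g0 by auto
    show "(x, 0, x) \<in> S'" if "x \<in> Q" for x
      using h(2)[OF that] memS'[of x 0] g0 by auto
    show "(z, z, z) \<in> S'"
      using memS'[OF z(1)] g(4) h(3) by simp
  qed
qed

end

locale second_kind_normal = second_kind_split +
  fixes z
  assumes diag_P: "p \<in> P \<Longrightarrow> (p, p, 0) \<in> S" and diag_Q: "x \<in> Q \<Longrightarrow> (x, 0, x) \<in> S"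
    and diag_y: "(y, y, 0) \<in> S" "(y, 0, y) \<in> S" and diag_z: "(z, z, z) \<in> S"
    and z_perp: "z \<in> perp q (S1 + P + Q)" and y_z: "polar q y z = 1" and q_z: "q z = 0"
begin

definition B where "B = {0, y} + {0, z}"

lemma f2_subspace_B: "f2_subspace B"
  unfolding B_def by (intro f2_subspace_plus f2_subspace_line)

lemma B_elements: "B = {0, y, z, y + z}"
  by (auto simp: B_def set_plus_def)

lemma perp_B: "perp q B = perp q {0, y} \<inter> perp q {0, z}"
  unfolding B_def by (simp add: perp_plus)

lemma z_y: "polar q z y = 1"
  using y_z by (simp add: polar_commute)

lemma B_nonsingular: "B \<inter> perp q B = {0}"
  unfolding perp_B using y_z z_y by (auto simp: B_elements perp_def polar_add_left)

lemma B_lagrangian: "lagrangian B {0, z}"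
  unfolding lagrangian_def using q_z y_z
  by (auto simp: B_elements perp_def polar_add_left f2_subspace_line)

lemma perp_S1_P_Q_eq: "perp q (S1 + P + Q) = S1 + B"
  using perp_S1_P_Q[OF z_perp y_z] by (simp add: B_def add.assoc)

lemma diag_P_line: "p \<in> P + {0, y} \<Longrightarrow> (p, p, 0) \<in> S"
  using diag_P diag_y(1) add_S[of _ _ 0 y y 0] by (auto elim!: set_plus_elim)

lemma diag_Q_line: "x \<in> Q + {0, y} \<Longrightarrow> (x, 0, x) \<in> S"
  using diag_Q diag_y(2) add_S[of _ 0 _ y 0 y] by (auto elim!: set_plus_elim)

lemma perp_P_S2_B: "perp q (P + S2 + B) = perp q S2 \<inter> perp q (P + {0, y}) \<inter> perp q {0, z}"
  using P(1) f2_subspace_slots(2) f2_subspace_B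
  by (simp add: perp_plus f2_subspace_0 f2_subspace_plus perp_B) blast

lemma perp_Q_B: "perp q (Q + B) = perp q (Q + {0, y}) \<inter> perp q {0, z}"
  using Q(1) f2_subspace_B by (simp add: perp_plus f2_subspace_0 perp_B) blast

text \<open>
  Pairing \<open>(0, t, u)\<close> with \<open>(z, z, z)\<close> shows that \<open>t\<close> is orthogonal to \<open>z\<close> if and only if \<open>u\<close> is.
\<close>

lemma slot_iff: "(0, t, u) \<in> S \<Longrightarrow> t \<in> perp q (P + S2 + B) \<longleftrightarrow> u \<in> perp q (Q + B)"
  using slot_perps(1)[of t u] slot_perps(2)[of t u "P + {0, y}"]
    slot_perps(3)[of t u "Q + {0, y}"] diag_P_line diag_Q_line
    polar_S23[OF _ diag_z, of t u]
  by (auto simp: perp_P_S2_B perp_Q_B perp_iff[of _ "{0, z}"])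

lemma slot2_dual': "t \<in> perp q (P + S2 + B) \<Longrightarrow> \<exists>u. (0, t, u) \<in> S"
  using slot2_dual[OF P_line(3) diag_P_line, of t] by (auto simp: perp_P_S2_B)

lemma slot3_dual': "u \<in> perp q (Q + B) \<Longrightarrow> \<exists>t. (0, t, u) \<in> S"
  using slot3_dual[OF no3 Q_line(3) diag_Q_line, of u] by (auto simp: perp_Q_B)

lemma S2_orthogonal: "S2 \<subseteq> perp q P" "S2 \<subseteq> perp q B" "S2 \<subseteq> perp q S2"
proof -
  have *: "(0, s, 0) \<in> S" if "s \<in> S2" for s
    using that by (simp add: slots_iff)
  show "S2 \<subseteq> perp q P"
    using slot_perps(2)[OF * diag_P] by blast
  show "S2 \<subseteq> perp q S2"
    using slot_perps(1)[OF *] by blast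
  show "S2 \<subseteq> perp q B"
    using polar_S12[OF * diag_y(1)] polar_S12[OF * diag_z] unfolding perp_B
    by (auto simp: perp_iff)
qed

lemma P_Q_orthogonal: "P \<subseteq> perp q B" "Q \<subseteq> perp q B" "S1 + P \<subseteq> perp q Q" "S1 \<subseteq> perp q B"
proof -
  have z: "polar q a z = 0" if "a \<in> S1 \<or> a \<in> P \<or> a \<in> Q" for a
    using that z_perp unfolding perp_sum by (auto simp: perp_def polar_commute[of _ z])
  show "P \<subseteq> perp q B" "Q \<subseteq> perp q B" "S1 \<subseteq> perp q B"
    using orthogonal z unfolding perp_B by (auto simp: perp_iff)
  show "S1 + P \<subseteq> perp q Q"
    using orthogonal f2_subspace_slots(1) P(1)
    by (auto simp: plus_subset_iff f2_subspace_perp perp_iff)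
qed

lemma perp_S1_sum: "perp q S1 = A12 + A13 + {0, z}"
proof -
  have "z \<in> perp q S1"
    using z_perp unfolding perp_sum by blast
  have "perp q (S1 + {0, y}) = A13 + A12"
    using perp_Int_perp[OF f2_subspace_slots(3,3)] radical by (simp add: perp_A12)
  moreover have "a \<in> perp q (S1 + {0, y}) + {0, z}" if a: "a \<in> perp q S1" for a
  proof -
    define e where "e = bit_scale (polar q a y) z"
    have e: "e \<in> {0, z}"
      by (cases "polar q a y") (simp_all add: e_def)
    have "polar q (a + e) y = 0"
      using z_y by (simp add: e_def polar_add_left polar_bit_scale)
    moreover have "a + e \<in> perp q S1"
      using e a \<open>z \<in> perp q S1\<close> f2_subspace_add[OF f2_subspace_perp] by auto
    ultimately have "a + e \<in> perp q (S1 + {0, y})"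
      using f2_subspace_slots(1) by (auto simp: perp_plus f2_subspace_0 perp_iff[of _ "{0, y}"])
    then have "(a + e) + e \<in> perp q (S1 + {0, y}) + {0, z}"
      using e by (rule set_plus_intro)
    then show ?thesis
      by (simp add: add.assoc)
  qed
  moreover have "perp q (S1 + {0, y}) + {0, z} \<subseteq> perp q S1"
    using \<open>z \<in> perp q S1\<close> perp_anti_mono[OF subset_plus_left[of "{0, y}" S1]]
      f2_subspace_0[OF f2_subspace_perp]
    by (auto simp: plus_subset_iff f2_subspace_perp f2_subspace_line)
  ultimately show ?thesis
    by (simp add: add.commute) blast
qed

text \<open>
  As for the first kind, generators clear the first entry, now with the help of \<open>(z, z, z)\<close>.  The
  second entry is then orthogonal to \<open>S\<^sub>2\<close>, \<open>P\<close> and \<open>y\<close>; the vector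
  \<open>(0, y, y) = (y, y, 0) + (y, 0, y)\<close> makes it orthogonal to \<open>z\<close> as well.
\<close>

lemma second_kind_spanning:
  assumes R: "f2_subspace R"
    and T: "S2 + T = perp q (P + S2 + B)" "\<And>t. t \<in> T \<Longrightarrow> (0, t, \<phi> t) \<in> S"
    and gens: "\<And>s. s \<in> S1 \<Longrightarrow> (s, 0, 0) \<in> R" "\<And>s. s \<in> S2 \<Longrightarrow> (0, s, 0) \<in> R"
      "\<And>p. p \<in> P \<Longrightarrow> (p, p, 0) \<in> R" "\<And>x. x \<in> Q \<Longrightarrow> (x, 0, x) \<in> R"
      "\<And>t. t \<in> T \<Longrightarrow> (0, t, \<phi> t) \<in> R" "(y, y, 0) \<in> R" "(y, 0, y) \<in> R" "(z, z, z) \<in> R"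
  shows "S \<subseteq> R"
proof clarify
  fix a b c assume abc: "(a, b, c) \<in> S"
  have zero_R: "(0, 0, 0) \<in> R"
    using f2_subspace_0[OF R] by (simp add: zero_prod_def)
  have "a \<in> A12 + A13 + {0, z}"
    using first_coordinate_perp[OF abc] perp_S1_sum by simp
  then obtain d d' g where d: "d \<in> S1 + {0, y} + P" "d' \<in> S1 + {0, y} + Q" "g \<in> {0, z}" "a = d + d' + g"
    unfolding P(3) Q(3) by (metis set_plus_elim)
  obtain s e p where *: "s \<in> S1" "e \<in> {0, y}" "p \<in> P" "d = s + e + p"
    using d(1) by (metis set_plus_elim)
  obtain s' e' x where **: "s' \<in> S1" "e' \<in> {0, y}" "x \<in> Q" "d' = s' + e' + x"
    using d(2) by (metis set_plus_elim)
  define r where "r = (s, 0, 0) + (e, e, 0) + (p, p, 0) + (s', 0, 0) + (e', 0, e') + (x, 0, x) + (g, g, g)"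
  have "r \<in> S" "r \<in> R"
    unfolding r_def using * ** d(3) diag_P diag_Q diag_y diag_z gens zero_R
    by (intro f2_subspace_add[OF f2_subspace_S] f2_subspace_add[OF R]; auto simp: slots_iff)+
  define f where "f = bit_scale (polar q (b + (e + p + g)) z) y"
  have f: "f \<in> {0, y}"
    by (cases "polar q (b + (e + p + g)) z") (simp_all add: f_def)
  then have fS: "(0, f, f) \<in> S" "(0, f, f) \<in> R"
    using add_S[OF diag_y] f2_subspace_add[OF R gens(6,7)] zero_R by auto
  have r: "r = (a, e + p + g, e' + x + g)"
    using d(4) *(4) **(4) by (simp add: r_def ac_simps)
  have "(a, b, c) + r + (0, f, f) \<in> S"
    using abc \<open>r \<in> S\<close> fS(1) by (intro f2_subspace_add[OF f2_subspace_S])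
  then have bc: "(0, b + (e + p + g) + f, c + (e' + x + g) + f) \<in> S"
    by (simp add: r)
  have "polar q (b + (e + p + g) + f) z = 0"
    unfolding polar_add_left[of "b + (e + p + g)" f]
    using y_z by (simp add: f_def polar_bit_scale)
  then have "b + (e + p + g) + f \<in> S2 + T"
    unfolding T(1) perp_P_S2_B using slot_perps(1,2)[OF bc] diag_P_line
    by (auto simp: perp_iff[of _ "{0, z}"])
  then have "(0, b + (e + p + g) + f, c + (e' + x + g) + f) \<in> R"
    using spanning_23[OF no3 R gens(2,5) T(2) bc] by blast
  then have "(0, b + (e + p + g) + f, c + (e' + x + g) + f) + (0, f, f) + r \<in> R"
    using fS(2) \<open>r \<in> R\<close> by (intro f2_subspace_add[OF R])
  then show "(a, b, c) \<in> R"
    by (simp add: r add.assoc)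
qed

end

section \<open>Vector spaces over the field with two elements\<close>

lemma module_subspace_iff:
  fixes scale :: "bit \<Rightarrow> 'a::ab_group_add \<Rightarrow> 'a"
  assumes "module scale"
  shows "module.subspace scale A \<longleftrightarrow> f2_subspace A"
proof -
  interpret module scale by fact
  have "scale c v \<in> A" if "0 \<in> A" "v \<in> A" for c v
    using that by (cases c) simp_all
  then show ?thesis
    by (auto simp: subspace_def f2_subspace_def)
qed

locale plus_space = finite_dimensional_vector_space scale Basis
  for scale :: "bit \<Rightarrow> 'v::ab_group_add \<Rightarrow> 'v" and Basis :: "'v set" +
  fixes q :: "'v \<Rightarrow> bit" and m :: nat
  assumes dim_UNIV_eq: "dim UNIV = 2 * m"
    and quadratic_form_q: "quadratic_form scale q" and plus_type_UNIV: "plus_type scale q UNIV"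
begin

lemma subspace_iff: "subspace A \<longleftrightarrow> f2_subspace A"
  by (rule module_subspace_iff) (rule module_axioms)

lemma double_zero: "x + x = (0 :: 'v)"
  using scale_left_distrib[of 1 1 x] by simp

text \<open>
  Finiteness is part of the conclusion because the finiteness of the whole space rests on it.
\<close>

lemma card_span_independent:
  "finite B \<Longrightarrow> independent B \<Longrightarrow> finite (span B) \<and> card (span B) = 2 ^ card B"
proof (induction B rule: finite_induct)
  case empty
  then show ?case by simp
next
  case (insert a B)
  then have IH: "finite (span B)" "card (span B) = 2 ^ card B" and a: "a \<notin> span B"
    using independent_insert[of a B] by auto
  have "v \<in> span (insert a B) \<longleftrightarrow> v \<in> span B \<union> (+) a ` span B" for v
  proof -
    have "v \<in> span (insert a B) \<longleftrightarrow> v \<in> span B \<or> v - a \<in> span B"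
    proof -
      have "(\<exists>k. v - scale k a \<in> span B) \<longleftrightarrow> v - scale 0 a \<in> span B \<or> v - scale 1 a \<in> span B"
        by (metis bit.exhaust)
      then show ?thesis
        by (simp add: span_breakdown_eq)
    qed
    moreover have "v - a \<in> span B \<longleftrightarrow> v \<in> (+) a ` span B"
      by (force simp: image_iff)
    ultimately show ?thesis
      by blast
  qed
  then have eq: "span (insert a B) = span B \<union> (+) a ` span B"
    by blast
  have disj: "span B \<inter> (+) a ` span B = {}"
  proof -
    have False if "a + v \<in> span B" "v \<in> span B" for v
      using a span_diff[OF that] by simp
    then show ?thesis
      by auto
  qed
  have "card (span (insert a B)) = card (span B) + card ((+) a ` span B)"
    unfolding eq using IH(1) disj by (intro card_Un_disjoint) auto
  also have "card ((+) a ` span B) = card (span B)"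
    by (rule card_image) simp
  finally show ?case
    using IH insert.hyps by (simp add: eq)
qed

sublocale f2_quadratic_space q
proof (rule f2_quadratic_space.intro)
  show "char_two TYPE('v)"
  proof (rule char_two.intro)
    show "x + x = (0 :: 'v)" for x
      by (rule double_zero)
    show "finite (UNIV :: 'v set)"
      using card_span_independent[of Basis] finite_Basis independent_Basis span_Basis by simp
  qed
  show "polar q (a + b) c = polar q a c + polar q b c" for a b c
    using quadratic_form_q unfolding quadratic_form_def Vector_Spaces.linear_def module_hom_iff
    by blast
  show "a = 0" if "\<And>b. polar q a b = 0" for a
    using plus_type_UNIV that
    by (auto simp: plus_type_def nonsingular_subspace_def perp_def)
qed

lemma card_eq: "f2_subspace A \<Longrightarrow> card A = 2 ^ dim A"
proof -
  assume "f2_subspace A"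
  then have A: "subspace A"
    by (simp add: subspace_iff)
  obtain B where B: "B \<subseteq> A" "independent B" "A \<subseteq> span B" "card B = dim A"
    using basis_exists by blast
  then have "span B = A"
    using span_minimal[OF B(1) A] by blast
  then show ?thesis
    using card_span_independent[OF finiteI_independent[OF B(2)] B(2)] B(4) by simp
qed

lemma dim_eqI: "f2_subspace A \<Longrightarrow> card A = 2 ^ n \<Longrightarrow> dim A = n"
  by (simp add: card_eq)

lemma dim_plus: "f2_subspace A \<Longrightarrow> f2_subspace B \<Longrightarrow> A \<inter> B = {0} \<Longrightarrow> dim (A + B) = dim A + dim B"
  by (rule dim_eqI) (simp_all add: f2_subspace_plus card_plus_direct card_eq[of A] card_eq[of B] power_add)

lemma dim_perp: "f2_subspace A \<Longrightarrow> dim A + dim (perp q A) = 2 * m"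
proof -
  assume A: "f2_subspace A"
  have "A \<inter> {0} = {0}"
    using f2_subspace_0[OF A] by blast
  then have "(2::nat) ^ (2 * m) = 2 ^ (dim A + dim (perp q A))"
    using card_perp[OF A f2_subspace_UNIV] card_eq[OF A] card_eq[OF f2_subspace_perp, of A]
      card_eq[OF f2_subspace_UNIV, unfolded dim_UNIV_eq]
    by (simp add: perp_UNIV power_add)
  then show ?thesis
    by simp
qed

lemma totally_singular_iff: "totally_singular scale q A \<longleftrightarrow> f2_subspace A \<and> (\<forall>a\<in>A. q a = 0)"
  by (simp add: totally_singular_def subspace_iff)

lemma maximal_totally_singular_iff: "maximal_totally_singular scale q W M \<longleftrightarrow> maximal_singular W M"
  unfolding maximal_totally_singular_def maximal_singular_def totally_singular_iff by blast

lemma nonsingular_subspace_iff: "nonsingular_subspace scale q W \<longleftrightarrow> f2_subspace W \<and> W \<inter> perp q W = {0}"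
  by (simp add: nonsingular_subspace_def subspace_iff)

lemma dim_lagrangian:
  assumes "f2_subspace W" "W \<inter> perp q W = {0}" "lagrangian W M"
  shows "dim W = 2 * dim M"
proof -
  have "f2_subspace M"
    using assms(3) by (simp add: lagrangian_def)
  then have "(2::nat) ^ dim W = 2 ^ (2 * dim M)"
    using card_lagrangian[OF assms] assms(1) by (simp add: card_eq mult_2 power_add)
  then show ?thesis
    by simp
qed

lemma plus_typeI:
  assumes "f2_subspace W" "W \<inter> perp q W = {0}" "lagrangian W M"
  shows "plus_type scale q W"
proof -
  have "dim N = dim M" if "maximal_singular W N" for N
    using dim_lagrangian[OF assms]
      dim_lagrangian[OF assms(1,2) maximal_singular_imp_lagrangian[OF assms that]] by simp
  then show ?thesis
    unfolding plus_type_def nonsingular_subspace_iff maximal_totally_singular_iff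
    using assms dim_lagrangian[OF assms] by blast
qed

lemma exists_lagrangian: "\<exists>L. lagrangian UNIV L"
proof -
  obtain L where L: "maximal_singular UNIV L"
    using exists_maximal_singular[OF f2_subspace_zero, of UNIV] by auto
  then have sub: "f2_subspace L" "\<forall>v\<in>L. q v = 0"
    by (auto simp: maximal_singular_def)
  have "dim L = m"
    using plus_type_UNIV L dim_UNIV_eq
    by (auto simp: plus_type_def maximal_totally_singular_iff)
  then have "card (perp q L) = card L"
    using dim_perp[OF sub(1)] by (simp add: card_eq sub(1) f2_subspace_perp)
  moreover have "L \<subseteq> perp q L"
    using polar_singular[OF sub] by (auto simp: perp_def)
  ultimately have "perp q L = L"
    using card_subset_eq[OF finite_set] by metis
  then show ?thesis
    using sub by (auto simp: lagrangian_def)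
qed

lemma orthogonal_group_iff: "g \<in> orthogonal_group scale q \<longleftrightarrow> isometry g"
proof -
  have "g (scale c v) = scale c (g v)" if "isometry g" for c v
    using that isometry_0 by (cases c) simp_all
  then have "Vector_Spaces.linear scale scale g \<and> bij g \<longleftrightarrow>
      (\<forall>x y. g (x + y) = g x + g y) \<and> bij g" if "\<forall>v. q (g v) = q v"
    using that vector_space_axioms module_axioms
    by (auto simp: Vector_Spaces.linear_def module_hom_iff isometry_def)
  then show ?thesis
    by (auto simp: orthogonal_group_def isometry_def)
qed

lemma module_scale3: "module (scale3 scale)"
  by standard
     (auto simp: scale3_def scale_right_distrib scale_left_distrib)

section \<open>The two kinds of data\<close>

lemma quadratic_isoI:
  assumes "bij_betw \<phi> T U" "f2_subspace T"
    and add: "\<And>s t. s \<in> T \<Longrightarrow> t \<in> T \<Longrightarrow> \<phi> (s + t) = \<phi> s + \<phi> t"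
    and "\<And>t. t \<in> T \<Longrightarrow> q (\<phi> t) = q t"
  shows "quadratic_iso scale q T U \<phi>"
proof -
  have "\<phi> 0 = 0"
    using add[of 0 0] f2_subspace_0[OF assms(2)] by simp
  then have "\<phi> (scale c t) = scale c (\<phi> t)" for c t
    by (cases c) simp_all
  then show ?thesis
    using assms by (simp add: quadratic_iso_def)
qed

lemma perp_disjoint:
  assumes "f2_subspace A" "f2_subspace N" "N \<inter> perp q N = {0}" "A \<subseteq> perp q N"
  shows "A \<inter> N = {0}"
  using assms f2_subspace_0 by blast

lemma span_generators_eq:
  assumes "f2_subspace S" "X \<subseteq> S" "S \<subseteq> module.span (scale3 scale) X"
  shows "S = module.span (scale3 scale) X"
proof -
  interpret triple_module: module "scale3 scale"
    by (rule module_scale3)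
  show ?thesis
    using assms triple_module.span_minimal[OF assms(2)] module_subspace_iff[OF module_scale3]
    by blast
qed

lemma f2_subspace_span3: "f2_subspace (module.span (scale3 scale) X)"
proof -
  interpret triple_module: module "scale3 scale"
    by (rule module_scale3)
  show ?thesis
    using triple_module.subspace_span module_subspace_iff[OF module_scale3] by blast
qed

lemma span3_base: "x \<in> X \<Longrightarrow> x \<in> module.span (scale3 scale) X"
proof -
  interpret triple_module: module "scale3 scale"
    by (rule module_scale3)
  show "x \<in> X \<Longrightarrow> x \<in> triple_module.span X"
    by (rule triple_module.span_base)
qed

text \<open>
  The dimension of \<open>P\<close> results from three complementary pairs: \<open>S\<^sub>1 + P\<close> and \<open>S\<^sub>1 + Q\<close>, \<open>S\<^sub>2 + P\<close> and
  \<open>S\<^sub>2 + T\<close>, \<open>Q\<close> and \<open>Q\<^sup>\<bottom>\<close>, where \<open>Q\<^sup>\<bottom>\<close> is isometric to \<open>T\<close>.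
\<close>

lemma first_kind:
  assumes "triple_lagrangian q S"
    and no3: "\<And>c. (0, 0, c) \<in> S \<Longrightarrow> c = 0"
    and S21: "triple_lagrangian.S2 S \<subseteq> triple_lagrangian.S1 S"
    and rad: "triple_lagrangian.A12 S \<inter> triple_lagrangian.A13 S = triple_lagrangian.S1 S"
    and P: "f2_subspace P" "triple_lagrangian.S1 S \<inter> P = {0}"
      "triple_lagrangian.A12 S = triple_lagrangian.S1 S + P" "\<And>p. p \<in> P \<Longrightarrow> (p, p, 0) \<in> S"
    and Q: "f2_subspace Q" "triple_lagrangian.S1 S \<inter> Q = {0}"
      "triple_lagrangian.A13 S = triple_lagrangian.S1 S + Q" "\<And>x. x \<in> Q \<Longrightarrow> (x, 0, x) \<in> S"
  shows "\<exists>k1 k2 S1 S2 P Q T \<phi>. first_kind_data scale q m k1 k2 S1 S2 P Q T \<phi> \<and>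
    S = first_kind_space scale S1 S2 P Q T \<phi>"
proof -
  interpret triple_lagrangian q S by fact
  have nonsing: "P \<inter> perp q P = {0}"
    by (rule complement_of_radical_nonsingular[OF f2_subspace_slots(3) _ P(1,2) P(3)[symmetric]])
       (simp add: perp_A12 rad)
  have perp1: "perp q (S1 + P) = S1 + Q"
    using perp_A12 P(3) Q(3) by simp
  have perp2: "perp q (S2 + P) = perp q S2 \<inter> perp q P"
    using f2_subspace_slots(2) P(1) by (simp add: perp_plus f2_subspace_0)
  have S2_perp: "S2 \<subseteq> perp q (S2 + P)" "S2 \<subseteq> perp q P"
    using slot_perps(1)[of _ 0] slot_perps(2)[of _ 0 P] P(4) unfolding perp2
    by (auto simp: slots_iff)
  obtain T where "f2_subspace T" "T \<subseteq> perp q (S2 + P)" "S2 \<inter> T = {0}" "S2 + T = perp q (S2 + P)"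
    by (rule exists_complement[OF f2_subspace_perp f2_subspace_slots(2) S2_perp(1)])
  note T = this(1,3,4)
  have V: "\<exists>u. (0, t, u) \<in> S" if "t \<in> perp q (S2 + P)" for t
    using slot2_dual[OF P(3,4), of t] that unfolding perp2 by blast
  have U: "\<exists>t. (0, t, u) \<in> S" if "u \<in> perp q Q" for u
    using slot3_dual[OF no3 Q(3,4) that] by blast
  have VU: "t \<in> perp q (S2 + P) \<longleftrightarrow> u \<in> perp q Q" if "(0, t, u) \<in> S" for t u
    using slot_perps[OF that] P(4) Q(4) unfolding perp2 by blast
  obtain \<phi> where \<phi>: "bij_betw \<phi> T (perp q Q)" "\<And>t. t \<in> T \<Longrightarrow> (0, t, \<phi> t) \<in> S"
    "\<And>s t. s \<in> T \<Longrightarrow> t \<in> T \<Longrightarrow> \<phi> (s + t) = \<phi> s + \<phi> t" "\<And>t. t \<in> T \<Longrightarrow> q (\<phi> t) = q t"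
    using slot_graph_isometry[OF no3 T V U VU] by metis
  have "S2 \<inter> P = {0}"
    by (rule perp_disjoint[OF f2_subspace_slots(2) P(1) nonsing S2_perp(2)])
  then have "dim S2 + dim P + (dim S2 + dim T) = 2 * m"
    using dim_perp[of "S2 + P"] dim_plus[of S2 P] dim_plus[of S2 T] T f2_subspace_slots(2) P(1)
    by (simp add: f2_subspace_plus)
  moreover have "dim S1 + dim P + (dim S1 + dim Q) = 2 * m"
    using dim_perp[of "S1 + P"] dim_plus[of S1 P] dim_plus[of S1 Q] perp1 P Q f2_subspace_slots(1)
    by (simp add: f2_subspace_plus)
  moreover have "dim T = dim (perp q Q)"
    using bij_betw_same_card[OF \<phi>(1)] T(1) by (simp add: card_eq f2_subspace_perp)
  moreover have "dim Q + dim (perp q Q) = 2 * m"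
    by (rule dim_perp[OF Q(1)])
  ultimately have dimP: "dim P + dim S1 + dim S2 = m"
    by linarith
  obtain L :: "'v set" where L: "f2_subspace L" "card P = card L * card L"
    by (rule nonsingular_square_card[OF P(1) nonsing])
  then have "(2::nat) ^ dim P = 2 ^ (2 * dim L)"
    using P(1) by (simp add: card_eq mult_2 power_add)
  then have "even (dim P)"
    by simp
  have dimP': "int (dim P) = int m - int (dim S1) - int (dim S2)"
    using dimP by linarith
  then have "even (int m - int (dim S1) - int (dim S2))"
    using \<open>even (dim P)\<close> by (metis even_of_nat_iff)
  moreover have "P \<subseteq> perp q S1"
  proof -
    have "P \<subseteq> A12"
      using subset_plus_right[OF f2_subspace_0[OF f2_subspace_slots(1)], of P] P(3) by simp
    then show ?thesis
      using S1_subset perp_A13 perp_anti_mono by blast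
  qed
  ultimately have "first_kind_data scale q m (dim S1) (dim S2) S1 S2 P Q T \<phi>"
    unfolding first_kind_data_def totally_singular_iff nonsingular_subspace_iff complement_in_def
      subspace_iff
    using dimP' nonsing P Q T f2_subspace_slots q_S1 q_S2 S21 perp1 quadratic_isoI[OF \<phi>(1) T(1) \<phi>(3,4)]
    by simp
  moreover have "S = first_kind_space scale S1 S2 P Q T \<phi>"
    unfolding first_kind_space_def
  proof (rule span_generators_eq[OF f2_subspace_S])
    show "S \<subseteq> module.span (scale3 scale) ({(s, 0, 0) | s. s \<in> S1} \<union> {(0, s, 0) | s. s \<in> S2} \<union>
        {(p, p, 0) | p. p \<in> P} \<union> {(x, 0, x) | x. x \<in> Q} \<union> {(0, t, \<phi> t) | t. t \<in> T})"
      by (rule first_kind_spanning[OF no3 f2_subspace_span3 rad P(3,4) Q(3,4) _ \<phi>(2)])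
         (auto simp: T(3) perp2 intro!: span3_base)
  qed (use P(4) Q(4) \<phi>(2) in \<open>auto simp: slots_iff\<close>)
  ultimately show ?thesis
    by blast
qed

text \<open>
  The dimensions of \<open>P\<close> and \<open>Q\<close> again result from three complementary pairs, \<open>S\<^sub>1 + P + Q\<close> and
  \<open>S\<^sub>1 + B\<close>, \<open>P + S\<^sub>2 + B\<close> and \<open>S\<^sub>2 + T\<close>, \<open>Q + B\<close> and its complement, which is isometric to \<open>T\<close>.
  The parity of \<open>m - k\<^sub>1 - k\<^sub>2\<close> then is that of \<open>dim P + 1\<close>, and \<open>dim P\<close> is even.
\<close>

lemma second_kind:
  assumes "second_kind_normal q S y P Q z"
    and S21: "triple_lagrangian.S2 S \<subseteq> triple_lagrangian.S1 S"
    and M: "lagrangian P M" "lagrangian Q N"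
  shows "\<exists>k1 k2 S1 S2 P Q B T y z \<phi>. second_kind_data scale q m k1 k2 S1 S2 P Q B T y z \<phi> \<and>
    S = second_kind_space scale S1 S2 P Q T y z \<phi>"
proof -
  interpret second_kind_normal q S y P Q z by fact
  note subs = f2_subspace_slots P(1) Q(1) f2_subspace_B
  have S2_perp: "S2 \<subseteq> perp q (P + S2 + B)"
    using S2_orthogonal subs by (simp add: perp_plus f2_subspace_0 f2_subspace_plus)
  obtain T where "f2_subspace T" "T \<subseteq> perp q (P + S2 + B)" "S2 \<inter> T = {0}"
    "S2 + T = perp q (P + S2 + B)"
    by (rule exists_complement[OF f2_subspace_perp f2_subspace_slots(2) S2_perp])
  note T = this(1,3,4)
  obtain \<phi> where \<phi>: "bij_betw \<phi> T (perp q (Q + B))" "\<And>t. t \<in> T \<Longrightarrow> (0, t, \<phi> t) \<in> S"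
    "\<And>s t. s \<in> T \<Longrightarrow> t \<in> T \<Longrightarrow> \<phi> (s + t) = \<phi> s + \<phi> t" "\<And>t. t \<in> T \<Longrightarrow> q (\<phi> t) = q t"
    using slot_graph_isometry[OF no3 T slot2_dual' slot3_dual' slot_iff] by metis
  have yz0: "y \<noteq> 0" "z \<noteq> 0" "y \<noteq> z"
    using y_z by auto
  have "dim B = 2"
  proof (rule dim_eqI[OF f2_subspace_B])
    have "card B = 4"
      unfolding B_elements using yz0 by (auto simp: add_eq_0_iff_eq card_insert_if)
    then show "card B = 2 ^ 2"
      by simp
  qed
  have "S1 \<inter> P \<subseteq> (S1 + {0, y}) \<inter> P"
    by (intro Int_mono subset_plus_left) auto
  then have "S1 \<inter> P \<subseteq> {0}"
    unfolding P(2) .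
  then have "S1 \<inter> P = {0}"
    using f2_subspace_0[OF subs(1)] f2_subspace_0[OF P(1)] by (intro equalityI) simp_all
  moreover have "(S1 + P) \<inter> Q = {0}"
    by (rule perp_disjoint[OF f2_subspace_plus[OF subs(1) P(1)] Q(1,4) P_Q_orthogonal(3)])
  moreover have S1B: "S1 \<inter> B = {0}"
    by (rule perp_disjoint[OF subs(1) f2_subspace_B B_nonsingular P_Q_orthogonal(4)])
  ultimately have d1: "dim S1 + dim P + dim Q + (dim S1 + 2) = 2 * m"
    using dim_perp[of "S1 + P + Q"] dim_plus[of "S1 + P" Q] dim_plus[of S1 P] dim_plus[of S1 B] subs
      \<open>dim B = 2\<close> by (simp add: perp_S1_P_Q_eq f2_subspace_plus)
  have "P \<inter> S2 = {0}"
    using perp_disjoint[OF subs(2) P(1,4) S2_orthogonal(1)] by (simp add: Int_commute)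
  moreover have "P + S2 \<subseteq> perp q B"
    using P_Q_orthogonal(1) S2_orthogonal(2) subs by (simp add: plus_subset_iff f2_subspace_perp)
  then have "(P + S2) \<inter> B = {0}"
    by (rule perp_disjoint[OF f2_subspace_plus[OF P(1) subs(2)] f2_subspace_B B_nonsingular])
  ultimately have d2: "dim P + dim S2 + 2 + (dim S2 + dim T) = 2 * m"
    using dim_perp[of "P + S2 + B"] dim_plus[of "P + S2" B] dim_plus[of P S2] dim_plus[of S2 T] T subs
      \<open>dim B = 2\<close> by (simp add: f2_subspace_plus)
  have "Q \<inter> B = {0}"
    by (rule perp_disjoint[OF Q(1) f2_subspace_B B_nonsingular P_Q_orthogonal(2)])
  moreover have "dim T = dim (perp q (Q + B))"
    using bij_betw_same_card[OF \<phi>(1)] T(1) by (simp add: card_eq f2_subspace_perp)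
  ultimately have d3: "dim Q + 2 + dim T = 2 * m"
    using dim_perp[of "Q + B"] dim_plus[of Q B] subs \<open>dim B = 2\<close> by (simp add: f2_subspace_plus)
  have dims: "int (dim P) = int m - int (dim S1) - int (dim S2) - 1"
    "int (dim Q) = int m - int (dim S1) + int (dim S2) - 1"
    using d1 d2 d3 by linarith+
  have "int m - int (dim S1) - int (dim S2) = 2 * int (dim M) + 1"
    using dims(1) dim_lagrangian[OF P(1,4) M(1)] by simp
  then have "odd (int m - int (dim S1) - int (dim S2))"
    by simp
  moreover have "P \<subseteq> perp q S1" "Q \<subseteq> perp q (S1 + P)"
    using orthogonal_sym subs unfolding perp_plus[OF f2_subspace_0[OF subs(1)] f2_subspace_0[OF P(1)]]
    by (auto simp: perp_def)
  moreover have "complement_in scale (perp q (S1 + P + Q)) S1 B"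
    using S1B subs by (simp add: complement_in_def subspace_iff perp_S1_P_Q_eq)
  moreover have "complement_in scale (perp q (P + S2 + B)) S2 T"
    using T by (simp add: complement_in_def subspace_iff)
  moreover have "plus_type scale q P" "plus_type scale q Q" "plus_type scale q B"
    using plus_typeI P(1,4) Q(1,4) M f2_subspace_B B_nonsingular B_lagrangian by blast+
  ultimately have "second_kind_data scale q m (dim S1) (dim S2) S1 S2 P Q B T y z \<phi>"
    unfolding second_kind_data_def totally_singular_iff
    using dims subs q_S1 q_S2 S21 quadratic_isoI[OF \<phi>(1) T(1) \<phi>(3,4)] \<open>dim B = 2\<close> q_y q_z yz0
    by (simp add: B_elements)
  moreover have "S = second_kind_space scale S1 S2 P Q T y z \<phi>"
    unfolding second_kind_space_def
  proof (rule span_generators_eq[OF f2_subspace_S])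
    show "S \<subseteq> module.span (scale3 scale) ({(s, 0, 0) | s. s \<in> S1} \<union> {(0, s, 0) | s. s \<in> S2} \<union>
        {(p, p, 0) | p. p \<in> P} \<union> {(x, 0, x) | x. x \<in> Q} \<union> {(0, t, \<phi> t) | t. t \<in> T} \<union>
        {(y, y, 0), (y, 0, y), (z, z, z)})"
      by (rule second_kind_spanning[OF f2_subspace_span3 T(3) \<phi>(2)]) (auto intro!: span3_base)
  qed (use diag_P diag_Q diag_y diag_z \<phi>(2) in \<open>auto simp: slots_iff\<close>)
  ultimately show ?thesis
    by blast
qed

section \<open>The classification\<close>

definition classified :: "('v \<times> 'v \<times> 'v) set \<Rightarrow> bool" where
  "classified S \<longleftrightarrow>
      (\<exists>a b c. a \<noteq> 0 \<and> q a = 0 \<and> b \<noteq> 0 \<and> q b = 0 \<and> c \<noteq> 0 \<and> q c = 0 \<and>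
         (a, 0, 0) \<in> S \<and> (0, b, 0) \<in> S \<and> (0, 0, c) \<in> S) \<or>
      (\<exists>a b c. a \<noteq> 0 \<and> q a = 0 \<and> b \<noteq> 0 \<and> q b = 0 \<and> c \<noteq> 0 \<and> q c = 0 \<and>
         (a, b, 0) \<in> S \<and> (0, b, c) \<in> S) \<or>
      (\<exists>k1 k2 S1 S2 P Q T \<phi>. first_kind_data scale q m k1 k2 S1 S2 P Q T \<phi> \<and>
         S = first_kind_space scale S1 S2 P Q T \<phi>) \<or>
      (\<exists>k1 k2 S1 S2 P Q B T y z \<phi>. second_kind_data scale q m k1 k2 S1 S2 P Q B T y z \<phi> \<and>
         S = second_kind_space scale S1 S2 P Q T y z \<phi>)"

lemma wreath_actionI:
  assumes "\<And>i. isometry (g i)" "\<pi> permutes {1..3}"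
  shows "(\<lambda>v. triple (\<lambda>i. g i (coord v (\<pi> i)))) \<in> wreath_action scale q"
  using assms by (auto simp: wreath_action_def orthogonal_group_iff)

lemma wreath_diagonal:
  assumes "isometry f" "isometry g" "isometry h"
  shows "(\<lambda>(a, b, c). (f a, g b, h c)) \<in> wreath_action scale q"
proof -
  define k where "k i = (if i = 1 then f else if i = 2 then g else h)" for i :: nat
  have "(\<lambda>v. triple (\<lambda>i. k i (coord v (id i)))) \<in> wreath_action scale q"
    by (rule wreath_actionI[OF _ permutes_id]) (use assms in \<open>simp add: k_def\<close>)
  moreover have "(\<lambda>v. triple (\<lambda>i. k i (coord v (id i)))) = (\<lambda>(a, b, c). (f a, g b, h c))"
    by (auto simp: fun_eq_iff triple_def coord_def k_def)
  ultimately show ?thesis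
    by simp
qed

lemma wreath_id: "id \<in> wreath_action scale q"
  using wreath_diagonal[OF isometry_id isometry_id isometry_id] by (simp add: id_def case_prod_beta')

lemma wreath_swap:
  assumes "i \<in> {1..3}" "j \<in> {1..3}"
  shows "(\<lambda>v. triple (\<lambda>k. coord v (Transposition.transpose i j k))) \<in> wreath_action scale q"
  using wreath_actionI[OF isometry_id permutes_swap_id[OF assms]] by simp

lemma wreath_swaps:
  "(\<lambda>(a, b, c). (b, a, c)) \<in> wreath_action scale q"
  "(\<lambda>(a, b, c). (a, c, b)) \<in> wreath_action scale q"
  "(\<lambda>(a, b, c). (c, b, a)) \<in> wreath_action scale q"
proof -
  have "(\<lambda>v. triple (\<lambda>k. coord v (Transposition.transpose 1 2 k))) = (\<lambda>(a :: 'v, b, c). (b, a, c))"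
    "(\<lambda>v. triple (\<lambda>k. coord v (Transposition.transpose 2 3 k))) = (\<lambda>(a :: 'v, b, c). (a, c, b))"
    "(\<lambda>v. triple (\<lambda>k. coord v (Transposition.transpose 1 3 k))) = (\<lambda>(a :: 'v, b, c). (c, b, a))"
    by (auto simp: fun_eq_iff triple_def coord_def Transposition.transpose_def)
  then show "(\<lambda>(a, b, c). (b, a, c)) \<in> wreath_action scale q"
    "(\<lambda>(a, b, c). (a, c, b)) \<in> wreath_action scale q"
    "(\<lambda>(a, b, c). (c, b, a)) \<in> wreath_action scale q"
    using wreath_swap[of 1 2] wreath_swap[of 2 3] wreath_swap[of 1 3] by simp_all
qed

lemma wreath_comp:
  assumes "f \<in> wreath_action scale q" "f' \<in> wreath_action scale q"
  shows "f \<circ> f' \<in> wreath_action scale q"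
proof -
  obtain g \<pi> where f: "f = (\<lambda>v. triple (\<lambda>i. g i (coord v (\<pi> i))))"
    "\<forall>i\<in>{1..3}. isometry (g i)" "\<pi> permutes {1..3}"
    using assms(1) by (auto simp: wreath_action_def orthogonal_group_iff)
  obtain g' \<pi>' where f': "f' = (\<lambda>v. triple (\<lambda>i. g' i (coord v (\<pi>' i))))"
    "\<forall>i\<in>{1..3}. isometry (g' i)" "\<pi>' permutes {1..3}"
    using assms(2) by (auto simp: wreath_action_def orthogonal_group_iff)
  have coord_triple: "coord (triple h) i = h i" if "i \<in> {1..3}" for h :: "nat \<Rightarrow> 'v" and i
  proof -
    have "i = 1 \<or> i = 2 \<or> i = 3"
      using that by auto
    then show ?thesis
      by (auto simp: coord_def triple_def)
  qed
  have \<pi>: "\<pi> i \<in> {1..3}" if "i \<in> {1..3}" for i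
    using permutes_in_image[OF f(3)] that by blast
  have "f \<circ> f' = (\<lambda>v. triple (\<lambda>i. (g i \<circ> g' (\<pi> i)) (coord v ((\<pi>' \<circ> \<pi>) i))))"
  proof
    fix v
    have "triple h = triple h'" if "\<And>i. i \<in> {1..3} \<Longrightarrow> h i = h' i" for h h' :: "nat \<Rightarrow> 'v"
      using that by (simp add: triple_def)
    then show "(f \<circ> f') v = triple (\<lambda>i. (g i \<circ> g' (\<pi> i)) (coord v ((\<pi>' \<circ> \<pi>) i)))"
      unfolding f(1) f'(1) o_apply using coord_triple[OF \<pi>] by presburger
  qed
  moreover have "\<forall>i\<in>{1..3}. isometry (g i \<circ> g' (\<pi> i))"
    using f(2) f'(2) \<pi> isometry_comp by blast
  ultimately show ?thesis
    using permutes_compose[OF f(3) f'(3)] unfolding wreath_action_def orthogonal_group_iff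
    by (intro CollectI exI[of _ "\<lambda>i. g i \<circ> g' (\<pi> i)"] exI[of _ "\<pi>' \<circ> \<pi>"] conjI)
qed

definition conjugate_classified :: "('v \<times> 'v \<times> 'v) set \<Rightarrow> bool" where
  "conjugate_classified S \<longleftrightarrow> (\<exists>g\<in>wreath_action scale q. classified (g ` S))"

lemma conjugate_classifiedI:
  "h \<in> wreath_action scale q \<Longrightarrow> classified (h ` S) \<Longrightarrow> conjugate_classified S"
  by (auto simp: conjugate_classified_def)

lemma conjugate_classified_image:
  assumes "h \<in> wreath_action scale q" "conjugate_classified (h ` S)"
  shows "conjugate_classified S"
proof -
  obtain g where "g \<in> wreath_action scale q" "classified (g ` h ` S)"
    using assms(2) by (auto simp: conjugate_classified_def)
  then show ?thesis
    using wreath_comp[OF _ assms(1)] by (intro conjugate_classifiedI[of "g \<circ> h"]) (auto simp: image_comp)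
qed

text \<open>
  The trichotomy for the radical \<open>A\<^sub>1\<^sub>2 \<inter> A\<^sub>1\<^sub>3\<close>: it contains a singular vector outside \<open>S\<^sub>1\<close>, or
  equals \<open>S\<^sub>1\<close>, or is \<open>S\<^sub>1 + {0, y}\<close> with \<open>y\<close> non-singular.  In the first case the two vectors
  \<open>(a, b, 0)\<close> and \<open>(a, 0, c)\<close> share their first entry, which the exchange of the first two
  coordinates brings into the middle.
\<close>

lemma classification_ordered:
  assumes S: "triple_lagrangian q S" and no3: "\<And>c. (0, 0, c) \<in> S \<Longrightarrow> c = 0"
    and card: "card (triple_lagrangian.S2 S) \<le> card (triple_lagrangian.S1 S)"
  shows "conjugate_classified S"
proof -
  interpret triple_lagrangian q S by fact
  obtain L where L: "lagrangian UNIV L"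
    using exists_lagrangian by blast
  consider (linked) a where "a \<in> A12 \<inter> A13" "q a = 0" "a \<notin> S1"
    | (first) "A12 \<inter> A13 = S1"
    | (second) y where "y \<in> A12 \<inter> A13" "q y = 1" "\<And>a. a \<in> A12 \<inter> A13 \<Longrightarrow> q a = 0 \<Longrightarrow> a \<in> S1"
  proof (cases "A12 \<inter> A13 = S1 \<or> (\<exists>a\<in>A12 \<inter> A13. q a = 0 \<and> a \<notin> S1)")
    case True
    then show thesis
      using linked first by blast
  next
    case False
    then obtain y where "y \<in> A12 \<inter> A13" "y \<notin> S1"
      using S1_subset by blast
    moreover from this have "q y = 1"
      using False by auto
    ultimately show thesis
      using second False by blast
  qed
  then show ?thesis
  proof cases
    case linked
    then obtain b c where bc: "(a, b, 0) \<in> S" "(a, 0, c) \<in> S"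
      by (auto simp: slots_iff)
    then have "a \<noteq> 0" "b \<noteq> 0" "c \<noteq> 0"
      using linked(3) by (auto simp: slots_iff)
    moreover have "q b = 0" "q c = 0"
      using q_S12[OF bc(1)] q_S13[OF bc(2)] linked(2) by simp_all
    moreover have "(b, a, 0) \<in> (\<lambda>(a, b, c). (b, a, c)) ` S" "(0, a, c) \<in> (\<lambda>(a, b, c). (b, a, c)) ` S"
      using bc by force+
    ultimately have "\<exists>a b' c. a \<noteq> 0 \<and> q a = 0 \<and> b' \<noteq> 0 \<and> q b' = 0 \<and> c \<noteq> 0 \<and> q c = 0 \<and>
        (a, b', 0) \<in> (\<lambda>(a, b, c). (b, a, c)) ` S \<and> (0, b', c) \<in> (\<lambda>(a, b, c). (b, a, c)) ` S"
      using linked(2) by (intro exI[of _ b] exI[of _ a] exI[of _ c] conjI)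
    then have "classified ((\<lambda>(a, b, c). (b, a, c)) ` S)"
      unfolding classified_def by (rule disjI2[OF disjI1])
    then show ?thesis
      by (rule conjugate_classifiedI[OF wreath_swaps(1)])
  next
    case first
    have S1A: "S1 \<subseteq> A12" "S1 \<subseteq> A13"
      using S1_subset by auto
    obtain P where P: "f2_subspace P" "P \<subseteq> A12" "S1 \<inter> P = {0}" "S1 + P = A12"
      by (rule exists_complement[OF f2_subspace_slots(3,1) S1A(1)])
    obtain Q where Q: "f2_subspace Q" "Q \<subseteq> A13" "S1 \<inter> Q = {0}" "S1 + Q = A13"
      by (rule exists_complement[OF f2_subspace_slots(4,1) S1A(2)])
    have cases: "(0 :: 'v) = 0 \<and> (0 :: 'v) = 0 \<and> (0 :: 'v) = 0 \<or> (\<exists>y\<in>P \<inter> Q. polar q y 0 = 1)"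
      by simp
    show ?thesis
    proof (rule normalise_coordinates[OF card no3 P(1,3,2) Q(1,3,2) zero_S q_0 q_0 q_0 cases])
      fix g h S'
      assume S': "isometry g" "isometry h" "S' = (\<lambda>(a, b, c). (a, g b, h c)) ` S"
        "triple_lagrangian q S'" "triple_lagrangian.S1 S' = S1" "triple_lagrangian.S2 S' \<subseteq> S1"
        "triple_lagrangian.A12 S' = A12" "triple_lagrangian.A13 S' = A13"
        "\<And>c. (0, 0, c) \<in> S' \<Longrightarrow> c = 0" "\<And>p. p \<in> P \<Longrightarrow> (p, p, 0) \<in> S'"
        "\<And>x. x \<in> Q \<Longrightarrow> (x, 0, x) \<in> S'"
      have "\<exists>k1 k2 S1 S2 P Q T \<phi>. first_kind_data scale q m k1 k2 S1 S2 P Q T \<phi> \<and>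
          S' = first_kind_space scale S1 S2 P Q T \<phi>"
        by (rule first_kind[where P = P and Q = Q])
           (use S' first P Q in simp_all)
      then have "classified S'"
        unfolding classified_def by blast
      then show ?thesis
        using conjugate_classifiedI[OF wreath_diagonal[OF isometry_id S'(1,2)], of S] S'(3) by simp
    qed
  next
    case second
    have "A12 \<inter> A13 = S1 + {0, y}"
    proof
      show "S1 + {0, y} \<subseteq> A12 \<inter> A13"
        using second(1) S1_subset f2_subspace_slots
          f2_subspace_0[OF f2_subspace_slots(3)] f2_subspace_0[OF f2_subspace_slots(4)]
        by (simp add: plus_subset_iff f2_subspace_line f2_subspace_Int)
      show "A12 \<inter> A13 \<subseteq> S1 + {0, y}"
      proof
        fix a assume a: "a \<in> A12 \<inter> A13"
        show "a \<in> S1 + {0, y}"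
        proof (cases "q a = 0")
          case True
          then show ?thesis
            using second(3)[OF a] subset_plus_left[of "{0, y}" S1] by blast
        next
          case False
          have "polar q a y = 0"
            using a second(1) perp_A12 perpD(2) by blast
          then have "q (a + y) = 0"
            using False second(2) by (simp add: q_add)
          then have "a + y \<in> S1"
            using second(3) f2_subspace_add[OF f2_subspace_Int[OF f2_subspace_slots(3,4)] a second(1)]
            by blast
          then have "(a + y) + y \<in> S1 + {0, y}"
            by (intro set_plus_intro) auto
          then show ?thesis
            by (simp add: add.assoc)
        qed
      qed
    qed
    note rad = this
    obtain P M where P: "f2_subspace P" "(S1 + {0, y}) \<inter> P = {0}" "S1 + {0, y} + P = A12"
      "P \<inter> perp q P = {0}" "lagrangian P M"
      using exists_plus_type_complement[OF f2_subspace_slots(3) _ f2_subspace_slots(1) q_S1 second(2)]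
        rad perp_A12 by metis
    obtain Q N where Q: "f2_subspace Q" "(S1 + {0, y}) \<inter> Q = {0}" "S1 + {0, y} + Q = A13"
      "Q \<inter> perp q Q = {0}" "lagrangian Q N"
      using exists_plus_type_complement[OF f2_subspace_slots(4) _ f2_subspace_slots(1) q_S1 second(2)]
        rad perp_A13 by (metis Int_commute)
    note M = P(5) and N = Q(5)
    interpret second_kind_split q S y P Q
      using no3 rad second(2) P Q by unfold_locales auto
    obtain z where z: "z \<in> perp q (S1 + P + Q)" "polar q y z = 1" "q z = 0"
      using exists_singular_partner[OF L M N] by blast
    obtain b c where bc: "(z, b, c) \<in> S" "q b = 0" "q c = 0"
      using exists_singular_lift[OF L N z] by blast
    have sub: "P + {0, y} \<subseteq> A12" "Q + {0, y} \<subseteq> A13"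
      using P_line(3) Q_line(3) subset_plus_right f2_subspace_0[OF f2_subspace_slots(1)] by blast+
    have y_lines: "y \<in> P + {0, y}" "y \<in> Q + {0, y}"
      using subset_plus_right[OF f2_subspace_0[OF P(1)], of "{0, y}"]
        subset_plus_right[OF f2_subspace_0[OF Q(1)], of "{0, y}"] by auto
    then have cases: "z = 0 \<and> b = 0 \<and> c = 0 \<or> (\<exists>y\<in>(P + {0, y}) \<inter> (Q + {0, y}). polar q y z = 1)"
      using z(2) by blast
    show ?thesis
    proof (rule normalise_coordinates[OF card no3 P_line(1,2) sub(1) Q_line(1,2) sub(2) bc(1) z(3)
          bc(2,3) cases])
      fix g h S'
      assume S': "isometry g" "isometry h" "S' = (\<lambda>(a, b, c). (a, g b, h c)) ` S"
        "triple_lagrangian q S'" "triple_lagrangian.S1 S' = S1" "triple_lagrangian.S2 S' \<subseteq> S1"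
        "triple_lagrangian.A12 S' = A12" "triple_lagrangian.A13 S' = A13"
        "\<And>c. (0, 0, c) \<in> S' \<Longrightarrow> c = 0" "\<And>p. p \<in> P + {0, y} \<Longrightarrow> (p, p, 0) \<in> S'"
        "\<And>x. x \<in> Q + {0, y} \<Longrightarrow> (x, 0, x) \<in> S'" "(z, z, z) \<in> S'"
      interpret S': triple_lagrangian q S'
        by (rule S'(4))
      have "P \<subseteq> P + {0, y}" "Q \<subseteq> Q + {0, y}"
        using subset_plus_left by blast+
      then have "second_kind_normal q S' y P Q z"
        using S'(9-12) y_lines rad second(2) P(1-4) Q(1-4) z
        by unfold_locales (auto simp: S'(5-8))
      then have "classified S'"
        using second_kind[OF _ _ M N] S'(5,6) unfolding classified_def by simp
      then show ?thesis
        using conjugate_classifiedI[OF wreath_diagonal[OF isometry_id S'(1,2)], of S] S'(3) by simp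
    qed
  qed
qed

lemma classification:
  assumes "triple_lagrangian q S"
  shows "conjugate_classified S"
proof -
  have no3: "conjugate_classified X"
    if X: "triple_lagrangian q X" "\<And>c. (0, 0, c) \<in> X \<Longrightarrow> c = 0" for X
  proof (cases "card (triple_lagrangian.S2 X) \<le> card (triple_lagrangian.S1 X)")
    case True
    then show ?thesis
      using classification_ordered X by blast
  next
    case False
    define Y where "Y = (\<lambda>(a, b, c). (b, a, c)) ` X"
    have memY: "(b, a, c) \<in> Y \<longleftrightarrow> (a, b, c) \<in> X" for a b c
      by (force simp: Y_def)
    have Y: "triple_lagrangian q Y"
      unfolding Y_def by (rule isometry_preserves_lagrangian_triple[OF X(1) isometry_swaps(1)])
    interpret X: triple_lagrangian q X by (rule X(1))
    interpret Y: triple_lagrangian q Y by (rule Y)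
    have "Y.S1 = X.S2" "Y.S2 = X.S1"
      unfolding Y.S1_def Y.S2_def X.S1_def X.S2_def memY by simp_all
    then have "card Y.S2 \<le> card Y.S1"
      using False by simp
    moreover have "c = 0" if "(0, 0, c) \<in> Y" for c
      using that X(2) unfolding memY by blast
    ultimately have "conjugate_classified Y"
      by (intro classification_ordered[OF Y])
    then show ?thesis
      unfolding Y_def by (rule conjugate_classified_image[OF wreath_swaps(1)])
  qed
  interpret triple_lagrangian q S by fact
  consider (all) a b c where "a \<noteq> 0" "(a, 0, 0) \<in> S" "b \<noteq> 0" "(0, b, 0) \<in> S" "c \<noteq> 0" "(0, 0, c) \<in> S"
    | (one) "\<And>a. (a, 0, 0) \<in> S \<Longrightarrow> a = 0" | (two) "\<And>b. (0, b, 0) \<in> S \<Longrightarrow> b = 0"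
    | (three) "\<And>c. (0, 0, c) \<in> S \<Longrightarrow> c = 0"
    by blast
  then show ?thesis
  proof cases
    case all
    then have "q a = 0" "q b = 0" "q c = 0"
      using q_S[OF all(2)] q_S[OF all(4)] q_S[OF all(6)] by simp_all
    then have "\<exists>a b c. a \<noteq> 0 \<and> q a = 0 \<and> b \<noteq> 0 \<and> q b = 0 \<and> c \<noteq> 0 \<and> q c = 0 \<and>
        (a, 0, 0) \<in> id ` S \<and> (0, b, 0) \<in> id ` S \<and> (0, 0, c) \<in> id ` S"
      using all by (intro exI[of _ a] exI[of _ b] exI[of _ c]) simp
    then have "classified (id ` S)"
      unfolding classified_def by (rule disjI1)
    then show ?thesis
      by (rule conjugate_classifiedI[OF wreath_id])
  next
    case one
    have "conjugate_classified ((\<lambda>(a, b, c). (c, b, a)) ` S)"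
      by (rule no3[OF isometry_preserves_lagrangian_triple[OF assms isometry_swaps(3)]])
         (use one in auto)
    then show ?thesis
      by (rule conjugate_classified_image[OF wreath_swaps(3)])
  next
    case two
    have "conjugate_classified ((\<lambda>(a, b, c). (a, c, b)) ` S)"
      by (rule no3[OF isometry_preserves_lagrangian_triple[OF assms isometry_swaps(2)]])
         (use two in auto)
    then show ?thesis
      by (rule conjugate_classified_image[OF wreath_swaps(2)])
  next
    case three
    then show ?thesis
      using no3 assms by blast
  qed
qed

lemma maximal_imp_triple_lagrangian:
  assumes "maximal_totally_singular (scale3 scale) (q3 q) UNIV S"
  shows "triple_lagrangian q S"
proof -
  interpret triple: f2_quadratic_space "q3 q"
    by (rule f2_quadratic_space_triple)
  obtain L where L: "lagrangian UNIV L"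
    using exists_lagrangian by blast
  have "triple.lagrangian UNIV (L \<times> L \<times> L)"
  proof -
    have sub: "f2_subspace L" "\<forall>v\<in>L. q v = 0" "perp q L = L"
      using L by (auto simp: lagrangian_def)
    have "(a, b, c) \<in> perp (q3 q) (L \<times> L \<times> L) \<longleftrightarrow> a \<in> L \<and> b \<in> L \<and> c \<in> L" for a b c
    proof
      assume abc: "(a, b, c) \<in> perp (q3 q) (L \<times> L \<times> L)"
      have *: "polar q a x + polar q b y + polar q c z = 0" if "x \<in> L" "y \<in> L" "z \<in> L" for x y z
        unfolding polar_q3[symmetric] by (rule triple.perpD(1)[OF abc]) (simp add: that)
      have "polar q a x = 0" "polar q b x = 0" "polar q c x = 0" if "x \<in> L" for x
        using *[of x 0 0] *[of 0 x 0] *[of 0 0 x] that f2_subspace_0[OF sub(1)] by simp_all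
      then have "a \<in> perp q L" "b \<in> perp q L" "c \<in> perp q L"
        by (simp_all add: perp_def)
      then show "a \<in> L \<and> b \<in> L \<and> c \<in> L"
        by (simp add: sub(3))
    next
      assume "a \<in> L \<and> b \<in> L \<and> c \<in> L"
      then show "(a, b, c) \<in> perp (q3 q) (L \<times> L \<times> L)"
        using polar_singular[OF sub(1,2)] by (auto simp: perp_def)
    qed
    then have "perp (q3 q) (L \<times> L \<times> L) = L \<times> L \<times> L"
      by auto
    then show ?thesis
      using sub by (auto simp: triple.lagrangian_def f2_subspace_Times)
  qed
  moreover have "triple.maximal_singular UNIV S"
    using assms module_subspace_iff[OF module_scale3]
    unfolding maximal_totally_singular_def triple.maximal_singular_def totally_singular_def
    by blast
  ultimately have "triple.lagrangian UNIV S"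
    using triple.maximal_singular_imp_lagrangian[OF f2_subspace_UNIV] by (simp add: triple.perp_UNIV)
  then show ?thesis
    by unfold_locales
qed

end

theorem theorem4p11:
  fixes scale :: "bit \<Rightarrow> 'v::ab_group_add \<Rightarrow> 'v"
    and q :: "'v \<Rightarrow> bit"
    and m :: nat
    and S :: "('v \<times> 'v \<times> 'v) set"
  assumes "\<exists>Basis. finite_dimensional_vector_space scale Basis"
    and "vector_space.dim scale (UNIV :: 'v set) = 2 * m"
    and "quadratic_form scale q"
    and "plus_type scale q (UNIV :: 'v set)"
    and "maximal_totally_singular (scale3 scale) (q3 q) UNIV S"
  shows "\<exists>g \<in> wreath_action scale q.
      (\<exists>a b c. a \<noteq> 0 \<and> q a = 0 \<and> b \<noteq> 0 \<and> q b = 0 \<and> c \<noteq> 0 \<and> q c = 0 \<and>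
         (a, 0, 0) \<in> g ` S \<and> (0, b, 0) \<in> g ` S \<and> (0, 0, c) \<in> g ` S) \<or>
      (\<exists>a b c. a \<noteq> 0 \<and> q a = 0 \<and> b \<noteq> 0 \<and> q b = 0 \<and> c \<noteq> 0 \<and> q c = 0 \<and>
         (a, b, 0) \<in> g ` S \<and> (0, b, c) \<in> g ` S) \<or>
      (\<exists>k1 k2 S1 S2 P Q T \<phi>. first_kind_data scale q m k1 k2 S1 S2 P Q T \<phi> \<and>
         g ` S = first_kind_space scale S1 S2 P Q T \<phi>) \<or>
      (\<exists>k1 k2 S1 S2 P Q B T y z \<phi>. second_kind_data scale q m k1 k2 S1 S2 P Q B T y z \<phi> \<and>
         g ` S = second_kind_space scale S1 S2 P Q T y z \<phi>)"
proof -
  obtain Basis where "finite_dimensional_vector_space scale Basis"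
    using assms(1) by blast
  then interpret plus_space scale Basis q m
    using assms(2-4) by (intro plus_space.intro plus_space_axioms.intro)
  show ?thesis
    using classification[OF maximal_imp_triple_lagrangian[OF assms(5)]]
    unfolding conjugate_classified_def classified_def .
qed

end
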